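(* Let $T$ be an ergodic automorphism of a standard probability Borel space $(X,\mathcal{B},\mu)$ with $\mu$ non-atomic and let $f:X\to\mathbb{R}_+$ be a square integrable roof function with $f\ge c$ for some $c>0$. Suppose there exist measurable sets $W_n\subset X$, an increasing sequence $\{q_n\}$ of natural numbers, a real sequence $\{a_n\}$, a real number $0<\alpha\le 1$ and $P\in\mathcal{P}(\mathbb{R}^2)$ such that, with $q_n'=2q_n$ and $a_n'=2a_n$: (C1) $\mu(W_n)\to\alpha$; (C2) $\mu(W_n\triangle T^{-1}W_n)\to 0$; (C3) $\{q_n\}$ is a rigidity sequence for $T$ along $\{W_n\}$; (C4) $\{q_n'\}$ is a rigidity sequence for $T$ along $\{W_n\}$; (C5) $\{\int_{W_n}|f_n|^2d\mu\}_n$ is bounded, where $f_n=f^{(q_n)}-a_n$; (C6) $\{\int_{W_n}|f_n'|^2d\mu\}_n$ is bounded, where $f_n'=f^{(q_n')}-a_n'$; (C7) $(f_n',f_n)_*(\mu_{W_n})\to P$ weakly in $\mathcal{P}(\mathbb{R}^2)$. Let $\xi:\mathbb{R}^2\to\mathbb{R}$, $\xi(x,y)=x-2y$. Assume that $\xi_*P=\sum_{i=0}^m c_i\delta_{d_i}$ is a discrete measure with $d_0=0$, $\sum_{i=1}^m c_i>\frac{1-\alpha}{\alpha}$ and $d_i\neq -d_j$ for $i\neq j$. Then the special flow $T^f$ is not isomorphic to its inverse.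
   Context: For $n\in\mathbb{Z}$: $f^{(n)}=f+f\circ T+\cdots+f\circ T^{n-1}$ for $n>0$, $f^{(0)}=0$, $f^{(n)}=-(f\circ T^{-1}+\cdots+f\circ T^{n})$ for $n<0$. $\mu_W(A)=\mu(A\cap W)/\mu(W)$. $\{q_n\}$ is a rigidity sequence for $T$ along $\{W_n\}$ if $\mu((T^{-q_n}A\triangle A)\cap W_n)\to 0$ for all $A\in\mathcal{B}$. The special flow $T^f$ acts on $X^f=\{(x,s):0\le s<f(x)\}$ with measure the restriction of $\mu\otimes Leb$, moving points upward at unit speed and identifying $(x,f(x))$ with $(Tx,0)$. It is isomorphic to its inverse if there is a measure-preserving automorphism $S$ of $X^f$ with $T^f_tS=ST^f_{-t}$ for all $t\in\mathbb{R}$. *)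

theory Defs
  imports "HOL-Probability.Probability"
begin

text \<open>Standard Borel space: measurably isomorphic to a Borel subset of the real line
  (every standard Borel space is, by Kuratowski's theorem).\<close>
definition standard_borel_space :: "'a measure \<Rightarrow> bool" where
  "standard_borel_space M \<longleftrightarrow>
     (\<exists>(B::real set) \<phi> \<psi>. B \<in> sets borel \<and>
        \<phi> \<in> measurable M (restrict_space borel B) \<and>
        \<psi> \<in> measurable (restrict_space borel B) M \<and>
        (\<forall>x\<in>space M. \<psi> (\<phi> x) = x) \<and> (\<forall>y\<in>B. \<phi> (\<psi> y) = y))"

definition non_atomic :: "'a measure \<Rightarrow> bool" where
  "non_atomic M \<longleftrightarrow>
     (\<forall>A\<in>sets M. emeasure M A > 0 \<longrightarrow>
        (\<exists>B\<in>sets M. B \<subseteq> A \<and> 0 < emeasure M B \<and> emeasure M B < emeasure M A))"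

definition mp_automorphism :: "'a measure \<Rightarrow> ('a \<Rightarrow> 'a) \<Rightarrow> bool" where
  "mp_automorphism M T \<longleftrightarrow>
     bij_betw T (space M) (space M) \<and>
     T \<in> measurable M M \<and> inv_into (space M) T \<in> measurable M M \<and>
     distr M M T = M"

definition ergodic :: "'a measure \<Rightarrow> ('a \<Rightarrow> 'a) \<Rightarrow> bool" where
  "ergodic M T \<longleftrightarrow>
     (\<forall>A\<in>sets M. T -` A \<inter> space M = A \<longrightarrow> measure M A = 0 \<or> measure M A = 1)"

definition ipow :: "'a measure \<Rightarrow> ('a \<Rightarrow> 'a) \<Rightarrow> int \<Rightarrow> 'a \<Rightarrow> 'a" where
  "ipow M T n = (if 0 \<le> n then T ^^ nat n else (inv_into (space M) T) ^^ nat (- n))"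

definition cocycle :: "'a measure \<Rightarrow> ('a \<Rightarrow> 'a) \<Rightarrow> ('a \<Rightarrow> real) \<Rightarrow> int \<Rightarrow> 'a \<Rightarrow> real" where
  "cocycle M T f n x =
     (if 0 \<le> n then (\<Sum>k<nat n. f ((T ^^ k) x))
      else - (\<Sum>k\<in>{1..nat (- n)}. f (((inv_into (space M) T) ^^ k) x)))"

definition rigidity_along :: "'a measure \<Rightarrow> ('a \<Rightarrow> 'a) \<Rightarrow> (nat \<Rightarrow> nat) \<Rightarrow> (nat \<Rightarrow> 'a set) \<Rightarrow> bool" where
  "rigidity_along M T q W \<longleftrightarrow>
     (\<forall>A\<in>sets M. (\<lambda>n. measure M (sym_diff ((T ^^ q n) -` A \<inter> space M) A \<inter> W n))
                 \<longlonglongrightarrow> 0)"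

definition weak_conv_measures :: "(nat \<Rightarrow> 'b::metric_space measure) \<Rightarrow> 'b measure \<Rightarrow> bool" where
  "weak_conv_measures Ps P \<longleftrightarrow>
     (\<forall>g :: 'b \<Rightarrow> real. continuous_on UNIV g \<and> bounded (range g) \<longrightarrow>
        (\<lambda>n. integral\<^sup>L (Ps n) g) \<longlonglongrightarrow> integral\<^sup>L P g)"

definition sf_space :: "'a measure \<Rightarrow> ('a \<Rightarrow> real) \<Rightarrow> ('a \<times> real) set" where
  "sf_space M f = {(x, s). x \<in> space M \<and> 0 \<le> s \<and> s < f x}"

definition sf_measure :: "'a measure \<Rightarrow> ('a \<Rightarrow> real) \<Rightarrow> ('a \<times> real) measure" where
  "sf_measure M f = restrict_space (M \<Otimes>\<^sub>M lborel) (sf_space M f)"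

definition special_flow :: "'a measure \<Rightarrow> ('a \<Rightarrow> 'a) \<Rightarrow> ('a \<Rightarrow> real) \<Rightarrow> real \<Rightarrow> 'a \<times> real \<Rightarrow> 'a \<times> real" where
  "special_flow M T f t p =
     (let x = fst p; u = snd p + t;
          n = (THE n::int. cocycle M T f n x \<le> u \<and> u < cocycle M T f (n + 1) x)
      in (ipow M T n x, u - cocycle M T f n x))"

definition special_flow_iso_inverse :: "'a measure \<Rightarrow> ('a \<Rightarrow> 'a) \<Rightarrow> ('a \<Rightarrow> real) \<Rightarrow> bool" where
  "special_flow_iso_inverse M T f \<longleftrightarrow>
     (let N = sf_measure M f in
      \<exists>S S'. S \<in> measurable N N \<and> S' \<in> measurable N N \<and>
        distr N N S = N \<and>
        (AE z in N. S' (S z) = z) \<and> (AE z in N. S (S' z) = z) \<and>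
        (\<forall>t. AE z in N. special_flow M T f t (S z) = S (special_flow M T f (- t) z)))"

end

theory Submission
  imports Defs
begin

text \<open>
  Put $a = a_n$. On the part of the phase space over $W_n$, the flow satisfies
  $T^f_{a}(x,s) = T^f_{-f_n(x)}(T^{q_n}x, s)$, and likewise for $2a$ and $f_n'$. By rigidity $T^{q_n}x$ may be
  replaced by $x$, and since $f_n \circ T - f_n = f \circ T^{q_n} - f$ tends to $0$ on the almost invariant sets
  $W_n$, ergodicity makes $(f_n', f_n)$ asymptotically independent of $x$. Hence the law of the triple
  $(z, T^f_{a}z, T^f_{2a}z)$ dominates in the limit $\alpha$ times the law of $(z, T^f_{-v}z, T^f_{-u}z)$
  with $(u,v)$ distributed by $P$. If $S$ conjugates the flow to its inverse, the law of the triple is invariant under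
  applying $S$ to each entry and reversing the order, so the limit also dominates $\alpha$ times the law of
  $(T^f_{u}z, T^f_{v}z, z)$. By aperiodicity the first law lives on triples with $\xi \in \{d_i\}$, and
  the second gives mass $\sum_{i \ge 1} c_i$ to triples with $\xi = -d_i$, $i \ge 1$, which is disjoint
  from the former. Comparing total masses, $\alpha (1 + \sum_{i\ge 1} c_i) \le 1$, a contradiction.
\<close>

section \<open>The special flow\<close>

text \<open>Three points are needed because a pair carries no trace of the reversal: by invariance
  of the flow, (T^f_v z, z) and (z, T^f_{-v} z) have the same law. For a triple (z, T^f_{-s} z,
  T^f_{-t} z) on an aperiodic orbit the number t - 2 s is a function of the triple. It equals u - 2
  v on (z, T^f_{-v} z, T^f_{-u} z); on (T^f_u z, T^f_v z, z) one has s = u - v and t = u, so it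
  equals -(u - 2 v). This is why xi enters and why reversal changes its sign; d_0 = 0 is its own
  negative and separates nothing. The obstacle is that convergence is available only for products of
  three sets, whereas the set separating the two laws is not of this kind. Before the limit, the
  masses of a set and of its complement add up to the total. This gives one inequality between the
  two limit laws, valid first for finite combinations of boxes, then for every measurable E by
  approximating E in both limit laws at once; E is chosen only after that.\<close>

locale mp_system = prob_space M for M :: "'a measure" and T :: "'a \<Rightarrow> 'a" +
  assumes aut: "mp_automorphism M T"
begin

abbreviation Ti :: "'a \<Rightarrow> 'a" where "Ti \<equiv> inv_into (space M) T"

lemma T_meas [measurable]: "T \<in> measurable M M"
  and Ti_meas [measurable]: "Ti \<in> measurable M M"
  and distr_T: "distr M M T = M"
  and bij_T: "bij_betw T (space M) (space M)"
  using aut by (auto simp: mp_automorphism_def)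

lemma T_in [simp]: "x \<in> space M \<Longrightarrow> T x \<in> space M"
  using bij_T by (auto simp: bij_betw_def)

lemma Ti_in [simp]: "x \<in> space M \<Longrightarrow> Ti x \<in> space M"
  using bij_T by (auto simp: bij_betw_def intro: inv_into_into)

lemma T_Ti [simp]: "x \<in> space M \<Longrightarrow> T (Ti x) = x"
  using bij_T by (auto simp: bij_betw_def f_inv_into_f)

lemma Ti_T [simp]: "x \<in> space M \<Longrightarrow> Ti (T x) = x"
  using bij_T by (auto simp: bij_betw_def)

lemma T_funpow_in [simp]: "x \<in> space M \<Longrightarrow> (T ^^ n) x \<in> space M"
  by (induction n) auto

lemma Ti_funpow_in [simp]: "x \<in> space M \<Longrightarrow> (Ti ^^ n) x \<in> space M"
  by (induction n) auto

lemma T_funpow_meas [measurable]: "T ^^ n \<in> measurable M M"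
  by (induction n) (auto simp: id_def)

lemma Ti_funpow_meas [measurable]: "Ti ^^ n \<in> measurable M M"
  by (induction n) (auto simp: id_def)

lemma distr_T_funpow: "distr M M (T ^^ n) = M"
proof (induction n)
  case 0 then show ?case by (simp add: id_def)
next
  case (Suc n)
  have "distr M M (T ^^ Suc n) = distr (distr M M (T ^^ n)) M T"
    by (subst distr_distr) (auto simp: comp_def)
  then show ?case using Suc distr_T by (simp del: funpow.simps)
qed

lemma integral_T_funpow:
  fixes h :: "'a \<Rightarrow> real"
  assumes [measurable]: "h \<in> borel_measurable M"
  shows "(LINT x|M. h ((T ^^ n) x)) = (LINT x|M. h x)"
proof -
  have "(LINT x|distr M M (T ^^ n). h x) = (LINT x|M. h ((T ^^ n) x))"
    by (intro integral_distr) auto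
  then show ?thesis by (simp add: distr_T_funpow)
qed

lemma integrable_T_funpow:
  fixes h :: "'a \<Rightarrow> real"
  assumes "integrable M h"
  shows "integrable M (\<lambda>x. h ((T ^^ n) x))"
proof -
  have "integrable (distr M M (T ^^ n)) h" using assms by (simp add: distr_T_funpow)
  then show ?thesis by (rule integrable_distr[rotated]) auto
qed

lemma ipow_0 [simp]: "ipow M T 0 x = x"
  by (simp add: ipow_def)

lemma ipow_of_nat: "ipow M T (int n) = T ^^ n"
  by (simp add: ipow_def)

lemma ipow_in [simp]: "x \<in> space M \<Longrightarrow> ipow M T n x \<in> space M"
  by (simp add: ipow_def)

lemma ipow_meas [measurable]: "ipow M T n \<in> measurable M M"
  by (simp add: ipow_def)

lemma ipow_Suc: 
  assumes "x \<in> space M"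
  shows "ipow M T (n + 1) x = T (ipow M T n x)"
proof (cases "0 \<le> n")
  case True
  then show ?thesis by (simp add: ipow_def nat_add_distrib)
next
  case False
  then obtain k where n: "n = - int (Suc k)"
    by (metis int_cases not_le of_nat_0_le_iff)
  have "n + 1 = - int k" using n by simp
  then have "ipow M T (n + 1) x = (Ti ^^ k) x"
    by (auto simp: ipow_def)
  then show ?thesis using assms by (simp add: ipow_def n nat_add_distrib)
qed

lemma ipow_add:
  assumes "x \<in> space M"
  shows "ipow M T (m + n) x = ipow M T m (ipow M T n x)"
proof (induction m rule: int_induct[where k=0])
  case (step1 i)
  then show ?case using assms ipow_Suc[of x "i + n"] ipow_Suc[of "ipow M T n x" i]
    by (simp add: ac_simps)
next
  case (step2 i)
  \<comment> \<open>The recursion \<open>ipow_Suc\<close> only raises the exponent, so the downward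
    step is proved after applying the injective map \<open>T\<close>.\<close>
  have "T (ipow M T (i - 1 + n) x) = T (ipow M T (i - 1) (ipow M T n x))"
    using assms step2 ipow_Suc[of x "i - 1 + n"] ipow_Suc[of "ipow M T n x" "i - 1"]
    by (simp add: ac_simps)
  then show ?case using bij_T assms by (auto simp: bij_betw_def inj_on_def)
qed auto

end

section \<open>The cocycle, the fibre reached after a given time, and the suspension\<close>

locale suspension = mp_system M T for M :: "'a measure" and T +
  fixes f :: "'a \<Rightarrow> real" and c :: real
  assumes f_meas [measurable]: "f \<in> borel_measurable M"
    and f_int: "integrable M f"
    and c_pos: "0 < c" and f_ge: "x \<in> space M \<Longrightarrow> c \<le> f x"
begin

abbreviation \<Omega> :: "('a \<times> real) set" where "\<Omega> \<equiv> sf_space M f"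
abbreviation cc :: "int \<Rightarrow> 'a \<Rightarrow> real" where "cc \<equiv> cocycle M T f"

lemma cc_0 [simp]: "cc 0 x = 0" by (simp add: cocycle_def)

lemma cc_meas [measurable]: "cc n \<in> borel_measurable M"
  unfolding cocycle_def[abs_def] by (cases "0 \<le> n") simp_all

lemma cc_Suc:
  assumes "x \<in> space M"
  shows "cc (n + 1) x = cc n x + f (ipow M T n x)"
proof (cases "0 \<le> n")
  case True
  then show ?thesis by (simp add: cocycle_def ipow_def nat_add_distrib)
next
  case False
  then obtain k where n: "n = - int (Suc k)"
    by (metis int_cases not_le of_nat_0_le_iff)
  have n1: "n + 1 = - int k" using n by simp
  have "cc (n + 1) x = - (\<Sum>k\<in>{1..k}. f ((Ti ^^ k) x))"
    unfolding n1 by (auto simp: cocycle_def)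
  moreover have "cc n x = - (\<Sum>k\<in>{1..Suc k}. f ((Ti ^^ k) x))"
    unfolding n by (simp add: cocycle_def nat_add_distrib)
  ultimately show ?thesis using assms by (simp add: ipow_def n nat_add_distrib)
qed

lemma cc_1: "x \<in> space M \<Longrightarrow> cc 1 x = f x"
  using cc_Suc[of x 0] by simp

lemma cc_add:
  assumes "x \<in> space M"
  shows "cc (m + n) x = cc n x + cc m (ipow M T n x)"
proof (induction m rule: int_induct[where k=0])
  case (step1 i)
  then show ?case using assms cc_Suc[of x "i + n"] cc_Suc[of "ipow M T n x" i]
    by (simp add: ac_simps ipow_add)
next
  case (step2 i)
  then show ?case
    using assms step2 cc_Suc[of x "i - 1 + n"] cc_Suc[of "ipow M T n x" "i - 1"]
      ipow_add[of x "i - 1" n]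
    by (simp add: add.commute[of n] add_diff_eq diff_add_eq)
qed auto

text \<open>The roof is at least \<open>c\<close>, so the cocycle grows at least linearly in both
  directions; existence and uniqueness of the fibre index rest on this.\<close>

lemma cc_mono:
  assumes x: "x \<in> space M" and "n \<le> m"
  shows "cc n x + c * of_int (m - n) \<le> cc m x"
  using \<open>n \<le> m\<close>
proof (induction m rule: int_ge_induct)
  case (step i)
  have "c \<le> f (ipow M T i x)" using x f_ge by simp
  then show ?case using step cc_Suc[OF x, of i] by (simp add: algebra_simps)
qed simp

lemma cc_less_cancel:
  assumes "x \<in> space M" "cc n x < cc m x" shows "n < m"
proof (rule ccontr)
  assume "\<not> n < m"
  then have "cc m x + c * of_int (n - m) \<le> cc n x" using cc_mono[of x m n] assms by simp
  moreover have "0 \<le> c * of_int (n - m)" using c_pos \<open>\<not> n < m\<close> by simp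
  ultimately show False using assms by simp
qed

lemma cc_index_ex1:
  assumes x: "x \<in> space M"
  shows "\<exists>!n. cc n x \<le> u \<and> u < cc (n + 1) x"
proof
  \<comment> \<open>For \<open>n \<le> 0\<close> the cocycle is at most \<open>c * n\<close>; the
    minimum with 0 stays in that range, and rounding \<open>u / c\<close> down makes
    \<open>c * n0 \<le> u\<close>. For \<open>n \<ge> 0\<close> the cocycle is at least
    \<open>c * n\<close>, which bounds the candidates from above.\<close>
  define n0 where "n0 = min 0 \<lfloor>u / c\<rfloor>"
  define A where "A = {n. n0 \<le> n \<and> cc n x \<le> u}"
  have le: "real_of_int \<lfloor>u / c\<rfloor> * c \<le> u"
    using c_pos by (metis of_int_floor_le pos_le_divide_eq)
  have "cc n0 x \<le> c * n0"
    using cc_mono[OF x, of n0 0] by (simp add: n0_def)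
  also have "c * n0 \<le> u" using le c_pos
    by (smt (verit) mult.commute mult_left_mono n0_def of_int_le_iff)
  finally have n0: "n0 \<in> A" by (simp add: A_def)
  have bound: "n \<le> max 0 \<lfloor>u / c\<rfloor>" if "n \<in> A" for n
  proof (cases "0 \<le> n")
    case True
    then have "c * n \<le> u" using cc_mono[OF x, of 0 n] that by (simp add: A_def)
    then show ?thesis using c_pos by (simp add: le_floor_iff pos_le_divide_eq mult.commute le_max_iff_disj)
  qed simp
  have "finite A" by (rule finite_subset[of _ "{n0..max 0 \<lfloor>u / c\<rfloor>}"]) (use bound in \<open>auto simp: A_def\<close>)
  then have m: "Max A \<in> A" "\<And>n. n \<in> A \<Longrightarrow> n \<le> Max A" using n0 by (auto intro: Max_in)
  have "Max A + 1 \<notin> A" using m(2)[of "Max A + 1"] by auto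
  then show "cc (Max A) x \<le> u \<and> u < cc (Max A + 1) x"
    using m(1) by (auto simp: A_def)
  fix n assume n: "cc n x \<le> u \<and> u < cc (n + 1) x"
  have "cc n x < cc (Max A + 1) x" "cc (Max A) x < cc (n + 1) x"
    using n \<open>cc (Max A) x \<le> u \<and> u < cc (Max A + 1) x\<close> by linarith+
  then show "n = Max A" using cc_less_cancel[OF x] by (metis add1_zle_eq add_le_cancel_right antisym_conv)
qed

definition idx :: "'a \<Rightarrow> real \<Rightarrow> int" where
  "idx x u = (THE n. cc n x \<le> u \<and> u < cc (n + 1) x)"

lemma idx_eq_iff:
  assumes "x \<in> space M"
  shows "idx x u = n \<longleftrightarrow> cc n x \<le> u \<and> u < cc (n + 1) x"
  using theI'[OF cc_index_ex1[OF assms], of u] cc_index_ex1[OF assms, of u]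
  unfolding idx_def by blast

lemma idx_bounds:
  assumes "x \<in> space M"
  shows "cc (idx x u) x \<le> u" "u < cc (idx x u + 1) x"
  using idx_eq_iff[OF assms, of u "idx x u"] by auto

text \<open>The projection of X x R onto the suspension, its quotient by (x, u) ~ (T x, u - f x).
  Admitting all real heights turns the flow into translation of \<open>u\<close>.\<close>

definition flow_pt :: "'a \<Rightarrow> real \<Rightarrow> 'a \<times> real" where
  "flow_pt x u = (ipow M T (idx x u) x, u - cc (idx x u) x)"

abbreviation fl :: "real \<Rightarrow> 'a \<times> real \<Rightarrow> 'a \<times> real" where "fl \<equiv> special_flow M T f"
abbreviation N :: "('a \<times> real) measure" where "N \<equiv> sf_measure M f"

lemma fl_eq: "fl t z = flow_pt (fst z) (snd z + t)"
  by (simp add: special_flow_def flow_pt_def idx_def Let_def)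

lemma flow_pt_in [simp]:
  assumes x: "x \<in> space M" shows "flow_pt x u \<in> \<Omega>"
proof -
  have "cc (idx x u) x \<le> u \<and> u < cc (idx x u + 1) x"
    using idx_eq_iff[OF x] by blast
  then show ?thesis using x by (simp add: flow_pt_def sf_space_def cc_Suc)
qed

lemma flow_pt_base:
  assumes "(x, s) \<in> \<Omega>" shows "flow_pt x s = (x, s)"
proof -
  have "idx x s = 0" using assms by (subst idx_eq_iff) (auto simp: sf_space_def cc_1)
  then show ?thesis by (simp add: flow_pt_def)
qed

text \<open>The fibre index of the new pair is that of the old one minus \<open>k\<close>, so both
  project to the same point. With \<open>k = q n\<close> this trades flowing for the time
  \<open>a n\<close> against \<open>T ^^ q n\<close> on the base and the time
  \<open>- fq n x\<close>.\<close>

lemma flow_pt_shift: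
  assumes x: "x \<in> space M"
  shows "flow_pt (ipow M T k x) (u - cc k x) = flow_pt x u"
proof -
  define n where "n = idx x u"
  have n: "cc n x \<le> u \<and> u < cc (n + 1) x" using idx_eq_iff[OF x] unfolding n_def by blast
  have "idx (ipow M T k x) (u - cc k x) = n - k"
    using x n cc_add[OF x, of "n - k" k] cc_add[OF x, of "n - k + 1" k]
    by (subst idx_eq_iff) (auto simp: algebra_simps)
  then show ?thesis
    using x cc_add[OF x, of "n - k" k] ipow_add[OF x, of "n - k" k]
    by (simp add: flow_pt_def n_def)
qed

lemma flow_pt_shift_T:
  assumes x: "x \<in> space M"
  shows "flow_pt (T x) (u - f x) = flow_pt x u"
  using flow_pt_shift[OF x, of 1 u] x ipow_of_nat[of 1] by (simp add: cc_1)

lemma fl_in [simp]: "z \<in> \<Omega> \<Longrightarrow> fl t z \<in> \<Omega>"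
  unfolding fl_eq by (rule flow_pt_in) (auto simp: sf_space_def)

lemma fl_flow_pt: 
  assumes "x \<in> space M"
  shows "fl t (flow_pt x u) = flow_pt x (u + t)"
  using flow_pt_shift[OF assms, of "idx x u" "u + t"]
  by (simp add: fl_eq flow_pt_def[of x u] algebra_simps)

lemma fl_fl: "z \<in> \<Omega> \<Longrightarrow> fl s (fl t z) = fl (t + s) z"
  using fl_flow_pt[of "fst z" s "snd z + t"] by (cases z) (simp add: fl_eq[of t] fl_eq[of "t + s"] sf_space_def add.assoc)

lemma fl_0: "z \<in> \<Omega> \<Longrightarrow> fl 0 z = z"
  by (cases z) (simp add: fl_eq flow_pt_base)

section \<open>Measurability of the flow and its invariant measure\<close>

lemma idx_meas [measurable]: "(\<lambda>p. idx (fst p) (snd p)) \<in> measurable (M \<Otimes>\<^sub>M borel) (count_space UNIV)"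
proof (rule measurable_count_space_eq2_countable[THEN iffD2], safe)
  fix n :: int
  have "(\<lambda>p. idx (fst p) (snd p)) -` {n} \<inter> space (M \<Otimes>\<^sub>M borel) =
    {p \<in> space (M \<Otimes>\<^sub>M borel). cc n (fst p) \<le> snd p \<and> snd p < cc (n + 1) (fst p)}"
    using idx_bounds by (auto simp: space_pair_measure idx_eq_iff)
  also have "\<dots> \<in> sets (M \<Otimes>\<^sub>M borel)" by measurable
  finally show "(\<lambda>p. idx (fst p) (snd p)) -` {n} \<inter> space (M \<Otimes>\<^sub>M borel) \<in> sets (M \<Otimes>\<^sub>M borel)" .
qed auto

lemma sf_space_sets [measurable]: "\<Omega> \<in> sets (M \<Otimes>\<^sub>M lborel)"
proof -
  have "\<Omega> = {p \<in> space (M \<Otimes>\<^sub>M lborel). 0 \<le> snd p \<and> snd p < f (fst p)}"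
    by (auto simp: sf_space_def space_pair_measure)
  also have "\<dots> \<in> sets (M \<Otimes>\<^sub>M lborel)" by measurable
  finally show ?thesis .
qed

lemma sf_space_sets' [measurable]: "\<Omega> \<in> sets (M \<Otimes>\<^sub>M borel)"
  using sf_space_sets by (simp add: sets_pair_measure_cong[OF refl sets_lborel])

lemma space_N [simp]: "space N = \<Omega>"
  by (auto simp: sf_measure_def space_restrict_space space_pair_measure sf_space_def)

lemma sets_N: "sets N = sets (restrict_space (M \<Otimes>\<^sub>M borel) (\<Omega>))"
  unfolding sf_measure_def by (intro sets_restrict_space_cong sets_pair_measure_cong) auto

lemma flow_pt_meas [measurable]: "(\<lambda>p. flow_pt (fst p) (snd p)) \<in> measurable (M \<Otimes>\<^sub>M borel) N"
proof -
  have "(\<lambda>p. flow_pt (fst p) (snd p)) \<in> measurable (M \<Otimes>\<^sub>M borel) (restrict_space (M \<Otimes>\<^sub>M borel) (\<Omega>))"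
  proof (rule measurable_restrict_space2)
    show "(\<lambda>p. flow_pt (fst p) (snd p)) \<in> space (M \<Otimes>\<^sub>M borel) \<rightarrow> \<Omega>"
      by (auto simp: space_pair_measure)
    have "(\<lambda>p. (\<lambda>n p. (ipow M T n (fst p), snd p - cc n (fst p))) (idx (fst p) (snd p)) p)
      \<in> measurable (M \<Otimes>\<^sub>M borel) (M \<Otimes>\<^sub>M borel)"
      by (rule measurable_compose_countable[OF _ idx_meas]) measurable
    then show "(\<lambda>p. flow_pt (fst p) (snd p)) \<in> measurable (M \<Otimes>\<^sub>M borel) (M \<Otimes>\<^sub>M borel)"
      by (simp add: flow_pt_def)
  qed
  then show ?thesis by (simp add: measurable_cong_sets[OF refl sets_N])
qed

lemma measurable_N_pair: "measurable N L = measurable (restrict_space (M \<Otimes>\<^sub>M borel) (\<Omega>)) L"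
  by (intro measurable_cong_sets sets_N refl)

lemma fst_N [measurable]: "fst \<in> measurable N M"
  and snd_N [measurable]: "snd \<in> borel_measurable N"
  unfolding measurable_N_pair by (auto intro: measurable_restrict_space1)

lemma fl_meas2 [measurable]: "(\<lambda>p. fl (fst p) (snd p)) \<in> measurable (borel \<Otimes>\<^sub>M N) N"
proof -
  have "(\<lambda>p. (fst (snd p), snd (snd p) + fst p)) \<in> measurable (borel \<Otimes>\<^sub>M N) (M \<Otimes>\<^sub>M borel)"
    by measurable
  from measurable_compose[OF this flow_pt_meas] show ?thesis by (simp add: fl_eq)
qed

lemma fl_meas [measurable]: "fl t \<in> measurable N N"
  using measurable_compose[OF measurable_Pair1' fl_meas2, of t] by simp

text \<open>The integrand is written through \<open>flow_pt\<close> because \<open>g\<close> is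
  measurable on the suspension only, while \<open>g (flow_pt x s)\<close> is measurable on the whole
  product.\<close>

lemma nn_integral_N:
  assumes [measurable]: "g \<in> borel_measurable N"
  shows "(\<integral>\<^sup>+z. g z \<partial>N) = (\<integral>\<^sup>+x. \<integral>\<^sup>+s. g (flow_pt x s) * indicator {0..<f x} s \<partial>lborel \<partial>M)"
proof -
  have [measurable]: "(\<lambda>p. g (flow_pt (fst p) (snd p))) \<in> borel_measurable (M \<Otimes>\<^sub>M lborel)"
    using measurable_compose[OF flow_pt_meas assms] by (simp add: measurable_cong_sets[OF sets_pair_measure_cong[OF refl sets_lborel] refl])
  have "(\<integral>\<^sup>+z. g z \<partial>N) = (\<integral>\<^sup>+z. g (flow_pt (fst z) (snd z)) \<partial>N)"
    by (intro nn_integral_cong) (auto simp: flow_pt_base)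
  also have "\<dots> = (\<integral>\<^sup>+z. g (flow_pt (fst z) (snd z)) * indicator (\<Omega>) z \<partial>(M \<Otimes>\<^sub>M lborel))"
    unfolding sf_measure_def using sets.Int[OF sf_space_sets sets.top]
    by (intro nn_integral_restrict_space) auto
  also have "\<dots> = (\<integral>\<^sup>+x. \<integral>\<^sup>+s. g (flow_pt x s) * indicator (\<Omega>) (x, s) \<partial>lborel \<partial>M)"
    by (subst lborel.nn_integral_fst[symmetric]) auto
  also have "\<dots> = (\<integral>\<^sup>+x. \<integral>\<^sup>+s. g (flow_pt x s) * indicator {0..<f x} s \<partial>lborel \<partial>M)"
    by (intro nn_integral_cong) (auto simp: sf_space_def indicator_def)
  finally show ?thesis .
qed

lemma finite_N: "finite_measure N"
proof
  have "emeasure N (space N) = (\<integral>\<^sup>+x. \<integral>\<^sup>+s. 1 * indicator {0..<f x} s \<partial>lborel \<partial>M)"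
    by (subst nn_integral_N[symmetric]) auto
  also have "\<dots> = (\<integral>\<^sup>+x. ennreal (f x) \<partial>M)"
    using f_ge c_pos by (intro nn_integral_cong) (fastforce simp: less_le_trans order_less_imp_le)
  also have "\<dots> < \<infinity>" using f_int by (simp add: integrable_iff_bounded nn_integral_mono order_le_less_trans[rotated])
  finally show "emeasure N (space N) \<noteq> \<infinity>" by simp
qed


text \<open>
  For the lift $G$ of $1_A$ to $X \times \mathbb{R}$ one has
  $\int_0^t G(x,r)\,dr + \int_t^{f(x)+t} G(x,r)\,dr = \int_0^{f(x)} G(x,r)\,dr + \int_0^t G(Tx,r)\,dr$;
  integrating over $x$, the finite outer terms cancel by the invariance of the base measure.
\<close>

lemma emeasure_fl_nonneg:
  assumes A [measurable]: "A \<in> sets N" and t: "0 \<le> t"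
  shows "emeasure N (fl t -` A \<inter> space N) = emeasure N A"
proof -
  define G :: "'a \<Rightarrow> real \<Rightarrow> ennreal" where "G x r = indicator A (flow_pt x r)" for x r
  have G_meas: "(\<lambda>p. G (fst p) (snd p)) \<in> borel_measurable (M \<Otimes>\<^sub>M borel)"
    unfolding G_def by (rule measurable_compose[OF flow_pt_meas]) measurable
  have [measurable]: "(\<lambda>p. G (fst p) (snd p)) \<in> borel_measurable (M \<Otimes>\<^sub>M lborel)"
    using G_meas by (simp add: measurable_cong_sets[OF sets_pair_measure_cong[OF refl sets_lborel] refl])
  have Gx [measurable]: "G x \<in> borel_measurable borel" if "x \<in> space M" for x
    using measurable_compose[OF measurable_Pair1'[OF that] G_meas] by simp
  have GT: "G (T x) (r - f x) = G x r" if "x \<in> space M" for x r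
    using that by (simp add: G_def flow_pt_shift_T)
  define a where "a x = (\<integral>\<^sup>+r. G x r * indicator {0..<t} r \<partial>lborel)" for x
  define b where "b x = (\<integral>\<^sup>+r. G x r * indicator {0..<f x} r \<partial>lborel)" for x
  define b' where "b' x = (\<integral>\<^sup>+r. G x r * indicator {t..<f x + t} r \<partial>lborel)" for x
  have meas [measurable]: "a \<in> borel_measurable M" "b \<in> borel_measurable M" "b' \<in> borel_measurable M"
    unfolding a_def b_def b'_def atLeastLessThan_def atLeast_def lessThan_def by measurable
  have eq: "a x + b' x = b x + a (T x)" if x: "x \<in> space M" for x
  proof -
    note [measurable] = Gx[OF x]
    have fx: "0 < f x" using c_pos f_ge[OF x] by simp
    have "a (T x) = (\<integral>\<^sup>+r. G (T x) (- f x + 1 * r) * indicator {0..<t} (- f x + 1 * r) \<partial>lborel)"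
      unfolding a_def using nn_integral_real_affine[of "\<lambda>r. G (T x) r * indicator {0..<t} r" 1 "- f x"] Gx[of "T x"] x
      by simp
    also have "\<dots> = (\<integral>\<^sup>+r. G x r * indicator {f x..<f x + t} r \<partial>lborel)"
      using GT[OF x] by (intro nn_integral_cong) (auto simp: indicator_def)
    finally have aT: "a (T x) = (\<integral>\<^sup>+r. G x r * indicator {f x..<f x + t} r \<partial>lborel)" .
    show ?thesis unfolding aT unfolding a_def b_def b'_def
      using t fx
      by (subst (1 2) nn_integral_add[symmetric])
         (auto intro!: nn_integral_cong simp: indicator_def)
  qed
  have "(\<integral>\<^sup>+x. a x \<partial>M) \<le> (\<integral>\<^sup>+x. ennreal t \<partial>M)"
  proof (rule nn_integral_mono)
    fix x
    have "a x \<le> (\<integral>\<^sup>+r. indicator {0..<t} r \<partial>lborel)"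
      unfolding a_def G_def by (intro nn_integral_mono) (auto simp: indicator_def)
    then show "a x \<le> ennreal t" using t by simp
  qed
  then have fin: "(\<integral>\<^sup>+x. a x \<partial>M) \<noteq> \<infinity>"
    by (simp add: emeasure_space_1 top_unique[symmetric]) (metis ennreal_neq_top top_unique)
  have "(\<integral>\<^sup>+x. a (T x) \<partial>M) = (\<integral>\<^sup>+x. a x \<partial>distr M M T)"
    by (subst nn_integral_distr) auto
  then have aT: "(\<integral>\<^sup>+x. a (T x) \<partial>M) = (\<integral>\<^sup>+x. a x \<partial>M)"
    by (simp add: distr_T)
  have "(\<integral>\<^sup>+x. a x \<partial>M) + (\<integral>\<^sup>+x. b' x \<partial>M) = (\<integral>\<^sup>+x. b x + a (T x) \<partial>M)"
    by (subst nn_integral_add[symmetric]) (auto intro!: nn_integral_cong eq)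
  also have "\<dots> = (\<integral>\<^sup>+x. a x \<partial>M) + (\<integral>\<^sup>+x. b x \<partial>M)"
    by (subst nn_integral_add) (auto simp: aT add.commute)
  finally have main: "(\<integral>\<^sup>+x. b' x \<partial>M) = (\<integral>\<^sup>+x. b x \<partial>M)"
    using fin by (simp add: ennreal_add_left_cancel)
  have "emeasure N (fl t -` A \<inter> space N) = (\<integral>\<^sup>+z. indicator (fl t -` A \<inter> space N) z \<partial>N)"
    using measurable_sets[OF fl_meas A, of t] by simp
  also have "\<dots> = (\<integral>\<^sup>+x. \<integral>\<^sup>+s. indicator (fl t -` A \<inter> space N) (flow_pt x s) * indicator {0..<f x} s \<partial>lborel \<partial>M)"
    by (rule nn_integral_N) measurable
  also have "\<dots> = (\<integral>\<^sup>+x. b' x \<partial>M)"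
  proof (rule nn_integral_cong)
    fix x assume x: "x \<in> space M"
    note [measurable] = Gx[OF x]
    have "(\<integral>\<^sup>+s. indicator (fl t -` A \<inter> space N) (flow_pt x s) * indicator {0..<f x} s \<partial>lborel)
      = (\<integral>\<^sup>+s. G x (t + 1 * s) * indicator {t..<f x + t} (t + 1 * s) \<partial>lborel)"
      using x by (intro nn_integral_cong) (auto simp: G_def indicator_def fl_flow_pt add.commute)
    also have "\<dots> = b' x"
      unfolding b'_def using nn_integral_real_affine[of "\<lambda>r. G x r * indicator {t..<f x + t} r" 1 t] by simp
    finally show "(\<integral>\<^sup>+s. indicator (fl t -` A \<inter> space N) (flow_pt x s) * indicator {0..<f x} s \<partial>lborel) = b' x" .
  qed
  also have "\<dots> = (\<integral>\<^sup>+z. indicator A z \<partial>N)"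
    unfolding main using nn_integral_N[of "indicator A"] by (simp add: b_def[abs_def] G_def)
  also have "\<dots> = emeasure N A" by simp
  finally show ?thesis .
qed

lemma distr_fl: "distr N N (fl t) = N"
proof (cases "0 \<le> t")
  case True
  show ?thesis by (rule measure_eqI) (use True in \<open>auto simp: emeasure_distr emeasure_fl_nonneg simp del: space_N\<close>)
next
  case False
  have 1: "distr N N (fl (- t)) = N"
    by (rule measure_eqI) (use False in \<open>auto simp: emeasure_distr emeasure_fl_nonneg simp del: space_N\<close>)
  have "distr N N (fl t) = distr (distr N N (fl (- t))) N (fl t)"
    by (simp add: 1)
  also have "\<dots> = distr N N (\<lambda>z. fl t (fl (- t) z))"
    by (subst distr_distr) (auto simp: comp_def)
  also have "\<dots> = distr N N (\<lambda>z. z)"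
    by (rule distr_cong) (auto simp: fl_fl fl_0)
  finally show ?thesis by simp
qed

end

section \<open>The pointwise and mean ergodic theorems\<close>

locale ergodic_system = mp_system +
  assumes erg: "ergodic M T"

section \<open>Birkhoff sums and the maximal inequality\<close>

context mp_system
begin

definition bsum :: "('a \<Rightarrow> real) \<Rightarrow> nat \<Rightarrow> 'a \<Rightarrow> real" where
  "bsum h n x = (\<Sum>k<n. h ((T ^^ k) x))"

lemma bsum_0 [simp]: "bsum h 0 x = 0"
  by (simp add: bsum_def)

lemma bsum_Suc_left: "bsum h (Suc n) x = h x + bsum h n (T x)"
  unfolding bsum_def by (subst sum.lessThan_Suc_shift) (simp add: funpow_swap1)

lemma bsum_diff_const: "bsum (\<lambda>x. h x - e) n x = bsum h n x - n * e"
  by (simp add: bsum_def sum_subtractf)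

lemma integrable_bsum: "integrable M h \<Longrightarrow> integrable M (bsum h n)"
  unfolding bsum_def[abs_def] by (intro Bochner_Integration.integrable_sum integrable_T_funpow)

lemma bsum_meas [measurable]: "h \<in> borel_measurable M \<Longrightarrow> bsum h n \<in> borel_measurable M"
  unfolding bsum_def[abs_def] by (intro borel_measurable_sum measurable_compose[OF T_funpow_meas])

text \<open>The empty sum takes part in the maximum: this makes \<open>bmax\<close> nonnegative,
  which settles the points without a positive sum in \<open>maximal_ergodic\<close>.\<close>

primrec bmax :: "('a \<Rightarrow> real) \<Rightarrow> nat \<Rightarrow> 'a \<Rightarrow> real" where
  "bmax h 0 x = 0"
| "bmax h (Suc n) x = max (bmax h n x) (bsum h (Suc n) x)"

lemma bmax_ge: "k \<le> n \<Longrightarrow> bsum h k x \<le> bmax h n x"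
  by (induction n) (auto simp: le_Suc_eq)

lemma bmax_attained: "\<exists>k\<le>n. bmax h n x = bsum h k x"
proof (induction n)
  case (Suc n)
  then show ?case by (auto simp: max_def intro: le_SucI)
qed (auto intro: exI[of _ 0])

lemma bmax_nonneg: "0 \<le> bmax h n x"
  using bmax_ge[of 0 n h x] by simp

lemma integrable_bmax: "integrable M h \<Longrightarrow> integrable M (bmax h n)"
proof (induction n)
  case 0
  have "bmax h 0 = (\<lambda>x. 0)" by (rule ext) simp
  then show ?case by simp
next
  case (Suc n)
  have "bmax h (Suc n) = (\<lambda>x. max (bmax h n x) (bsum h (Suc n) x))" by (rule ext) simp
  then show ?case using Suc by (simp add: integrable_bsum)
qed

text \<open>Garsia's argument: where some sum is positive, the maximum is attained at some
  \<open>k \<ge> 1\<close>, and splitting off the first term bounds it by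
  \<open>h x + bmax h n (T x)\<close>; elsewhere \<open>bmax h n x\<close> is 0. The integral of
  \<open>bmax h n x - bmax h n (T x)\<close> is 0 by invariance.\<close>

lemma maximal_ergodic:
  assumes h: "integrable M h"
  shows "0 \<le> (LINT x|M. h x * indicator {x. \<exists>k\<le>n. 0 < bsum h k x} x)"
proof -
  let ?g = "\<lambda>x. h x * indicator {x. \<exists>k\<le>n. 0 < bsum h k x} x"
  have [measurable]: "h \<in> borel_measurable M" using h by auto
  have "integrable M (\<lambda>x. bmax h n ((T ^^ 1) x))"
    by (intro integrable_T_funpow integrable_bmax h)
  then have bi: "integrable M (bmax h n)" "integrable M (\<lambda>x. bmax h n (T x))"
    using integrable_bmax[OF h] by simp_all
  have "0 = (LINT x|M. bmax h n x - bmax h n (T x))"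
    using bi integral_T_funpow[of "bmax h n" 1] by auto
  also have "\<dots> \<le> (LINT x|M. ?g x)"
  proof (rule integral_mono)
    have "{x \<in> space M. \<exists>k\<le>n. 0 < bsum h k x} \<in> sets M" by measurable
    then have "integrable M (\<lambda>x. h x * indicator {x \<in> space M. \<exists>k\<le>n. 0 < bsum h k x} x)"
      by (intro integrable_real_mult_indicator h)
    then show "integrable M (\<lambda>x. ?g x)"
      by (rule Bochner_Integration.integrable_cong[THEN iffD1, rotated 2]) (auto simp: indicator_def)
    fix x
    obtain k where k: "k \<le> n" "bmax h n x = bsum h k x" using bmax_attained by blast
    show "bmax h n x - bmax h n (T x) \<le> ?g x"
    proof (cases "\<exists>k\<le>n. 0 < bsum h k x")
      case True
      then have "0 < bsum h k x" using bmax_ge k by (metis order_less_le_trans)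
      then obtain j where j: "k = Suc j" by (cases k) auto
      then show ?thesis using True k bmax_ge[of j n h "T x"] by (simp add: bsum_Suc_left)
    next
      case False
      then show ?thesis using k bmax_nonneg[of h n "T x"] by force
    qed
  qed (use bi in auto)
  finally show ?thesis .
qed

text \<open>As \<open>n\<close> grows, the indicator tends to 1 almost everywhere. The lemma serves
  by contraposition: a negative mean forbids that almost every orbit has a positive sum.\<close>

lemma maximal_ergodic_AE:
  assumes h: "integrable M h" and AE: "AE x in M. \<exists>k. 0 < bsum h k x"
  shows "0 \<le> (LINT x|M. h x)"
proof (rule LIMSEQ_le_const)
  let ?g = "\<lambda>n x. h x * indicator {x. \<exists>k\<le>n. 0 < bsum h k x} x"
  have [measurable]: "h \<in> borel_measurable M" using h by auto
  show "(\<lambda>n. LINT x|M. ?g n x) \<longlonglongrightarrow> (LINT x|M. h x)"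
  proof (rule integral_dominated_convergence[where w="\<lambda>x. norm (h x)"])
    show "AE x in M. (\<lambda>n. ?g n x) \<longlonglongrightarrow> h x"
      using AE
    proof eventually_elim
      case (elim x)
      then obtain k where k: "0 < bsum h k x" by blast
      have "eventually (\<lambda>n. ?g n x = h x) sequentially"
        using eventually_ge_at_top[of k] by eventually_elim (use k in \<open>auto simp: indicator_def\<close>)
      then show ?case by (rule tendsto_eventually)
    qed
  qed (use h in \<open>auto simp: indicator_def\<close>)
  show "\<exists>N. \<forall>n\<ge>N. 0 \<le> (LINT x|M. ?g n x)"
    using maximal_ergodic[OF h] by blast
qed

end

section \<open>From the maximal inequality to the ergodic theorems\<close>

context ergodic_system
begin

text \<open>
  Ergodicity is only available for strictly invariant sets; unlike a set
  $\{x. S_n(x) > 0 \mbox{ for some } n\}$, the set where the Birkhoff sums are unbounded is one.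
\<close>

lemma bsum_bdd_above:
  assumes h: "integrable M h" and neg: "(LINT x|M. h x) < 0"
  shows "AE x in M. \<exists>B. \<forall>n. bsum h n x \<le> B"
proof -
  have [measurable]: "h \<in> borel_measurable M" using h by auto
  define A where "A = {x \<in> space M. \<forall>B::nat. \<exists>n. real B < bsum h n x}"
  have A_sets: "A \<in> sets M" unfolding A_def by measurable
  have unb: "(\<forall>B::nat. \<exists>n. real B < bsum h n x) \<longleftrightarrow> \<not> bdd_above (range (\<lambda>n. bsum h n x))" for x
  proof
    assume *: "\<forall>B::nat. \<exists>n. real B < bsum h n x"
    show "\<not> bdd_above (range (\<lambda>n. bsum h n x))"
    proof
      assume "bdd_above (range (\<lambda>n. bsum h n x))"
      then obtain B where B: "\<And>n. bsum h n x \<le> B" by (auto simp: bdd_above_def)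
      obtain n where "real (nat \<lceil>B\<rceil>) < bsum h n x" using * by blast
      then show False using B[of n] by linarith
    qed
  qed (auto simp: bdd_above_def not_le[symmetric] intro: order_trans)
  have shift: "bdd_above (range (\<lambda>n. bsum h n (T x))) \<longleftrightarrow> bdd_above (range (\<lambda>n. bsum h n x))" for x
  proof
    assume "bdd_above (range (\<lambda>n. bsum h n (T x)))"
    then obtain B where B: "\<And>n. bsum h n (T x) \<le> B" by (auto simp: bdd_above_def)
    have "bsum h n x \<le> max 0 (h x + B)" for n
      using B[of "n - 1"] by (cases n) (auto simp: bsum_Suc_left)
    then show "bdd_above (range (\<lambda>n. bsum h n x))" by (auto simp: bdd_above_def)
  next
    assume "bdd_above (range (\<lambda>n. bsum h n x))"
    then obtain B where B: "\<And>n. bsum h n x \<le> B" by (auto simp: bdd_above_def)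
    have "bsum h n (T x) \<le> B - h x" for n
      using B[of "Suc n"] by (auto simp: bsum_Suc_left)
    then show "bdd_above (range (\<lambda>n. bsum h n (T x)))" by (auto simp: bdd_above_def)
  qed
  have "T -` A \<inter> space M = A"
    unfolding A_def unb using shift by auto
  then have "prob A = 0 \<or> prob A = 1"
    using erg A_sets by (auto simp: ergodic_def)
  moreover have "prob A \<noteq> 1"
  proof
    assume "prob A = 1"
    then have "AE x in M. x \<in> A" using A_sets by (simp add: prob_eq_1)
    then have "AE x in M. \<exists>k. 0 < bsum h k x"
      by eventually_elim (auto simp: A_def dest!: spec[of _ "0::nat"])
    then show False using maximal_ergodic_AE[OF h] neg by simp
  qed
  ultimately have "AE x in M. x \<notin> A" using A_sets by (simp add: prob_eq_0)
  then show ?thesis using AE_space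
    by eventually_elim (auto simp: A_def not_less)
qed

text \<open>This is \<open>bsum_bdd_above\<close> for \<open>h\<close> diminished by its mean and by
  \<open>e\<close>, a function of mean \<open>- e\<close>.\<close>

lemma bsum_upper:
  assumes h: "integrable M h" and e: "0 < e"
  shows "AE x in M. \<exists>B. \<forall>n. bsum h n x \<le> B + n * ((LINT x|M. h x) + e)"
proof -
  have "AE x in M. \<exists>B. \<forall>n. bsum (\<lambda>x. h x - ((LINT x|M. h x) + e)) n x \<le> B"
    by (rule bsum_bdd_above) (use h e in \<open>auto simp: prob_space\<close>)
  then show ?thesis by (simp add: bsum_diff_const algebra_simps)
qed

text \<open>The bounds for \<open>h\<close> and \<open>- h\<close> confine the sum from both sides.
  Taking \<open>e = 1 / Suc j\<close> keeps the exceptional sets countable in number; the constants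
  \<open>B\<close> and \<open>B'\<close> depend on the point but vanish after division by
  \<open>n\<close>.\<close>

lemma birkhoff_AE:
  assumes h: "integrable M h"
  shows "AE x in M. (\<lambda>n. bsum h n x / n) \<longlonglongrightarrow> (LINT x|M. h x)"
proof -
  let ?I = "LINT x|M. h x"
  have m: "bsum (\<lambda>x. - h x) n x = - bsum h n x" for n x
    by (simp add: bsum_def sum_negf)
  have "AE x in M. \<forall>j::nat. \<exists>B. \<forall>n. bsum h n x \<le> B + n * (?I + 1 / Suc j)"
    unfolding AE_all_countable using bsum_upper[OF h] by simp
  moreover have "AE x in M. \<forall>j::nat. \<exists>B. \<forall>n. - bsum h n x \<le> B + n * (- ?I + 1 / Suc j)"
    unfolding AE_all_countable using bsum_upper[of "\<lambda>x. - h x"] h by (simp add: m)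
  ultimately show ?thesis
  proof eventually_elim
    case (elim x)
    show ?case
    proof (rule LIMSEQ_I)
      fix r :: real assume "0 < r"
      then obtain j where j: "1 / Suc j < r / 2" by (metis half_gt_zero nat_approx_posE)
      obtain B where B: "\<And>n. bsum h n x \<le> B + n * (?I + 1 / Suc j)" using elim(1) by blast
      obtain B' where B': "\<And>n. - bsum h n x \<le> B' + n * (- ?I + 1 / Suc j)" using elim(2) by blast
      \<comment> \<open>Beyond \<open>n0\<close> the two constants together cost less than
        \<open>n * r / 2\<close>; the other half of \<open>n * r\<close> pays for
        \<open>n / Suc j\<close>.\<close>
      obtain n0 :: nat where n0: "2 * (\<bar>B\<bar> + \<bar>B'\<bar>) / r < n0" using reals_Archimedean2 by blast
      show "\<exists>no. \<forall>n\<ge>no. norm (bsum h n x / n - ?I) < r"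
      proof (intro exI allI impI)
        fix n assume n: "Suc n0 \<le> n"
        have n_pos: "0 < real n" using n by simp
        have 1: "2 * (\<bar>B\<bar> + \<bar>B'\<bar>) < n * r" using n0 n \<open>0 < r\<close> 
          by (smt (verit) Suc_leD mult_right_mono of_nat_mono pos_divide_less_eq)
        have 2: "n * (1 / Suc j) \<le> n * (r / 2)" using j by (intro mult_left_mono) auto
        have "\<bar>bsum h n x - n * ?I\<bar> < n * r"
          using B[of n] B'[of n] 1 2 unfolding distrib_left mult_minus_right by argo
        moreover have "bsum h n x / n - ?I = (bsum h n x - n * ?I) / n"
          using n_pos by (simp add: field_simps)
        ultimately show "norm (bsum h n x / n - ?I) < r"
          using n_pos by (simp add: pos_divide_less_eq mult.commute)
      qed
    qed
  qed
qed

lemma mean_ergodic: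
  assumes [measurable]: "h \<in> borel_measurable M" and bd: "\<And>x. x \<in> space M \<Longrightarrow> \<bar>h x\<bar> \<le> C"
  shows "(\<lambda>n. LINT x|M. \<bar>bsum h n x / n - (LINT x|M. h x)\<bar>) \<longlonglongrightarrow> 0"
proof -
  let ?I = "LINT x|M. h x"
  have h: "integrable M h" by (rule integrable_const_bound[where B=C]) (use bd in auto)
  have bs: "\<bar>bsum h n x / n\<bar> \<le> \<bar>C\<bar>" if "x \<in> space M" for n x
  proof -
    have "\<bar>bsum h n x\<bar> \<le> (\<Sum>k<n. \<bar>C\<bar>)"
      unfolding bsum_def using that bd
      by (intro order_trans[OF sum_abs] sum_mono order_trans[OF _ abs_ge_self]) auto
    then show ?thesis by (cases "n = 0") (auto simp: field_simps)
  qed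
  have "(\<lambda>n. LINT x|M. \<bar>bsum h n x / n - ?I\<bar>) \<longlonglongrightarrow> (LINT x|M. 0)"
  proof (rule integral_dominated_convergence[where w="\<lambda>x. \<bar>C\<bar> + \<bar>?I\<bar>"])
    show "AE x in M. (\<lambda>n. \<bar>bsum h n x / n - ?I\<bar>) \<longlonglongrightarrow> 0"
      using birkhoff_AE[OF h] by eventually_elim (simp add: LIM_zero tendsto_rabs_zero)
    show "AE x in M. norm \<bar>bsum h n x / n - ?I\<bar> \<le> \<bar>C\<bar> + \<bar>?I\<bar>" for n
    proof (rule AE_I2)
      fix x assume "x \<in> space M"
      from bs[OF this, of n] show "norm \<bar>bsum h n x / n - ?I\<bar> \<le> \<bar>C\<bar> + \<bar>?I\<bar>"
        unfolding real_norm_def by linarith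
    qed
  qed auto
  then show ?thesis by simp
qed

end

section \<open>Rigidity and asymptotic independence\<close>

text \<open>The pattern of the approximation arguments below: replacing a function by a simpler one
  costs \<open>e\<close> uniformly in \<open>n\<close>, and for the simpler one the limit is
  known.\<close>

lemma tendsto_zeroI_approx:
  fixes u :: "nat \<Rightarrow> real"
  assumes "\<And>e. 0 < e \<Longrightarrow> \<exists>b. b \<longlonglongrightarrow> 0 \<and> (\<forall>n. \<bar>u n\<bar> \<le> b n + e)"
  shows "u \<longlonglongrightarrow> 0"
proof (rule LIMSEQ_I)
  fix r :: real assume r: "0 < r"
  obtain b where b: "b \<longlonglongrightarrow> 0" "\<And>n. \<bar>u n\<bar> \<le> b n + r / 2" using assms[of "r / 2"] r by auto
  obtain n0 where n0: "\<And>n. n0 \<le> n \<Longrightarrow> \<bar>b n\<bar> < r / 2" using LIMSEQ_D[OF b(1), of "r / 2"] r by auto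
  show "\<exists>no. \<forall>n\<ge>no. norm (u n - 0) < r"
  proof (intro exI allI impI)
    fix n assume "n0 \<le> n"
    with n0[OF this] b(2)[of n] show "norm (u n - 0) < r" by simp
  qed
qed

lemma tendsto_zero_bound:
  fixes u :: "nat \<Rightarrow> real"
  assumes "b \<longlonglongrightarrow> 0" "\<And>n. \<bar>u n\<bar> \<le> b n"
  shows "u \<longlonglongrightarrow> 0"
  by (rule tendsto_zeroI_approx) (use assms in \<open>auto intro!: exI[of _ b] add_increasing2\<close>)

lemma (in finite_measure) integrable_bounded:
  fixes h :: "'a \<Rightarrow> real"
  assumes "h \<in> borel_measurable M" "\<And>x. x \<in> space M \<Longrightarrow> \<bar>h x\<bar> \<le> C"
  shows "integrable M h"
  by (rule integrable_const_bound[where B=C]) (use assms in auto)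

lemma abs_integral_diff_le:
  fixes f g k :: "'a \<Rightarrow> real"
  assumes f: "integrable M f" and g: "integrable M g" and k: "integrable M k"
    and le: "\<And>x. x \<in> space M \<Longrightarrow> \<bar>f x - g x\<bar> \<le> k x"
  shows "\<bar>(LINT x|M. f x) - (LINT x|M. g x)\<bar> \<le> (LINT x|M. k x)"
proof -
  have "\<bar>(LINT x|M. f x) - (LINT x|M. g x)\<bar> = \<bar>LINT x|M. f x - g x\<bar>" using f g by simp
  also have "\<dots> \<le> (LINT x|M. \<bar>f x - g x\<bar>)" by (rule integral_abs_bound)
  also have "\<dots> \<le> (LINT x|M. k x)" by (rule integral_mono) (use f g k le in auto)
  finally show ?thesis .
qed

section \<open>Rigidity in L1\<close>

locale rigid_suspension = suspension M T f c + ergodic_system M T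
  for M :: "'a measure" and T f c +
  fixes W :: "nat \<Rightarrow> 'a set" and q :: "nat \<Rightarrow> nat" and a :: "nat \<Rightarrow> real"
    and \<alpha> :: real and P :: "(real \<times> real) measure"
  assumes W_sets [measurable]: "W n \<in> sets M"
    and alpha_pos: "0 < \<alpha>"
    and P_prob: "prob_space P" and P_sets [measurable_cong]: "sets P = sets borel"
    and C1: "(\<lambda>n. measure M (W n)) \<longlonglongrightarrow> \<alpha>"
    and C2: "(\<lambda>n. measure M (sym_diff (W n) (T -` W n \<inter> space M))) \<longlonglongrightarrow> 0"
    and C3: "rigidity_along M T q W"
    and C4: "rigidity_along M T (\<lambda>n. 2 * q n) W"
    and C7: "weak_conv_measures
               (\<lambda>n. distr (uniform_measure M (W n)) borel
                  (\<lambda>x. (cocycle M T f (int (2 * q n)) x - 2 * a n,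
                        cocycle M T f (int (q n)) x - a n)))
               P"
begin

definition wt :: "nat \<Rightarrow> 'a \<Rightarrow> real" where "wt n = indicator (W n)"

lemma wt_meas [measurable]: "wt n \<in> borel_measurable M"
  by (simp add: wt_def)

lemma wt_bounds [simp]: "0 \<le> wt n x" "wt n x \<le> 1" "\<bar>wt n x\<bar> \<le> 1"
  by (auto simp: wt_def indicator_def)

lemma integrable_wt: 
  assumes "integrable M h" shows "integrable M (\<lambda>x. wt n x * h x)"
  using integrable_real_mult_indicator[OF W_sets assms, of n] by (simp add: wt_def mult.commute)

text \<open>For an indicator the integral is the measure in the definition of rigidity. Passing to
  limits of simple functions works because \<open>T\<close> preserves the measure: the error at
  \<open>(T ^^ r n) x\<close> has the same integral as the error at \<open>x\<close>, hence is
  uniform in \<open>n\<close>.\<close>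

lemma rigid_L1:
  assumes rig: "rigidity_along M T r W" and h: "integrable M h"
  shows "(\<lambda>n. LINT x|M. wt n x * \<bar>h ((T ^^ r n) x) - h x\<bar>) \<longlonglongrightarrow> 0"
  using h
proof (induction rule: integrable_induct)
  case (base A e)
  have [measurable]: "A \<in> sets M" by fact
  have eq: "(LINT x|M. wt n x * \<bar>indicator A ((T ^^ r n) x) *\<^sub>R e - indicator A x *\<^sub>R e\<bar>)
     = \<bar>e\<bar> * measure M (sym_diff ((T ^^ r n) -` A \<inter> space M) A \<inter> W n)" for n
  proof -
    have "(LINT x|M. wt n x * \<bar>indicator A ((T ^^ r n) x) *\<^sub>R e - indicator A x *\<^sub>R e\<bar>)
      = (LINT x|M. \<bar>e\<bar> * indicator (sym_diff ((T ^^ r n) -` A \<inter> space M) A \<inter> W n) x)"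
    proof (rule Bochner_Integration.integral_cong)
      fix x assume "x \<in> space M"
      then show "wt n x * \<bar>indicator A ((T ^^ r n) x) *\<^sub>R e - indicator A x *\<^sub>R e\<bar>
        = \<bar>e\<bar> * indicator (sym_diff ((T ^^ r n) -` A \<inter> space M) A \<inter> W n) x"
        by (cases "x \<in> A"; cases "(T ^^ r n) x \<in> A"; cases "x \<in> W n") (simp_all add: wt_def)
    qed simp
    moreover have S: "sym_diff ((T ^^ r n) -` A \<inter> space M) A \<inter> W n \<in> sets M"
      using measurable_sets[OF T_funpow_meas \<open>A \<in> sets M\<close>, of "r n"] \<open>A \<in> sets M\<close>
      by auto
    ultimately show ?thesis using sets.sets_into_space[OF S] by (simp add: Int_absorb2)
  qed
  have "(\<lambda>n. measure M (sym_diff ((T ^^ r n) -` A \<inter> space M) A \<inter> W n)) \<longlonglongrightarrow> 0"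
    using rig base by (auto simp: rigidity_along_def)
  from tendsto_mult_left[OF this, of "\<bar>e\<bar>"] show ?case unfolding eq by simp
next
  case (add g h)
  let ?d = "\<lambda>h n x. wt n x * \<bar>h ((T ^^ r n) x) - h x\<bar>"
  have i: "integrable M (\<lambda>x. ?d k n x)" if "integrable M k" for k n
    by (intro integrable_wt integrable_abs Bochner_Integration.integrable_diff integrable_T_funpow that)
  show ?case
  proof (rule tendsto_zero_bound)
    show "(\<lambda>n. (LINT x|M. ?d g n x) + (LINT x|M. ?d h n x)) \<longlonglongrightarrow> 0"
      using tendsto_add[OF add(3,4)] by simp
    fix n
    have "(LINT x|M. wt n x * \<bar>g ((T ^^ r n) x) + h ((T ^^ r n) x) - (g x + h x)\<bar>)
      \<le> (LINT x|M. ?d g n x + ?d h n x)"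
    proof (rule integral_mono)
      fix x
      show "wt n x * \<bar>g ((T ^^ r n) x) + h ((T ^^ r n) x) - (g x + h x)\<bar>
        \<le> ?d g n x + ?d h n x"
        by (auto simp: wt_def indicator_def)
    qed (use i[OF add(1)] i[OF add(2)] i[OF Bochner_Integration.integrable_add[OF add(1,2)]] in auto)
    also have "\<dots> = (LINT x|M. ?d g n x) + (LINT x|M. ?d h n x)"
      using i[OF add(1)] i[OF add(2)] by simp
    finally show "\<bar>LINT x|M. wt n x * \<bar>g ((T ^^ r n) x) + h ((T ^^ r n) x) - (g x + h x)\<bar>\<bar> \<le> \<dots>"
      by (subst abs_of_nonneg) (auto intro!: Bochner_Integration.integral_nonneg)
  qed
next
  case (lim h s)
  let ?d = "\<lambda>h n x. wt n x * \<bar>h ((T ^^ r n) x) - h x\<bar>"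
  have [measurable]: "h \<in> borel_measurable M" "\<And>i. s i \<in> borel_measurable M" using lim by auto
  have i: "integrable M (\<lambda>x. ?d k n x)" if "integrable M k" for k n
    by (intro integrable_wt integrable_abs Bochner_Integration.integrable_diff integrable_T_funpow that)
  \<comment> \<open>The induction rule supplies approximants with
    \<open>\<bar>s i x\<bar> \<le> 2 * \<bar>h x\<bar>\<close>, whence the factor 3 in the
    majorant.\<close>
  have conv: "(\<lambda>i. LINT x|M. \<bar>h x - s i x\<bar>) \<longlonglongrightarrow> (LINT x|M. 0)"
  proof (rule integral_dominated_convergence[where w="\<lambda>x. 3 * \<bar>h x\<bar>"])
    show "AE x in M. (\<lambda>i. \<bar>h x - s i x\<bar>) \<longlonglongrightarrow> 0"
    proof (rule AE_I2)
      fix x assume "x \<in> space M"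
      from tendsto_rabs[OF tendsto_diff[OF tendsto_const[of "h x"] lim(2)[OF this]]]
      show "(\<lambda>i. \<bar>h x - s i x\<bar>) \<longlonglongrightarrow> 0" by simp
    qed
    show "AE x in M. norm \<bar>h x - s i x\<bar> \<le> 3 * \<bar>h x\<bar>" for i
    proof (rule AE_I2)
      fix x assume "x \<in> space M"
      from lim(3)[OF this, of i] show "norm \<bar>h x - s i x\<bar> \<le> 3 * \<bar>h x\<bar>" by simp
    qed
  qed (use lim(4) in auto)
  show ?case
  proof (rule tendsto_zeroI_approx)
    fix e :: real assume e: "0 < e"
    obtain i where i2: "(LINT x|M. \<bar>h x - s i x\<bar>) < e / 2"
      using LIMSEQ_D[OF conv, of "e / 2"] e by fastforce
    let ?b = "\<lambda>n. LINT x|M. ?d (s i) n x"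
    have d: "integrable M (\<lambda>x. \<bar>h x - s i x\<bar>)" using lim by auto
    have "\<bar>LINT x|M. ?d h n x\<bar> \<le> ?b n + e" for n
    proof -
      have "(LINT x|M. ?d h n x)
        \<le> (LINT x|M. ?d (s i) n x + (\<bar>h x - s i x\<bar> + \<bar>h ((T ^^ r n) x) - s i ((T ^^ r n) x)\<bar>))"
      proof (rule integral_mono)
        fix x
        show "?d h n x \<le> ?d (s i) n x + (\<bar>h x - s i x\<bar> + \<bar>h ((T ^^ r n) x) - s i ((T ^^ r n) x)\<bar>)"
          by (auto simp: wt_def indicator_def)
      qed (use i[OF lim(4)] i[OF lim(1)] d integrable_T_funpow[OF d] in auto)
      also have "\<dots> = ?b n + ((LINT x|M. \<bar>h x - s i x\<bar>) + (LINT x|M. \<bar>h ((T ^^ r n) x) - s i ((T ^^ r n) x)\<bar>))"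
        using i[OF lim(1)] d integrable_T_funpow[OF d]
        by (simp del: integrable_abs_iff)
      also have "\<dots> \<le> ?b n + e"
        using i2 integral_T_funpow[of "\<lambda>x. \<bar>h x - s i x\<bar>" "r n"] by simp
      finally show ?thesis
        by (subst abs_of_nonneg) (auto intro!: Bochner_Integration.integral_nonneg)
    qed
    then show "\<exists>b. b \<longlonglongrightarrow> 0 \<and> (\<forall>n. \<bar>LINT x|M. ?d h n x\<bar> \<le> b n + e)"
      using lim(5)[of i] by blast
  qed
qed

definition fq :: "nat \<Rightarrow> 'a \<Rightarrow> real" where "fq n x = cc (int (q n)) x - a n"
definition fq' :: "nat \<Rightarrow> 'a \<Rightarrow> real" where "fq' n x = cc (int (2 * q n)) x - 2 * a n"

lemma fq_meas [measurable]: "fq n \<in> borel_measurable M" "fq' n \<in> borel_measurable M"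
  unfolding fq_def[abs_def] fq'_def[abs_def] by measurable

lemma cc_T_diff:
  assumes "x \<in> space M"
  shows "cc (int k) (T x) - cc (int k) x = f ((T ^^ k) x) - f x"
  using cc_add[OF assms, of "int k" 1] cc_add[OF assms, of 1 "int k"] assms
    ipow_of_nat[of 1] ipow_of_nat[of k] cc_1[of "(T ^^ k) x"]
  by (simp add: cc_1 add.commute)

end

text \<open>Weak convergence would allow any bounded continuous test function. The Lipschitz bound
  converts L1 smallness of the increments of \<open>fq\<close> and \<open>fq'\<close> under
  \<open>T\<close> into L1 smallness of those of \<open>\<psi> (fq' n x, fq n x)\<close>.\<close>

locale rigid_test = rigid_suspension M T f c W q a \<alpha> P 
  for M :: "'a measure" and T f c W q a \<alpha> P +
  fixes \<psi> :: "real \<times> real \<Rightarrow> real" and B L :: real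
  assumes psi_bdd: "\<bar>\<psi> p\<bar> \<le> B"
    and psi_lip: "\<bar>\<psi> (u, v) - \<psi> (u', v')\<bar> \<le> L * (\<bar>u - u'\<bar> + \<bar>v - v'\<bar>)"
begin

lemma B_nonneg: "0 \<le> B" using psi_bdd[of undefined] by linarith

lemma L_nonneg: "0 \<le> L" using order_trans[OF abs_ge_zero psi_lip[of 0 0 1 0]] by simp

lemma psi_cont: "continuous_on UNIV \<psi>"
proof -
  have "(2 * L)-lipschitz_on UNIV \<psi>"
  proof (rule lipschitz_onI)
    fix p p' :: "real \<times> real"
    obtain u v u' v' where p: "p = (u, v)" "p' = (u', v')" by (cases p, cases p')
    have "\<bar>u - u'\<bar> \<le> dist p p'" "\<bar>v - v'\<bar> \<le> dist p p'"
      using dist_fst_le[of p p'] dist_snd_le[of p p'] by (auto simp: p dist_real_def)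
    then have "L * (\<bar>u - u'\<bar> + \<bar>v - v'\<bar>) \<le> L * (2 * dist p p')"
      using L_nonneg by (intro mult_left_mono) auto
    then show "dist (\<psi> p) (\<psi> p') \<le> 2 * L * dist p p'"
      using psi_lip[of u v u' v'] by (simp add: p dist_real_def)
  qed (use L_nonneg in simp)
  then show ?thesis by (rule lipschitz_on_continuous_on)
qed

lemma psi_meas [measurable]: "\<psi> \<in> borel_measurable borel"
  using psi_cont by (rule borel_measurable_continuous_onI)

definition \<Psi> :: "nat \<Rightarrow> 'a \<Rightarrow> real" where "\<Psi> n x = \<psi> (fq' n x, fq n x)"

lemma Psi_meas [measurable]: "\<Psi> n \<in> borel_measurable M"
  unfolding \<Psi>_def[abs_def] by measurable

lemma Psi_bdd: "\<bar>\<Psi> n x\<bar> \<le> B"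
  using psi_bdd by (simp add: \<Psi>_def)

text \<open>By \<open>cc_T_diff\<close> the increments of \<open>fq\<close> and \<open>fq'\<close>
  under \<open>T\<close> are \<open>f\<close> composed with a power of \<open>T\<close> minus
  \<open>f\<close>, so \<open>rigid_L1\<close> for the integrable function \<open>f\<close> along
  \<open>q\<close> and \<open>2 * q\<close> controls them on \<open>W n\<close>.\<close>

lemma Psi_almost_invariant: "(\<lambda>n. LINT x|M. wt n x * \<bar>\<Psi> n (T x) - \<Psi> n x\<bar>) \<longlonglongrightarrow> 0"
proof (rule tendsto_zero_bound)
  let ?p = "\<lambda>n x. wt n x * \<bar>\<Psi> n (T x) - \<Psi> n x\<bar>"
  let ?f = "\<lambda>n x. wt n x * \<bar>f ((T ^^ (2 * q n)) x) - f x\<bar> + wt n x * \<bar>f ((T ^^ q n) x) - f x\<bar>"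
  let ?g = "\<lambda>n x. \<bar>f ((T ^^ (2 * q n)) x) - f x\<bar> + \<bar>f ((T ^^ q n) x) - f x\<bar>"
  let ?I = "\<lambda>r n. LINT x|M. wt n x * \<bar>f ((T ^^ r n) x) - f x\<bar>"
  show "(\<lambda>n. L * (?I (\<lambda>n. 2 * q n) n + ?I q n)) \<longlonglongrightarrow> 0"
    using tendsto_mult_left[OF tendsto_add[OF rigid_L1[OF C4 f_int] rigid_L1[OF C3 f_int]], of L] by simp
  fix n
  have i: "integrable M (\<lambda>x. wt n x * \<bar>f ((T ^^ r) x) - f x\<bar>)" for r
    by (intro integrable_wt integrable_abs Bochner_Integration.integrable_diff integrable_T_funpow f_int)
  have "(LINT x|M. ?p n x)
    \<le> (LINT x|M. L * (?f n x))"
  proof (rule integral_mono)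
    have "\<bar>?p n x\<bar> \<le> 1 * (B + B)" for x
      unfolding abs_mult using Psi_bdd[of n x] Psi_bdd[of n "T x"] by (intro mult_mono) auto
    then show "integrable M (\<lambda>x. ?p n x)"
      by (intro integrable_bounded[where C="1 * (B + B)"]) auto
    fix x assume x: "x \<in> space M"
    have "\<bar>\<Psi> n (T x) - \<Psi> n x\<bar> \<le> L * (?g n x)"
      using psi_lip[of "fq' n (T x)" "fq n (T x)" "fq' n x" "fq n x"]
        cc_T_diff[OF x, of "q n"] cc_T_diff[OF x, of "2 * q n"]
      by (simp add: \<Psi>_def fq_def fq'_def)
    then have "?p n x \<le> wt n x * (L * (?g n x))"
      by (intro mult_left_mono) auto
    then show "?p n x
      \<le> L * (?f n x)"
      by (simp add: algebra_simps)
  qed (use i in auto)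
  also have "\<dots> = L * (?I (\<lambda>n. 2 * q n) n + ?I q n)"
    using i by simp
  finally show "\<bar>LINT x|M. ?p n x\<bar> \<le> \<dots>"
    by (subst abs_of_nonneg) (auto intro!: Bochner_Integration.integral_nonneg)
qed

lemma integrable_wt_Psi:
  assumes [measurable]: "h \<in> borel_measurable M" and "\<And>x. x \<in> space M \<Longrightarrow> \<bar>h x\<bar> \<le> C"
  shows "integrable M (\<lambda>x. wt n x * h x * \<Psi> n x)"
proof (rule integrable_bounded[where C="1 * C * B"])
  fix x assume "x \<in> space M"
  then show "\<bar>wt n x * h x * \<Psi> n x\<bar> \<le> 1 * C * B"
    unfolding abs_mult using assms(2)[of x] Psi_bdd[of n x] by (intro mult_mono) auto
qed measurable

text \<open>By invariance of the measure, the integral of the whole product may be taken at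
  \<open>T x\<close> instead of \<open>x\<close>. After that only the weight and
  \<open>\<Psi>\<close> have to be moved back from \<open>T x\<close> to \<open>x\<close>:
  \<open>\<Psi>\<close> by its almost invariance when both points are in \<open>W n\<close>, the
  weight by the symmetric difference, where \<open>\<Psi>\<close> is at most
  \<open>B\<close>.\<close>

lemma shift_once:
  assumes [measurable]: "h \<in> borel_measurable M" and bd: "\<And>x. x \<in> space M \<Longrightarrow> \<bar>h x\<bar> \<le> C"
  shows "(\<lambda>n. (LINT x|M. wt n x * h (T x) * \<Psi> n x) - (LINT x|M. wt n x * h x * \<Psi> n x)) \<longlonglongrightarrow> 0"
proof (rule tendsto_zero_bound)
  let ?p = "\<lambda>n x. wt n x * \<bar>\<Psi> n (T x) - \<Psi> n x\<bar>"
  let ?f = "\<lambda>n x. wt n x * h (T x) * \<Psi> n x"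
  let ?g = "\<lambda>n x. wt n (T x) * h (T x) * \<Psi> n (T x)"
  let ?d = "\<lambda>n x. indicator (sym_diff (W n) (T -` W n \<inter> space M)) x"
  let ?s = "\<lambda>n. measure M (sym_diff (W n) (T -` W n \<inter> space M))"
  let ?I = "\<lambda>n. LINT x|M. ?p n x"
  show "(\<lambda>n. C * (?I n + B * ?s n)) \<longlonglongrightarrow> 0"
    using tendsto_mult_left[OF tendsto_add[OF Psi_almost_invariant tendsto_mult_left[OF C2, of B]], of C] by simp
  fix n
  obtain x0 where "x0 \<in> space M" using not_empty by auto
  then have C: "0 \<le> C" using bd[of x0] by linarith
  have i1: "integrable M (\<lambda>x. ?f n x)"
    by (rule integrable_wt_Psi[where C=C]) (use bd in auto)
  have i2: "integrable M (\<lambda>x. ?g n x)"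
    using integrable_T_funpow[OF integrable_wt_Psi[OF assms], of n 1] by simp
  have i3: "integrable M (\<lambda>x. ?p n x)"
  proof (rule integrable_bounded[where C="1 * (B + B)"])
    show "\<bar>?p n x\<bar> \<le> 1 * (B + B)" for x
      unfolding abs_mult using Psi_bdd[of n x] Psi_bdd[of n "T x"] by (intro mult_mono) auto
  qed measurable
  have S: "sym_diff (W n) (T -` W n \<inter> space M) \<in> sets M"
    by (intro sets.Un sets.Diff measurable_sets[OF T_meas] W_sets)
  then have i4: "integrable M (\<lambda>x. indicat_real (sym_diff (W n) (T -` W n \<inter> space M)) x)"
    by (simp add: emeasure_eq_measure)
  have "(LINT x|M. wt n x * h x * \<Psi> n x) = (LINT x|M. ?g n x)"
    using integral_T_funpow[of "\<lambda>x. wt n x * h x * \<Psi> n x" 1] by simp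
  then have "\<bar>(LINT x|M. ?f n x) - (LINT x|M. wt n x * h x * \<Psi> n x)\<bar> = \<bar>(LINT x|M. ?f n x) - (LINT x|M. ?g n x)\<bar>" by simp
  also have "\<dots> \<le> (LINT x|M. C * (?p n x + B * ?d n x))"
  proof (rule abs_integral_diff_le[OF i1 i2])
    fix x assume x: "x \<in> space M"
    have "\<bar>?f n x - ?g n x\<bar>
      = \<bar>h (T x)\<bar> * \<bar>wt n x * \<Psi> n x - wt n (T x) * \<Psi> n (T x)\<bar>"
      unfolding abs_mult[symmetric] by (simp add: algebra_simps)
    also have "\<dots> \<le> C * (?p n x + B * ?d n x)"
    proof (rule mult_mono)
      show "\<bar>wt n x * \<Psi> n x - wt n (T x) * \<Psi> n (T x)\<bar>
      \<le> ?p n x + B * ?d n x"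
      using Psi_bdd[of n x] Psi_bdd[of n "T x"] x
      by (cases "x \<in> W n"; cases "T x \<in> W n") (simp_all add: wt_def abs_minus_commute)
    qed (use bd[of "T x"] x C in auto)
    finally show "\<bar>?f n x - ?g n x\<bar> \<le> \<dots>" .
  qed (use i3 i4 in auto)
  also have "\<dots> = C * (?I n + B * ?s n)"
    using i3 i4 sets.sets_into_space[OF S] by (simp add: Int_absorb2)
  finally show "\<bar>(LINT x|M. ?f n x) - (LINT x|M. wt n x * h x * \<Psi> n x)\<bar> \<le> C * (?I n + B * ?s n)" .
qed

lemma shift_iterate:
  assumes [measurable]: "h \<in> borel_measurable M" and bd: "\<And>x. x \<in> space M \<Longrightarrow> \<bar>h x\<bar> \<le> C"
  shows "(\<lambda>n. (LINT x|M. wt n x * h ((T ^^ k) x) * \<Psi> n x) - (LINT x|M. wt n x * h x * \<Psi> n x)) \<longlonglongrightarrow> 0"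
proof (induction k)
  case (Suc k)
  have "(\<lambda>x. h ((T ^^ k) x)) \<in> borel_measurable M"
    by (rule measurable_compose[OF T_funpow_meas]) measurable
  from tendsto_add[OF shift_once[OF this, of C] Suc] bd
  show ?case by (simp add: funpow_swap1)
qed simp

lemma shift_average:
  assumes h [measurable]: "h \<in> borel_measurable M" and bd: "\<And>x. x \<in> space M \<Longrightarrow> \<bar>h x\<bar> \<le> C"
    and K: "0 < K"
  shows "(\<lambda>n. (LINT x|M. wt n x * (bsum h K x / K) * \<Psi> n x) - (LINT x|M. wt n x * h x * \<Psi> n x)) \<longlonglongrightarrow> 0"
proof -
  let ?X = "\<lambda>n. LINT x|M. wt n x * (bsum h K x / K) * \<Psi> n x"
  let ?Y = "\<lambda>n. LINT x|M. wt n x * h x * \<Psi> n x"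
  let ?Z = "\<lambda>n k. LINT x|M. wt n x * h ((T ^^ k) x) * \<Psi> n x"
  have m: "(\<lambda>x. h ((T ^^ k) x)) \<in> borel_measurable M" for k
    by (rule measurable_compose[OF T_funpow_meas]) measurable
  have i: "integrable M (\<lambda>x. wt n x * h ((T ^^ k) x) * \<Psi> n x)" for n k
    by (rule integrable_wt_Psi[OF m, where C=C]) (use bd in auto)
  have eq: "?X n - ?Y n
    = (\<Sum>k<K. ?Z n k - ?Y n) / K" for n
  proof -
    have "?X n = (LINT x|M. (\<Sum>k<K. wt n x * h ((T ^^ k) x) * \<Psi> n x) / K)"
      by (simp add: bsum_def sum_distrib_left sum_distrib_right mult.commute)
    also have "\<dots> = (\<Sum>k<K. LINT x|M. wt n x * h ((T ^^ k) x) * \<Psi> n x) / K"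
      using i by simp
    finally show ?thesis using K by (simp add: sum_subtractf diff_divide_distrib)
  qed
  have "(\<lambda>n. (\<Sum>k<K. ?Z n k - ?Y n) / K)
    \<longlonglongrightarrow> (\<Sum>k<K. 0) / K"
    by (intro tendsto_divide tendsto_sum shift_iterate[OF assms(1,2)] tendsto_const) (use K in auto)
  then show ?thesis unfolding eq by simp
qed

text \<open>By the shifts above, \<open>h\<close> may be replaced by its Birkhoff average over
  \<open>K\<close> steps at no cost in the limit, and for large \<open>K\<close> this average is
  close to the mean in L1. \<open>K\<close> is fixed before \<open>n\<close> tends to
  infinity.\<close>

lemma asymptotic_independence:
  assumes h [measurable]: "h \<in> borel_measurable M" and bd: "\<And>x. x \<in> space M \<Longrightarrow> \<bar>h x\<bar> \<le> C"
  shows "(\<lambda>n. (LINT x|M. wt n x * h x * \<Psi> n x) - (LINT x|M. h x) * (LINT x|M. wt n x * \<Psi> n x)) \<longlonglongrightarrow> 0"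
proof (rule tendsto_zeroI_approx)
  fix e :: real assume e: "0 < e"
  let ?I = "LINT x|M. h x"
  let ?Y = "\<lambda>n. LINT x|M. wt n x * h x * \<Psi> n x"
  let ?V = "\<lambda>n. LINT x|M. wt n x * \<Psi> n x"
  \<comment> \<open>The 1 keeps the denominator positive when \<open>B\<close> is 0.\<close>
  define e' where "e' = e / (B + 1)"
  have e': "0 < e'" using e B_nonneg by (simp add: e'_def)
  obtain K0 where K0: "\<And>K. K0 \<le> K \<Longrightarrow> (LINT x|M. \<bar>bsum h K x / K - ?I\<bar>) < e'"
    using LIMSEQ_D[OF mean_ergodic[OF assms] e'] by fastforce
  define K where "K = Suc K0"
  have K: "0 < K" "(LINT x|M. \<bar>bsum h K x / K - ?I\<bar>) < e'" using K0[of K] by (auto simp: K_def)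
  let ?X = "\<lambda>n. LINT x|M. wt n x * (bsum h K x / K) * \<Psi> n x"
  have hi: "integrable M h" by (rule integrable_bounded[OF assms])
  have i1: "integrable M (\<lambda>x. wt n x * 1 * \<Psi> n x)" for n
    by (rule integrable_wt_Psi[where C=1]) auto
  have bK: "\<bar>bsum h K x / K\<bar> \<le> C" if "x \<in> space M" for x
  proof -
    have "\<bar>bsum h K x\<bar> \<le> (\<Sum>k<K. C)"
      unfolding bsum_def using that bd by (intro order_trans[OF sum_abs] sum_mono) auto
    then show ?thesis using K by (simp add: field_simps)
  qed
  have i2: "integrable M (\<lambda>x. wt n x * (bsum h K x / K) * \<Psi> n x)" for n
    by (rule integrable_wt_Psi[where C=C]) (use bK in auto)
  have i3: "integrable M (\<lambda>x. \<bar>bsum h K x / K - ?I\<bar>)"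
    using integrable_bsum[OF hi, of K] by auto
  let ?b = "\<lambda>n. \<bar>?X n - ?Y n\<bar>"
  have "\<bar>?Y n - ?I * ?V n\<bar> \<le> ?b n + e" for n
  proof -
    have "?I * ?V n = (LINT x|M. ?I * (wt n x * \<Psi> n x))" by simp
    then have "\<bar>?X n - ?I * ?V n\<bar> = \<bar>?X n - (LINT x|M. ?I * (wt n x * \<Psi> n x))\<bar>" by (simp only:)
    also have "\<dots> \<le> (LINT x|M. B * \<bar>bsum h K x / K - ?I\<bar>)"
    proof (rule abs_integral_diff_le[OF i2])
      fix x
      have "\<bar>wt n x * (bsum h K x / K) * \<Psi> n x - ?I * (wt n x * \<Psi> n x)\<bar> = \<bar>wt n x\<bar> * (\<bar>\<Psi> n x\<bar> * \<bar>bsum h K x / K - ?I\<bar>)"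
        unfolding abs_mult[symmetric] by (simp add: algebra_simps)
      also have "\<dots> \<le> 1 * (B * \<bar>bsum h K x / K - ?I\<bar>)"
        using Psi_bdd B_nonneg by (intro mult_mono) auto
      finally show "\<bar>wt n x * (bsum h K x / K) * \<Psi> n x - ?I * (wt n x * \<Psi> n x)\<bar> \<le> B * \<bar>bsum h K x / K - ?I\<bar>" by simp
    qed (use i1[of n] i3 in auto)
    also have "\<dots> = B * (LINT x|M. \<bar>bsum h K x / K - ?I\<bar>)" using i3 by simp
    also have "\<dots> \<le> (B + 1) * e'" using K B_nonneg by (intro mult_mono) auto
    also have "\<dots> = e" using B_nonneg by (simp add: e'_def)
    finally show ?thesis by linarith
  qed
  moreover have "?b \<longlonglongrightarrow> 0"
    using tendsto_rabs_zero[OF shift_average[OF assms K(1)]] .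
  ultimately show "\<exists>b. b \<longlonglongrightarrow> 0 \<and> (\<forall>n. \<bar>?Y n - ?I * ?V n\<bar> \<le> b n + e)"
    by blast
qed

lemma integral_uniform_W:
  assumes "0 < measure M (W n)"
  shows "(LINT p|distr (uniform_measure M (W n)) borel (\<lambda>x. (fq' n x, fq n x)). \<psi> p)
    = (LINT x|M. wt n x * \<Psi> n x) / measure M (W n)"
proof -
  have "uniform_measure M (W n) = density M (\<lambda>x. ennreal (wt n x / measure M (W n)))"
    unfolding uniform_measure_def using assms
    by (intro density_cong) (auto simp: wt_def emeasure_eq_measure divide_ennreal[symmetric] ennreal_indicator)
  then show ?thesis
    by (subst integral_distr) (simp_all add: integral_density \<Psi>_def del: measure_uniform_measure)
qed

text \<open>The hypothesis \<open>C7\<close> normalises by the measure of \<open>W n\<close>;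
  multiplying it back brings in \<alpha>. That measure is known to be positive only from some
  \<open>n\<close> on, so the two sequences agree eventually.\<close>

lemma integral_Psi_tendsto: "(\<lambda>n. LINT x|M. wt n x * \<Psi> n x) \<longlonglongrightarrow> \<alpha> * (LINT p|P. \<psi> p)"
proof -
  have "bounded (range \<psi>)" using psi_bdd by (auto simp: bounded_iff)
  then have "(\<lambda>n. LINT p|distr (uniform_measure M (W n)) borel (\<lambda>x. (fq' n x, fq n x)). \<psi> p) \<longlonglongrightarrow> (LINT p|P. \<psi> p)"
    using C7 psi_cont unfolding weak_conv_measures_def fq_def fq'_def by blast
  from tendsto_mult[OF C1 this]
  have "(\<lambda>n. measure M (W n) * (LINT p|distr (uniform_measure M (W n)) borel (\<lambda>x. (fq' n x, fq n x)). \<psi> p)) \<longlonglongrightarrow> \<alpha> * (LINT p|P. \<psi> p)" .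
  moreover have "eventually (\<lambda>n. 0 < measure M (W n)) sequentially"
    using order_tendstoD(1)[OF C1 alpha_pos] .
  then have "eventually (\<lambda>n. measure M (W n) * (LINT p|distr (uniform_measure M (W n)) borel (\<lambda>x. (fq' n x, fq n x)). \<psi> p)
     = (LINT x|M. wt n x * \<Psi> n x)) sequentially"
    by eventually_elim (simp add: integral_uniform_W)
  ultimately show ?thesis by (rule Lim_transform_eventually)
qed

lemma integral_h_Psi_tendsto:
  assumes h [measurable]: "h \<in> borel_measurable M" and bd: "\<And>x. x \<in> space M \<Longrightarrow> \<bar>h x\<bar> \<le> C"
  shows "(\<lambda>n. LINT x|M. wt n x * h x * \<Psi> n x) \<longlonglongrightarrow> \<alpha> * (LINT x|M. h x) * (LINT p|P. \<psi> p)"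
  using tendsto_add[OF asymptotic_independence[OF assms] tendsto_mult_left[OF integral_Psi_tendsto, of "LINT x|M. h x"]]
  by (simp add: algebra_simps)

end

section \<open>Interpolation of fibrewise Lipschitz functions\<close>

definition hat :: "real \<Rightarrow> real" where "hat z = max 0 (1 - \<bar>z\<bar>)"

lemma hat_bounds [simp]: "0 \<le> hat z" "hat z \<le> 1" "\<bar>hat z\<bar> \<le> 1"
  by (auto simp: hat_def)

lemma hat_lipschitz: "\<bar>hat z - hat z'\<bar> \<le> \<bar>z - z'\<bar>"
  by (auto simp: hat_def max_def)

lemma hat_zero: "1 \<le> \<bar>z\<bar> \<Longrightarrow> hat z = 0"
  by (simp add: hat_def)

lemma hat_meas [measurable]: "hat \<in> borel_measurable borel"
  unfolding hat_def[abs_def] by measurable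

text \<open>Only the two tents centred at the integers around \<open>y\<close> are nonzero there,
  with values \<open>1 - frac y\<close> and \<open>frac y\<close>. So the integer translates add up
  to 1.\<close>

lemma sum_hat:
  fixes y :: real and A :: "int set"
  assumes "finite A"
  defines "k \<equiv> \<lfloor>y\<rfloor>"
  shows "(\<Sum>j\<in>A. hat (y - j)) = (if k \<in> A then 1 - frac y else 0) + (if k + 1 \<in> A then frac y else 0)"
proof -
  have "hat (y - j) = (if j = k then 1 - frac y else 0) + (if j = k + 1 then frac y else 0)" for j :: int
  proof -
    have fl: "real_of_int k \<le> y" "y < real_of_int k + 1" by (auto simp: k_def)
    have fr: "frac y = y - real_of_int k" by (simp add: frac_def k_def)
    consider "j = k" | "j = k + 1" | "j < k" | "j > k + 1" by linarith
    then show ?thesis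
    proof cases
      case 3
      then have "real_of_int j \<le> real_of_int k - 1" by linarith
      then show ?thesis using 3 fl by (simp add: hat_zero)
    next
      case 4
      then have "real_of_int j \<ge> real_of_int k + 2" by linarith
      then show ?thesis using 4 fl by (simp add: hat_zero)
    qed (use fl fr in \<open>auto simp: hat_def\<close>)
  qed
  then show ?thesis using assms(1) by (simp add: sum.distrib)
qed

lemma sum_hat_le_1: "finite A \<Longrightarrow> (\<Sum>j\<in>A. hat (y - of_int j)) \<le> 1"
  using frac_ge_0[of y] frac_lt_1[of y] by (simp add: sum_hat)

lemma sum_hat_eq_1:
  assumes "\<bar>y\<bar> \<le> real m"
  shows "(\<Sum>j\<in>{- int m..int m}. hat (y - of_int j)) = 1"
\<comment> \<open>At the right end the neighbour \<open>m + 1\<close> is outside the index set, but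
  its weight \<open>frac y\<close> is 0.\<close>
proof (cases "y = real m")
  case True
  then show ?thesis by (simp add: sum_hat)
next
  case False
  then have "\<lfloor>y\<rfloor> < int m" "- int m \<le> \<lfloor>y\<rfloor>" using assms by (auto simp: floor_less_iff le_floor_iff)
  then show ?thesis by (simp add: sum_hat)
qed

text \<open>
  The part of the line not covered by the hat functions is controlled by a continuous function, so
  weak convergence applies to it directly and no separate tightness argument is needed.
\<close>

definition tail :: "real \<Rightarrow> nat \<Rightarrow> real \<Rightarrow> real" where
  "tail \<eta> m v = 1 - (\<Sum>j\<in>{- int m..int m}. hat (v / \<eta> - of_int j))"

lemma tail_bounds: "0 \<le> tail \<eta> m v" "tail \<eta> m v \<le> 1"
  using sum_hat_le_1[of "{- int m..int m}" "v / \<eta>"] by (auto simp: tail_def intro!: sum_nonneg)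

lemma tail_meas [measurable]: "tail \<eta> m \<in> borel_measurable borel"
  unfolding tail_def[abs_def] by measurable

lemma tail_tendsto: "(\<lambda>m. tail \<eta> m v) \<longlonglongrightarrow> 0"
proof (rule tendsto_eventually)
  obtain m0 :: nat where "\<bar>v / \<eta>\<bar> \<le> real m0" using real_arch_simple by blast
  then show "eventually (\<lambda>m. tail \<eta> m v = 0) sequentially"
    unfolding eventually_sequentially tail_def
    by (intro exI[of _ m0] allI impI) (subst sum_hat_eq_1, auto)
qed

lemma hat_scale_lipschitz:
  assumes "0 < \<eta>" shows "\<bar>hat (v / \<eta> - j) - hat (v' / \<eta> - j)\<bar> \<le> \<bar>v - v'\<bar> / \<eta>"
  using hat_lipschitz[of "v / \<eta> - j" "v' / \<eta> - j"] assms
  by (simp add: diff_divide_distrib[symmetric])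

lemma tail_lipschitz:
  assumes "0 < \<eta>"
  shows "\<bar>tail \<eta> m v - tail \<eta> m v'\<bar> \<le> (2 * m + 1) / \<eta> * \<bar>v - v'\<bar>"
proof -
  have "\<bar>tail \<eta> m v - tail \<eta> m v'\<bar> = \<bar>\<Sum>j\<in>{- int m..int m}. hat (v / \<eta> - of_int j) - hat (v' / \<eta> - of_int j)\<bar>"
    by (simp add: tail_def sum_subtractf)
  also have "\<dots> \<le> (\<Sum>j\<in>{- int m..int m}. \<bar>v - v'\<bar> / \<eta>)"
    by (intro order_trans[OF sum_abs] sum_mono hat_scale_lipschitz assms)
  also have "\<dots> = (2 * real m + 1) / \<eta> * \<bar>v - v'\<bar>" by simp
  finally show ?thesis .
qed

text \<open>Piecewise linear interpolation of \<open>g (- v)\<close> as a function of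
  \<open>v\<close> at the nodes \<open>\<eta> * j\<close>. It separates variables: when
  \<open>g\<close> depends on a base point, the result is a finite sum of base functions times
  Lipschitz functions of \<open>v\<close>. The sign is there because the flow time remaining after
  \<open>q n\<close> base steps is \<open>- fq n x\<close>.\<close>

definition interp :: "real \<Rightarrow> nat \<Rightarrow> (real \<Rightarrow> real) \<Rightarrow> real \<Rightarrow> real" where
  "interp \<eta> m g v = (\<Sum>j\<in>{- int m..int m}. hat (v / \<eta> - of_int j) * g (- (\<eta> * of_int j)))"

text \<open>The nodes that carry weight lie within \<open>\<eta>\<close> of \<open>v\<close> and
  cost \<open>K * \<eta>\<close>; the weight missing from 1 is \<open>tail\<close> and costs at most
  itself because \<open>g\<close> has values in [0, 1].\<close>

lemma interp_error:
  assumes \<eta>: "0 < \<eta>" and g: "\<And>r. 0 \<le> g r" "\<And>r. g r \<le> 1" and lip: "\<And>r r'. \<bar>g r - g r'\<bar> \<le> K * \<bar>r - r'\<bar>"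
  shows "0 \<le> interp \<eta> m g v" "interp \<eta> m g v \<le> 1"
    "\<bar>g (- v) - interp \<eta> m g v\<bar> \<le> K * \<eta> + tail \<eta> m v"
proof -
  let ?J = "{- int m..int m}"
  let ?h = "\<lambda>j. hat (v / \<eta> - of_int j)"
  have K: "0 \<le> K" using order_trans[OF abs_ge_zero lip[of 0 1]] by simp
  show "0 \<le> interp \<eta> m g v" unfolding interp_def using g by (intro sum_nonneg) auto
  have "interp \<eta> m g v \<le> (\<Sum>j\<in>?J. ?h j * 1)"
    unfolding interp_def using g by (intro sum_mono mult_left_mono) auto
  also have "\<dots> \<le> 1" using sum_hat_le_1[of ?J "v / \<eta>"] by simp
  finally show "interp \<eta> m g v \<le> 1" .
  have "g (- v) - interp \<eta> m g v = (\<Sum>j\<in>?J. ?h j * (g (- v) - g (- (\<eta> * of_int j)))) + tail \<eta> m v * g (- v)"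
    by (simp add: interp_def tail_def right_diff_distrib sum_subtractf left_diff_distrib sum_distrib_right[symmetric])
  also have "\<bar>\<dots>\<bar> \<le> (\<Sum>j\<in>?J. \<bar>?h j * (g (- v) - g (- (\<eta> * of_int j)))\<bar>) + \<bar>tail \<eta> m v * g (- v)\<bar>"
    by (intro order_trans[OF abs_triangle_ineq] add_mono sum_abs order_refl)
  also have "\<dots> \<le> (\<Sum>j\<in>?J. ?h j * (K * \<eta>)) + tail \<eta> m v"
  proof (intro add_mono sum_mono)
    fix j
    show "\<bar>?h j * (g (- v) - g (- (\<eta> * of_int j)))\<bar> \<le> ?h j * (K * \<eta>)"
    proof (cases "1 \<le> \<bar>v / \<eta> - of_int j\<bar>")
      case True then show ?thesis by (simp add: hat_zero)
    next
      case False
      then have "\<bar>v - \<eta> * of_int j\<bar> \<le> \<eta>" using \<eta> by (auto simp: abs_if field_simps split: if_splits)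
      then have "K * \<bar>- v - - (\<eta> * of_int j)\<bar> \<le> K * \<eta>" using K by (intro mult_left_mono) auto
      then have "\<bar>g (- v) - g (- (\<eta> * of_int j))\<bar> \<le> K * \<eta>" using lip order_trans by blast
      then show ?thesis by (simp add: abs_mult mult_left_mono)
    qed
    show "\<bar>tail \<eta> m v * g (- v)\<bar> \<le> tail \<eta> m v"
      using tail_bounds[of \<eta> m v] g[of "- v"] by (simp add: abs_mult mult_left_le)
  qed
  also have "\<dots> \<le> 1 * (K * \<eta>) + tail \<eta> m v"
    unfolding sum_distrib_right[symmetric] using sum_hat_le_1[of ?J "v / \<eta>"] K \<eta>
    by (intro add_mono mult_right_mono) auto
  finally show "\<bar>g (- v) - interp \<eta> m g v\<bar> \<le> K * \<eta> + tail \<eta> m v" by simp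
qed

lemma abs_mult3_diff:
  fixes x y z y' z' :: real
  assumes "\<bar>x\<bar> \<le> 1" "\<bar>y\<bar> \<le> 1" "\<bar>z'\<bar> \<le> 1"
  shows "\<bar>x * y * z - x * y' * z'\<bar> \<le> \<bar>y - y'\<bar> + \<bar>z - z'\<bar>"
proof -
  have "x * y * z - x * y' * z' = x * ((y - y') * z' + y * (z - z'))" by (simp add: algebra_simps)
  also have "\<bar>\<dots>\<bar> \<le> 1 * (\<bar>y - y'\<bar> * 1 + 1 * \<bar>z - z'\<bar>)"
    unfolding abs_mult using assms
    by (intro mult_mono order_trans[OF abs_triangle_ineq] add_mono) (auto simp: abs_mult mult_left_le mult_left_le_one_le)
  finally show ?thesis by simp
qed

section \<open>Limits with three base functions\<close>

context rigid_test
begin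

text \<open>Bounded functions are integrable, so \<open>rigid_L1\<close> removes
  \<open>T ^^ q n\<close> from \<open>h1\<close> and \<open>T ^^ (2 * q n)\<close> from
  \<open>h2\<close> on \<open>W n\<close>; what remains is asymptotic independence for the product
  of the three functions.\<close>

lemma triple_Psi_tendsto:
  assumes [measurable]: "h0 \<in> borel_measurable M" "h1 \<in> borel_measurable M" "h2 \<in> borel_measurable M"
    and bd: "\<And>x. x \<in> space M \<Longrightarrow> \<bar>h0 x\<bar> \<le> 1" "\<And>x. x \<in> space M \<Longrightarrow> \<bar>h1 x\<bar> \<le> 1" "\<And>x. x \<in> space M \<Longrightarrow> \<bar>h2 x\<bar> \<le> 1"
  shows "(\<lambda>n. LINT x|M. wt n x * (h0 x * h1 ((T ^^ q n) x) * h2 ((T ^^ (2 * q n)) x)) * \<Psi> n x)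
     \<longlonglongrightarrow> \<alpha> * (LINT x|M. h0 x * h1 x * h2 x) * (LINT p|P. \<psi> p)"
proof -
  note m [measurable] = measurable_compose[OF T_funpow_meas assms(1)] measurable_compose[OF T_funpow_meas assms(2)] measurable_compose[OF T_funpow_meas assms(3)]
  let ?H = "\<lambda>n x. h0 x * h1 ((T ^^ q n) x) * h2 ((T ^^ (2 * q n)) x)"
  let ?G = "\<lambda>x. h0 x * h1 x * h2 x"
  let ?h = "\<lambda>n x. wt n x * ?H n x * \<Psi> n x" and ?g = "\<lambda>n x. wt n x * ?G x * \<Psi> n x"
  let ?r = "\<lambda>n x. wt n x * \<bar>h1 ((T ^^ q n) x) - h1 x\<bar> + wt n x * \<bar>h2 ((T ^^ (2 * q n)) x) - h2 x\<bar>"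
  have meas_G: "?G \<in> borel_measurable M" by measurable
  have prod1: "\<bar>x * y * z\<bar> \<le> 1" if "\<bar>x\<bar> \<le> 1" "\<bar>y\<bar> \<le> 1" "\<bar>z\<bar> \<le> 1" for x y z :: real
    unfolding abs_mult using that by (auto intro!: mult_le_one)
  have bH: "\<bar>?H n x\<bar> \<le> 1" "\<bar>?G x\<bar> \<le> 1" if "x \<in> space M" for n x
    using that by (auto intro!: prod1 bd)
  have i: "integrable M (\<lambda>x. ?h n x)" "integrable M (\<lambda>x. ?g n x)" for n
    by (rule integrable_wt_Psi[OF _ bH(1)] integrable_wt_Psi[OF _ bH(2)], measurable)+
  have hi: "integrable M h1" "integrable M h2"
    by (rule integrable_bounded[OF assms(2) bd(2)], assumption)
       (rule integrable_bounded[OF assms(3) bd(3)], assumption)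
  let ?R = "\<lambda>h r n. LINT x|M. wt n x * \<bar>h ((T ^^ r n) x) - h x\<bar>"
  have ir: "integrable M (\<lambda>x. wt n x * \<bar>h ((T ^^ r) x) - h x\<bar>)" if "integrable M h" for h r n
    using that by (intro integrable_wt integrable_abs Bochner_Integration.integrable_diff integrable_T_funpow)
  have "(\<lambda>n. (LINT x|M. ?h n x) - (LINT x|M. ?g n x)) \<longlonglongrightarrow> 0"
  proof (rule tendsto_zero_bound)
    show "(\<lambda>n. B * (?R h1 q n + ?R h2 (\<lambda>n. 2 * q n) n)) \<longlonglongrightarrow> 0"
      using tendsto_mult_left[OF tendsto_add[OF rigid_L1[OF C3 hi(1)] rigid_L1[OF C4 hi(2)]], of B] by simp
    fix n
    have "\<bar>(LINT x|M. ?h n x) - (LINT x|M. ?g n x)\<bar>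
      \<le> (LINT x|M. B * (?r n x))"
    proof (rule abs_integral_diff_le[OF i])
      fix x assume x: "x \<in> space M"
      have eq: "?h n x - ?g n x = \<Psi> n x * (wt n x * (?H n x - ?G x))"
        by (simp only: algebra_simps)
      have "\<bar>?h n x - ?g n x\<bar> = \<bar>\<Psi> n x\<bar> * (wt n x * \<bar>?H n x - ?G x\<bar>)"
        unfolding eq by (simp only: abs_mult[of "\<Psi> n x"] abs_mult[of "wt n x"] abs_of_nonneg[OF wt_bounds(1)])
      also have "\<dots> \<le> B * (wt n x * (\<bar>h1 ((T ^^ q n) x) - h1 x\<bar> + \<bar>h2 ((T ^^ (2 * q n)) x) - h2 x\<bar>))"
        using B_nonneg x bd by (intro mult_mono mult_left_mono Psi_bdd abs_mult3_diff) auto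
      finally show "\<bar>?h n x - ?g n x\<bar>
        \<le> B * (?r n x)"
        by (simp add: distrib_left)
    next
      show "integrable M (\<lambda>x. B * (?r n x))"
        by (intro integrable_mult_right Bochner_Integration.integrable_add ir hi)
    qed
    also have "\<dots> = B * (?R h1 q n + ?R h2 (\<lambda>n. 2 * q n) n)"
      using ir[OF hi(1), of n "q n"] ir[OF hi(2), of n "2 * q n"] by simp
    finally show "\<bar>(LINT x|M. ?h n x) - (LINT x|M. ?g n x)\<bar> \<le> \<dots>" .
  qed
  from tendsto_add[OF this integral_h_Psi_tendsto[OF meas_G bH(2)]]
  show ?thesis by simp
qed

end

context rigid_suspension
begin

text \<open>The interpretation turns \<open>\<psi>\<close> into a parameter, since the interpolation
  brings a different \<open>\<psi>\<close> for each pair of nodes.\<close>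

lemma triple_tendsto:
  assumes "h0 \<in> borel_measurable M" "h1 \<in> borel_measurable M" "h2 \<in> borel_measurable M"
    and "\<And>x. x \<in> space M \<Longrightarrow> \<bar>h0 x\<bar> \<le> 1" "\<And>x. x \<in> space M \<Longrightarrow> \<bar>h1 x\<bar> \<le> 1" "\<And>x. x \<in> space M \<Longrightarrow> \<bar>h2 x\<bar> \<le> 1"
    and psi: "\<And>u v. \<bar>\<psi> (u, v)\<bar> \<le> B"
      "\<And>u v u' v'. \<bar>\<psi> (u, v) - \<psi> (u', v')\<bar> \<le> L * (\<bar>u - u'\<bar> + \<bar>v - v'\<bar>)"
  shows "(\<lambda>n. LINT x|M. wt n x * (h0 x * h1 ((T ^^ q n) x) * h2 ((T ^^ (2 * q n)) x)) * \<psi> (fq' n x, fq n x))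
     \<longlonglongrightarrow> \<alpha> * (LINT x|M. h0 x * h1 x * h2 x) * (LINT p|P. \<psi> p)"
proof -
  interpret rigid_test M T f c W q a \<alpha> P \<psi> B L
    by unfold_locales (use psi in \<open>auto simp: split_paired_all\<close>)
  show ?thesis using triple_Psi_tendsto[OF assms(1-6)] by (simp add: \<Psi>_def)
qed

end

section \<open>Limits for functions that are Lipschitz along the fibres\<close>

lemma interp_product:
  "h * interp \<eta> m g v * interp \<eta> m g' u
   = (\<Sum>j\<in>{- int m..int m}. \<Sum>k\<in>{- int m..int m}.
       (h * g (- (\<eta> * of_int j)) * g' (- (\<eta> * of_int k))) * (hat (v / \<eta> - of_int j) * hat (u / \<eta> - of_int k)))"
proof -
  have "h * interp \<eta> m g v * interp \<eta> m g' u = (\<Sum>j\<in>{- int m..int m}. \<Sum>k\<in>{- int m..int m}.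
    (h * (hat (v / \<eta> - of_int j) * g (- (\<eta> * of_int j)))) * (hat (u / \<eta> - of_int k) * g' (- (\<eta> * of_int k))))"
    unfolding interp_def sum_distrib_left[of h] sum_product ..
  also have "\<dots> = (\<Sum>j\<in>{- int m..int m}. \<Sum>k\<in>{- int m..int m}.
       (h * g (- (\<eta> * of_int j)) * g' (- (\<eta> * of_int k))) * (hat (v / \<eta> - of_int j) * hat (u / \<eta> - of_int k)))"
    by (intro sum.cong refl) (simp only: mult_ac)
  finally show ?thesis .
qed

lemma abs_mult_le_1:
  fixes x y :: real
  shows "\<bar>x\<bar> \<le> 1 \<Longrightarrow> \<bar>y\<bar> \<le> 1 \<Longrightarrow> \<bar>x * y\<bar> \<le> 1"
  by (simp add: abs_mult mult_le_one)

lemma hat_product_lipschitz: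
  assumes "0 < \<eta>"
  shows "\<bar>hat (v / \<eta> - j) * hat (u / \<eta> - k) - hat (v' / \<eta> - j) * hat (u' / \<eta> - k)\<bar>
    \<le> 1 / \<eta> * (\<bar>u - u'\<bar> + \<bar>v - v'\<bar>)"
proof -
  have "\<bar>1 * hat (v / \<eta> - j) * hat (u / \<eta> - k) - 1 * hat (v' / \<eta> - j) * hat (u' / \<eta> - k)\<bar>
    \<le> \<bar>hat (v / \<eta> - j) - hat (v' / \<eta> - j)\<bar> + \<bar>hat (u / \<eta> - k) - hat (u' / \<eta> - k)\<bar>"
    by (rule abs_mult3_diff) auto
  also have "\<dots> \<le> \<bar>v - v'\<bar> / \<eta> + \<bar>u - u'\<bar> / \<eta>"
    by (intro add_mono hat_scale_lipschitz assms)
  finally show ?thesis by (simp add: add_divide_distrib)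
qed

text \<open>The model is \<open>G x r = h (flow_pt x (s + r))\<close> with \<open>h\<close>
  Lipschitz along the flow. The constant \<open>K\<close> is common to all base points, so that one
  mesh \<open>\<eta>\<close> serves them all.\<close>

locale lipschitz_fibre = prob_space M for M :: "'a measure" +
  fixes G :: "'a \<Rightarrow> real \<Rightarrow> real" and K :: real
  assumes G_meas: "(\<lambda>p. G (fst p) (snd p)) \<in> borel_measurable (M \<Otimes>\<^sub>M borel)"
    and G_bounds: "x \<in> space M \<Longrightarrow> 0 \<le> G x r" "x \<in> space M \<Longrightarrow> G x r \<le> 1"
    and G_lip: "x \<in> space M \<Longrightarrow> \<bar>G x r - G x r'\<bar> \<le> K * \<bar>r - r'\<bar>"
begin

lemma G_meas_comp [measurable (raw)]:
  "g \<in> measurable L M \<Longrightarrow> r \<in> borel_measurable L \<Longrightarrow> (\<lambda>z. G (g z) (r z)) \<in> borel_measurable L"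
  using measurable_compose[OF measurable_Pair G_meas, of g L r] by simp

lemma interp_G_meas [measurable (raw)]:
  assumes [measurable]: "g \<in> measurable L M" "r \<in> borel_measurable L"
  shows "(\<lambda>z. interp \<eta> m (G (g z)) (r z)) \<in> borel_measurable L"
  unfolding interp_def by measurable

lemma K_nonneg: "0 \<le> K"
proof -
  obtain x where "x \<in> space M" using not_empty by auto
  from order_trans[OF abs_ge_zero G_lip[OF this, of 0 1]] show ?thesis by simp
qed

lemma G_abs: "x \<in> space M \<Longrightarrow> \<bar>G x r\<bar> \<le> 1"
  using G_bounds[of x r] by simp

lemmas interp_G = interp_error[of _ "G x" K for x, OF _ G_bounds G_lip]

lemma interp_G_abs: "x \<in> space M \<Longrightarrow> 0 < \<eta> \<Longrightarrow> \<bar>interp \<eta> m (G x) v\<bar> \<le> 1"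
  using interp_G(1,2)[of \<eta> x m v] by simp

end

context rigid_suspension
begin

sublocale P: prob_space P by (rule P_prob)

lemma P_sets_pair [measurable_cong]: "sets P = sets (borel \<Otimes>\<^sub>M borel)"
  unfolding P_sets by (simp only: borel_prod)

context
  fixes h0 :: "'a \<Rightarrow> real" and G2 G3 :: "'a \<Rightarrow> real \<Rightarrow> real" and K2 K3 :: real
  assumes h0 [measurable]: "h0 \<in> borel_measurable M" and h0_bd: "\<And>x. x \<in> space M \<Longrightarrow> \<bar>h0 x\<bar> \<le> 1"
    and G2: "lipschitz_fibre M G2 K2" and G3: "lipschitz_fibre M G3 K3"
begin

interpretation G2: lipschitz_fibre M G2 K2 by (rule G2)
interpretation G3: lipschitz_fibre M G3 K3 by (rule G3)
lemma T_pow_comp [measurable (raw)]: "g \<in> measurable L M \<Longrightarrow> (\<lambda>z. (T ^^ n) (g z)) \<in> measurable L M"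
  by (rule measurable_compose[OF _ T_funpow_meas])

text \<open>After interpolation the integrand is a finite sum of products of three base functions
  and a Lipschitz function of \<open>(fq' n x, fq n x)\<close>, to which
  \<open>triple_tendsto\<close> applies term by term.\<close>

lemma interp_tendsto:
  assumes \<eta>: "0 < \<eta>"
  shows "(\<lambda>n. LINT x|M. wt n x * (h0 x * interp \<eta> m (G2 ((T ^^ q n) x)) (fq n x) * interp \<eta> m (G3 ((T ^^ (2 * q n)) x)) (fq' n x)))
    \<longlonglongrightarrow> \<alpha> * (LINT p|P. LINT x|M. h0 x * interp \<eta> m (G2 x) (snd p) * interp \<eta> m (G3 x) (fst p))"
proof -
  let ?J = "{- int m..int m}"
  define \<psi> where "\<psi> j k = (\<lambda>p. hat (snd p / \<eta> - of_int j) * hat (fst p / \<eta> - of_int k))" for j k :: int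
  define g2 where "g2 j x = G2 x (- (\<eta> * of_int j))" for j :: int and x
  define g3 where "g3 j x = G3 x (- (\<eta> * of_int j))" for j :: int and x
  have [measurable]: "g2 j \<in> borel_measurable M" "g3 j \<in> borel_measurable M" for j
    unfolding g2_def[abs_def] g3_def[abs_def] by measurable
  have "\<psi> j k \<in> borel_measurable (borel \<Otimes>\<^sub>M borel)" for j k
    unfolding \<psi>_def[abs_def] by measurable
  then have [measurable]: "\<psi> j k \<in> borel_measurable borel" for j k by (simp add: borel_prod)
  have \<psi>_bd: "\<bar>\<psi> j k p\<bar> \<le> 1" for j k p unfolding \<psi>_def by (intro abs_mult_le_1) auto
  let ?I = "\<lambda>n j k x. wt n x * (h0 x * g2 j ((T ^^ q n) x) * g3 k ((T ^^ (2 * q n)) x)) * \<psi> j k (fq' n x, fq n x)"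
  let ?A = "\<lambda>n x. wt n x * (h0 x * interp \<eta> m (G2 ((T ^^ q n) x)) (fq n x) * interp \<eta> m (G3 ((T ^^ (2 * q n)) x)) (fq' n x))"
  have g_bd: "\<bar>g2 j x\<bar> \<le> 1" "\<bar>g3 j x\<bar> \<le> 1" if "x \<in> space M" for j x
    using that G2.G_abs G3.G_abs by (auto simp: g2_def g3_def)
  have lim: "(\<lambda>n. \<Sum>j\<in>?J. \<Sum>k\<in>?J. LINT x|M. ?I n j k x)
    \<longlonglongrightarrow> (\<Sum>j\<in>?J. \<Sum>k\<in>?J. \<alpha> * (LINT x|M. h0 x * g2 j x * g3 k x) * (LINT p|P. \<psi> j k p))"
  proof (intro tendsto_sum triple_tendsto)
    show "\<bar>\<psi> j k (u, v) - \<psi> j k (u', v')\<bar> \<le> 1 / \<eta> * (\<bar>u - u'\<bar> + \<bar>v - v'\<bar>)" for j k u v u' v'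
      using hat_product_lipschitz[OF \<eta>] by (simp add: \<psi>_def)
  qed (use \<psi>_bd g_bd h0_bd in auto)
  have i1: "integrable M (\<lambda>x. ?I n j k x)" for n j k
    by (rule integrable_bounded[where C=1]) (auto intro!: abs_mult_le_1 \<psi>_bd g_bd h0_bd)
  have i2: "integrable M (\<lambda>x. h0 x * g2 j x * g3 k x)" for j k
    by (rule integrable_bounded[where C=1]) (auto intro!: abs_mult_le_1 \<psi>_bd g_bd h0_bd)
  have i3: "integrable P (\<psi> j k)" for j k
    by (rule P.integrable_bounded[where C=1]) (simp add: measurable_cong_sets[OF P_sets refl], rule \<psi>_bd)
  have "?A n x
    = (\<Sum>j\<in>?J. \<Sum>k\<in>?J. ?I n j k x)" for n x
    unfolding interp_product sum_distrib_left g2_def g3_def \<psi>_def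
    by (intro sum.cong refl) (simp add: mult_ac)
  then have 1: "(LINT x|M. ?A n x)
    = (\<Sum>j\<in>?J. \<Sum>k\<in>?J. LINT x|M. ?I n j k x)" for n
    using i1 by (simp add: Bochner_Integration.integral_sum Bochner_Integration.integrable_sum)
  have "h0 x * interp \<eta> m (G2 x) (snd p) * interp \<eta> m (G3 x) (fst p)
    = (\<Sum>j\<in>?J. \<Sum>k\<in>?J. (h0 x * g2 j x * g3 k x) * \<psi> j k p)" for x p
    unfolding interp_product g2_def g3_def \<psi>_def ..
  then have "(LINT x|M. h0 x * interp \<eta> m (G2 x) (snd p) * interp \<eta> m (G3 x) (fst p))
    = (\<Sum>j\<in>?J. \<Sum>k\<in>?J. (LINT x|M. h0 x * g2 j x * g3 k x) * \<psi> j k p)" for p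
    using i2 by (simp add: Bochner_Integration.integral_sum Bochner_Integration.integrable_sum)
  then have 2: "(LINT p|P. LINT x|M. h0 x * interp \<eta> m (G2 x) (snd p) * interp \<eta> m (G3 x) (fst p))
    = (\<Sum>j\<in>?J. \<Sum>k\<in>?J. (LINT x|M. h0 x * g2 j x * g3 k x) * (LINT p|P. \<psi> j k p))"
    using i3 by (simp add: Bochner_Integration.integral_sum Bochner_Integration.integrable_sum)
  show ?thesis using lim unfolding 1 2 sum_distrib_left by (simp only: mult.assoc)
qed

text \<open>This is \<open>triple_tendsto\<close> with constant base functions. It carries the
  smallness of the tail under \<open>P\<close> over to the laws with finite
  \<open>n\<close>.\<close>

lemma integral_tail_tendsto:
  assumes \<eta>: "0 < \<eta>"
  shows "(\<lambda>n. LINT x|M. wt n x * (tail \<eta> m (fq n x) + tail \<eta> m (fq' n x)))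
    \<longlonglongrightarrow> \<alpha> * (LINT p|P. tail \<eta> m (snd p) + tail \<eta> m (fst p))"
proof -
  let ?\<psi> = "\<lambda>p. tail \<eta> m (snd p) + tail \<eta> m (fst p)"
  have "(\<lambda>n. LINT x|M. wt n x * (1 * 1 * 1) * ?\<psi> (fq' n x, fq n x))
    \<longlonglongrightarrow> \<alpha> * (LINT x|M. 1 * 1 * 1) * (LINT p|P. ?\<psi> p)"
  proof (rule triple_tendsto)
    show "\<bar>?\<psi> (u, v)\<bar> \<le> 2" for u v
      using tail_bounds[of \<eta> m u] tail_bounds[of \<eta> m v] by simp
    show "\<bar>?\<psi> (u, v) - ?\<psi> (u', v')\<bar> \<le> (2 * real m + 1) / \<eta> * (\<bar>u - u'\<bar> + \<bar>v - v'\<bar>)" for u v u' v'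
      using tail_lipschitz[OF \<eta>, of m u u'] tail_lipschitz[OF \<eta>, of m v v']
      unfolding distrib_left fst_conv snd_conv by linarith
  qed auto
  then show ?thesis by (simp add: prob_space)
qed

lemma tail_P_small:
  assumes e: "0 < e"
  shows "\<exists>m. (LINT p|P. tail \<eta> m (snd p) + tail \<eta> m (fst p)) < e"
proof -
  have "(\<lambda>m. LINT p|P. tail \<eta> m (snd p) + tail \<eta> m (fst p)) \<longlonglongrightarrow> (LINT p|P. 0)"
  proof (rule integral_dominated_convergence[where w="\<lambda>_. 2"])
    show "AE p in P. (\<lambda>m. tail \<eta> m (snd p) + tail \<eta> m (fst p)) \<longlonglongrightarrow> 0"
      by (intro AE_I2 tendsto_add_zero tail_tendsto)
    show "AE p in P. norm (tail \<eta> m (snd p) + tail \<eta> m (fst p)) \<le> 2" for m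
    proof (rule AE_I2)
      fix p :: "real \<times> real"
      show "norm (tail \<eta> m (snd p) + tail \<eta> m (fst p)) \<le> 2"
        using tail_bounds[of \<eta> m "fst p"] tail_bounds[of \<eta> m "snd p"] by simp
    qed
  qed auto
  from order_tendstoD(2)[OF this, of e] e show ?thesis
    by (auto simp: eventually_sequentially)
qed

text \<open>The choices come in this order: the mesh \<open>\<eta>\<close> for the interpolation
  error, \<open>m\<close> for the tail under \<open>P\<close>, and last \<open>n\<close>. The tail
  under the n-th law is compared with \<alpha> times the tail under \<open>P\<close>, and the
  difference joins the null sequence \<open>?r\<close>.\<close>

lemma lipschitz_tendsto:
  "(\<lambda>n. LINT x|M. wt n x * (h0 x * G2 ((T ^^ q n) x) (- fq n x) * G3 ((T ^^ (2 * q n)) x) (- fq' n x)))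
    \<longlonglongrightarrow> \<alpha> * (LINT p|P. LINT x|M. h0 x * G2 x (- snd p) * G3 x (- fst p))"
proof -
  let ?A = "\<lambda>n x. wt n x * (h0 x * G2 ((T ^^ q n) x) (- fq n x) * G3 ((T ^^ (2 * q n)) x) (- fq' n x))"
  let ?a = "\<lambda>p x. h0 x * G2 x (- snd p) * G3 x (- fst p)"
  define A where "A n = (LINT x|M. ?A n x)" for n
  define A' where "A' = (LINT p|P. LINT x|M. ?a p x)"
  have "(\<lambda>n. A n - \<alpha> * A') \<longlonglongrightarrow> 0"
  proof (rule tendsto_zeroI_approx)
    fix e :: real assume e: "0 < e"
    \<comment> \<open>The total will be \<open>e' + 3 * \<alpha> * e'\<close>: beyond the null
      sequence, interpolation costs \<open>e' + \<alpha> * e'\<close> before the limit and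
      \<open>\<alpha> * (e' + D')\<close> in it, where \<open>D' \<le> e'\<close>.\<close>
    define e' where "e' = e / (4 * (1 + \<alpha>))"
    have e': "0 < e'" using e alpha_pos by (simp add: e'_def)
    \<comment> \<open>The 1 covers the case that both Lipschitz constants are 0.\<close>
    define \<eta> where "\<eta> = e' / (K2 + K3 + 1)"
    have \<eta>: "0 < \<eta>" using e' G2.K_nonneg G3.K_nonneg by (simp add: \<eta>_def)
    have K\<eta>: "K2 * \<eta> + K3 * \<eta> \<le> e'"
    proof -
      have "K2 * \<eta> + K3 * \<eta> \<le> (K2 + K3 + 1) * \<eta>" using \<eta> by (simp add: algebra_simps)
      also have "\<dots> = e'" using G2.K_nonneg G3.K_nonneg by (simp add: \<eta>_def)
      finally show ?thesis .
    qed
    obtain m where m: "(LINT p|P. tail \<eta> m (snd p) + tail \<eta> m (fst p)) < e'"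
      using tail_P_small[OF e'] by blast
    let ?B = "\<lambda>n x. wt n x * (h0 x * interp \<eta> m (G2 ((T ^^ q n) x)) (fq n x) * interp \<eta> m (G3 ((T ^^ (2 * q n)) x)) (fq' n x))"
    let ?b = "\<lambda>p x. h0 x * interp \<eta> m (G2 x) (snd p) * interp \<eta> m (G3 x) (fst p)"
    let ?D = "\<lambda>n x. wt n x * (tail \<eta> m (fq n x) + tail \<eta> m (fq' n x))"
    let ?d = "\<lambda>p. tail \<eta> m (snd p) + tail \<eta> m (fst p)"
    define B where "B n = (LINT x|M. ?B n x)" for n
    define B' where "B' = (LINT p|P. LINT x|M. ?b p x)"
    define D where "D n = (LINT x|M. ?D n x)" for n
    define D' where "D' = (LINT p|P. ?d p)"
    have err: "\<bar>h * G2 x (- v) * G3 y (- u) - h * interp \<eta> m (G2 x) v * interp \<eta> m (G3 y) u\<bar>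
       \<le> e' + (tail \<eta> m v + tail \<eta> m u)" if "x \<in> space M" "y \<in> space M" "\<bar>h\<bar> \<le> 1" for h x y u v
    proof -
      have "\<bar>h * G2 x (- v) * G3 y (- u) - h * interp \<eta> m (G2 x) v * interp \<eta> m (G3 y) u\<bar>
        \<le> \<bar>G2 x (- v) - interp \<eta> m (G2 x) v\<bar> + \<bar>G3 y (- u) - interp \<eta> m (G3 y) u\<bar>"
        using that \<eta> by (intro abs_mult3_diff G2.G_abs G3.interp_G_abs)
      also have "\<dots> \<le> (K2 * \<eta> + tail \<eta> m v) + (K3 * \<eta> + tail \<eta> m u)"
        using that by (intro add_mono G2.interp_G(3)[OF \<eta>] G3.interp_G(3)[OF \<eta>])
      finally show ?thesis using K\<eta> by linarith
    qed
    have tail_abs: "\<bar>tail \<eta> m v + tail \<eta> m u\<bar> \<le> 2" for u v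
      using tail_bounds[of \<eta> m u] tail_bounds[of \<eta> m v] by simp
    have iA: "integrable M (\<lambda>x. ?A n x)" for n
      by (rule integrable_bounded[where C=1]) (auto intro!: abs_mult_le_1 h0_bd G2.G_abs G3.G_abs)
    have iB: "integrable M (\<lambda>x. ?B n x)" for n
      by (rule integrable_bounded[where C=1]) (auto intro!: abs_mult_le_1 h0_bd G2.interp_G_abs G3.interp_G_abs \<eta>)
    have iD: "integrable M (\<lambda>x. ?D n x)" for n
      by (rule integrable_wt, rule integrable_bounded[where C=2]) (auto intro!: tail_abs)
    have AB: "\<bar>A n - B n\<bar> \<le> e' + D n" for n
    proof -
      have "\<bar>A n - B n\<bar> \<le> (LINT x|M. e' + ?D n x)"
        unfolding A_def B_def
      proof (rule abs_integral_diff_le[OF iA iB])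
        fix x assume x: "x \<in> space M"
        show "\<bar>?A n x - ?B n x\<bar> \<le> e' + ?D n x"
        proof (cases "x \<in> W n")
          case True
          then show ?thesis using err[of "(T ^^ q n) x" "(T ^^ (2 * q n)) x" "h0 x" "fq n x" "fq' n x"] x h0_bd[OF x]
            by (simp add: wt_def)
        next
          case False
          then show ?thesis using e' by (simp add: wt_def)
        qed
      qed (use iD[of n] in simp)
      also have "\<dots> = e' + D n" unfolding D_def using iD[of n] by (simp add: prob_space)
      finally show ?thesis .
    qed
    have jA: "integrable P (\<lambda>p. LINT x|M. ?a p x)"
    proof (rule P.integrable_bounded[where C=1])
      show "(\<lambda>p. LINT x|M. ?a p x) \<in> borel_measurable P" by measurable
      show "\<bar>LINT x|M. ?a p x\<bar> \<le> 1" for p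
        by (rule order_trans[OF integral_abs_bound integral_le_const])
           (auto intro!: abs_mult_le_1 h0_bd G2.G_abs G3.G_abs integrable_bounded[where C=1] AE_I2)
    qed
    have jB: "integrable P (\<lambda>p. LINT x|M. ?b p x)"
    proof (rule P.integrable_bounded[where C=1])
      show "(\<lambda>p. LINT x|M. ?b p x) \<in> borel_measurable P" by measurable
      show "\<bar>LINT x|M. ?b p x\<bar> \<le> 1" for p
        by (rule order_trans[OF integral_abs_bound integral_le_const])
           (auto intro!: abs_mult_le_1 h0_bd G2.interp_G_abs G3.interp_G_abs integrable_bounded[where C=1] AE_I2 \<eta>)
    qed
    have jD: "integrable P ?d"
      by (rule P.integrable_bounded[where C=2]) (use tail_abs in \<open>auto\<close>)
    have AB': "\<bar>A' - B'\<bar> \<le> e' + D'"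
    proof -
      have "\<bar>A' - B'\<bar> \<le> (LINT p|P. e' + ?d p)"
        unfolding A'_def B'_def
      proof (rule abs_integral_diff_le[OF jA jB])
        fix p :: "real \<times> real"
        have k: "integrable M (\<lambda>x. ?a p x)"
          by (rule integrable_bounded[where C=1]) (auto intro!: abs_mult_le_1 h0_bd G2.G_abs G3.G_abs)
        have k': "integrable M (\<lambda>x. ?b p x)"
          by (rule integrable_bounded[where C=1]) (auto intro!: abs_mult_le_1 h0_bd G2.interp_G_abs G3.interp_G_abs \<eta>)
        have "\<bar>(LINT x|M. ?a p x) - (LINT x|M. ?b p x)\<bar> \<le> (LINT x|M. e' + ?d p)"
          by (rule abs_integral_diff_le[OF k k']) (use err h0_bd in auto)
        then show "\<bar>(LINT x|M. ?a p x) - (LINT x|M. ?b p x)\<bar> \<le> e' + ?d p"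
          by (simp add: prob_space)
      qed (use jD in simp)
      also have "\<dots> = e' + D'" unfolding D'_def using jD by (simp add: P.prob_space)
      finally show ?thesis .
    qed
    let ?r = "\<lambda>n. \<bar>B n - \<alpha> * B'\<bar> + (D n - \<alpha> * D')"
    have "?r \<longlonglongrightarrow> 0 + 0"
      using interp_tendsto[OF \<eta>, of m] integral_tail_tendsto[OF \<eta>, of m]
      unfolding B_def[symmetric] B'_def[symmetric] D_def[symmetric] D'_def[symmetric]
      by (intro tendsto_add tendsto_rabs_zero LIM_zero)
    moreover have "\<bar>A n - \<alpha> * A'\<bar> \<le> ?r n + e" for n
    proof -
      have D': "D' \<le> e'" using m by (simp add: D'_def)
      have "\<bar>\<alpha> * B' - \<alpha> * A'\<bar> \<le> \<alpha> * (e' + D')"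
        using AB' alpha_pos by (simp add: right_diff_distrib[symmetric] abs_mult abs_minus_commute)
      moreover have "\<alpha> * D' \<le> \<alpha> * e'" using D' alpha_pos by simp
      moreover have "4 * e' + 4 * (\<alpha> * e') = e"
      proof -
        have "4 * e' + 4 * (\<alpha> * e') = (4 * (1 + \<alpha>)) * e'" by (simp add: algebra_simps)
        also have "\<dots> = e" using alpha_pos by (simp add: e'_def)
        finally show ?thesis .
      qed
      moreover have "0 \<le> \<alpha> * e'" using alpha_pos e' by simp
      ultimately show ?thesis using AB[of n] e' D' unfolding distrib_left by linarith
    qed
    ultimately show "\<exists>b. b \<longlonglongrightarrow> 0 \<and> (\<forall>n. \<bar>A n - \<alpha> * A'\<bar> \<le> b n + e)" by auto
  qed
  from LIM_zero_cancel[OF this] show ?thesis unfolding A_def A'_def .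
qed

end
end

section \<open>Density of flow-Lipschitz functions\<close>

text \<open>The sets approximable in L1 of both measures by the same function form a sigma-algebra:
  \<open>1 - h\<close> handles complements, \<open>max\<close> finite unions, and countable unions
  follow because the partial unions exhaust the measure. Two measures are treated together because
  \<open>reversal_inequality\<close> needs a single function close to \<open>E\<close> for both
  limit laws; with equal measures it gives the density of flow-Lipschitz functions.\<close>

lemma approx_by_lattice:
  fixes K1 K2 :: "'b measure" and \<A> :: "('b \<Rightarrow> real) \<Rightarrow> bool"
  assumes fin: "finite_measure K1" "finite_measure K2" and sets_eq: "sets K2 = sets K1"
    and gen: "sets K1 \<subseteq> sigma_sets (space K1) \<G>" "\<G> \<subseteq> sets K1"
    and meas: "\<And>h. \<A> h \<Longrightarrow> h \<in> borel_measurable K1"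
    and bounds: "\<And>h z. \<A> h \<Longrightarrow> z \<in> space K1 \<Longrightarrow> 0 \<le> h z \<and> h z \<le> 1"
    and zero: "\<A> (\<lambda>_. 0)"
    and compl: "\<And>h. \<A> h \<Longrightarrow> \<A> (\<lambda>z. 1 - h z)"
    and max: "\<And>h h'. \<A> h \<Longrightarrow> \<A> h' \<Longrightarrow> \<A> (\<lambda>z. max (h z) (h' z))"
    and approx: "\<And>A e. A \<in> \<G> \<Longrightarrow> 0 < e \<Longrightarrow>
      \<exists>h. \<A> h \<and> (LINT z|K1. \<bar>h z - indicator A z\<bar>) < e \<and> (LINT z|K2. \<bar>h z - indicator A z\<bar>) < e"
    and E: "E \<in> sets K1" and e: "0 < e"
  shows "\<exists>h. \<A> h \<and> (LINT z|K1. \<bar>h z - indicator E z\<bar>) < e \<and> (LINT z|K2. \<bar>h z - indicator E z\<bar>) < e"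
proof -
  define d where "d K h A = (LINT z|K. \<bar>h z - indicator A z\<bar>)" for K :: "'b measure" and h :: "'b \<Rightarrow> real" and A :: "'b set"
  define Ap where "Ap A \<longleftrightarrow> (\<forall>e>0. \<exists>h. \<A> h \<and> d K1 h A < e \<and> d K2 h A < e)" for A
  have space_eq: "space K2 = space K1" by (rule sets_eq_imp_space_eq[OF sets_eq])
  have int: "integrable K (\<lambda>z. \<bar>h z - indicator A z\<bar>)"
    if "K = K1 \<or> K = K2" "\<A> h" "A \<in> sets K1" for K h A
  proof -
    interpret finite_measure K using fin that by auto
    have [measurable]: "h \<in> borel_measurable K" "A \<in> sets K"
      using that meas sets_eq by (auto simp: measurable_cong_sets[OF sets_eq refl])
    show ?thesis
    proof (rule integrable_bounded[where C=1])
      fix z assume "z \<in> space K"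
      then have "0 \<le> h z \<and> h z \<le> 1" using that bounds space_eq by auto
      then show "\<bar>\<bar>h z - indicator A z\<bar>\<bar> \<le> 1" by (auto simp: indicator_def)
    qed measurable
  qed
  have d_union: "d K (\<lambda>z. max (h z) (h' z)) (A \<union> B) \<le> d K h A + d K h' B"
    if "K = K1 \<or> K = K2" "\<A> h" "\<A> h'" "A \<in> sets K1" "B \<in> sets K1" for K h h' A B
  proof -
    have "d K (\<lambda>z. max (h z) (h' z)) (A \<union> B) \<le> (LINT z|K. \<bar>h z - indicator A z\<bar> + \<bar>h' z - indicator B z\<bar>)"
      unfolding d_def
    proof (rule integral_mono)
      fix z assume "z \<in> space K"
      then have "0 \<le> h z \<and> h z \<le> 1" "0 \<le> h' z \<and> h' z \<le> 1" using that bounds space_eq by auto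
      then show "\<bar>max (h z) (h' z) - indicator (A \<union> B) z\<bar> \<le> \<bar>h z - indicator A z\<bar> + \<bar>h' z - indicator B z\<bar>"
        by (auto simp: indicator_def)
    qed (use int[OF that(1) max[OF that(2,3)]] int[OF that(1,2,4)] int[OF that(1,3,5)] that in auto)
    then show ?thesis unfolding d_def using int[OF that(1,2,4)] int[OF that(1,3,5)] by simp
  qed
  have Ap_union: "Ap (A \<union> B)" if AB: "Ap A" "Ap B" "A \<in> sets K1" "B \<in> sets K1" for A B
    unfolding Ap_def
  proof (intro allI impI)
    fix e :: real assume "0 < e"
    then have e2: "0 < e / 2" by simp
    obtain h where h: "\<A> h" "d K1 h A < e / 2" "d K2 h A < e / 2" using AB(1)[unfolded Ap_def, rule_format, OF e2] by blast
    obtain h' where h': "\<A> h'" "d K1 h' B < e / 2" "d K2 h' B < e / 2" using AB(2)[unfolded Ap_def, rule_format, OF e2] by blast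
    show "\<exists>h. \<A> h \<and> d K1 h (A \<union> B) < e \<and> d K2 h (A \<union> B) < e"
      using d_union[of K1 h h' A B] d_union[of K2 h h' A B] max[OF h(1) h'(1)] h h' AB(3,4)
      by (intro exI[of _ "\<lambda>z. max (h z) (h' z)"]) auto
  qed
  have Ap_empty: "Ap {}" unfolding Ap_def d_def using zero by (auto intro!: exI[of _ "\<lambda>_. 0"])
  have "Ap E" if "E \<in> sigma_sets (space K1) \<G>" for E
    using that
  proof (induction rule: sigma_sets.induct)
    case (Basic A)
    then show ?case using approx unfolding Ap_def d_def by auto
  next
    case Empty
    show ?case by (rule Ap_empty)
  next
    case (Compl A)
    show ?case unfolding Ap_def
    proof (intro allI impI)
      fix e :: real assume "0 < e"
      then obtain h where h: "\<A> h" "d K1 h A < e" "d K2 h A < e" using Compl.IH unfolding Ap_def by blast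
      have "d K (\<lambda>z. 1 - h z) (space K1 - A) = d K h A" if "K = K1 \<or> K = K2" for K
        unfolding d_def using that space_eq by (intro Bochner_Integration.integral_cong) (auto simp: indicator_def)
      then show "\<exists>h. \<A> h \<and> d K1 h (space K1 - A) < e \<and> d K2 h (space K1 - A) < e"
        using h compl by (intro exI[of _ "\<lambda>z. 1 - h z"]) auto
    qed
  next
    case (Union A)
    have A: "A i \<in> sets K1" for i
      using Union.hyps[of i] sets.sigma_sets_subset[OF gen(2)] by blast
    define U where "U n = (\<Union>i<n. A i)" for n :: nat
    define V where "V = (\<Union>i. A i)"
    have UV [measurable]: "U n \<in> sets K1" "V \<in> sets K1" for n using A by (auto simp: U_def V_def)
    have ApU: "Ap (U n)" for n
    proof (induction n)
      case 0 then show ?case by (simp add: U_def Ap_empty)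
    next
      case (Suc n)
      have "Ap (U n \<union> A n)" by (rule Ap_union) (use Suc Union.IH A in auto)
      then show ?case by (simp add: U_def lessThan_Suc Un_commute)
    qed
    have lim: "(\<lambda>n. measure K (U n)) \<longlonglongrightarrow> measure K V" if "K = K1 \<or> K = K2" for K
    proof -
      interpret finite_measure K using fin that by auto
      have "(\<lambda>n. measure K (U n)) \<longlonglongrightarrow> measure K (\<Union>n. U n)"
      proof (rule finite_Lim_measure_incseq)
        show "incseq U" unfolding incseq_def U_def by (intro allI impI UN_mono) auto
        have "sets K = sets K1" using that sets_eq by auto
        then show "range U \<subseteq> sets K" using UV(1) by blast
      qed
      moreover have "(\<Union>n. U n) = V" by (auto simp: U_def V_def)
      ultimately show ?thesis by simp
    qed
    have dV: "d K h V \<le> d K h (U n) + (measure K V - measure K (U n))" if "K = K1 \<or> K = K2" "\<A> h" for K h n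
    proof -
      interpret finite_measure K using fin that by auto
      have UVK: "U n \<in> sets K" "V \<in> sets K" "U n \<subseteq> V" using that sets_eq UV by (auto simp: U_def V_def)
      have i: "integrable K (\<lambda>z. indicat_real V z - indicator (U n) z)"
        using UVK by (intro Bochner_Integration.integrable_diff) (auto simp: emeasure_eq_measure)
      have "d K h V \<le> (LINT z|K. \<bar>h z - indicator (U n) z\<bar> + (indicator V z - indicator (U n) z))"
        unfolding d_def
      proof (rule integral_mono)
        fix z
        show "\<bar>h z - indicator V z\<bar> \<le> \<bar>h z - indicator (U n) z\<bar> + (indicator V z - indicator (U n) z)"
          using UVK(3) by (auto simp: indicator_def)
      qed (use i int[OF that UV(1), of n] int[OF that UV(2)] in auto)
      also have "\<dots> = d K h (U n) + (measure K V - measure K (U n))"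
        unfolding d_def using i int[OF that UV(1), of n] UVK sets.sets_into_space[OF UVK(1)] sets.sets_into_space[OF UVK(2)]
        by (simp add: Int_absorb2 emeasure_eq_measure)
      finally show ?thesis .
    qed
    show ?case unfolding Ap_def V_def[symmetric]
    proof (intro allI impI)
      fix e :: real assume "0 < e"
      then have e2: "0 < e / 2" by simp
      have "eventually (\<lambda>n. measure K1 V - e / 2 < measure K1 (U n) \<and> measure K2 V - e / 2 < measure K2 (U n)) sequentially"
        using e2 by (intro eventually_conj order_tendstoD(1)[OF lim]) auto
      then obtain n where n: "measure K1 V - e / 2 < measure K1 (U n)" "measure K2 V - e / 2 < measure K2 (U n)"
        by (auto simp: eventually_sequentially)
      obtain h where h: "\<A> h" "d K1 h (U n) < e / 2" "d K2 h (U n) < e / 2"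
        using ApU[of n, unfolded Ap_def, rule_format, OF e2] by blast
      show "\<exists>h. \<A> h \<and> d K1 h V < e \<and> d K2 h V < e"
        using h n dV[of K1 h n] dV[of K2 h n] by (intro exI[of _ h]) auto
    qed
  qed
  then have "Ap E" using E gen by blast
  then show ?thesis using e unfolding Ap_def d_def by blast
qed


section \<open>Functions that are Lipschitz along the orbits\<close>

definition clip :: "real \<Rightarrow> real" where "clip y = min 1 (max 0 y)"

lemma clip_bounds [simp]: "0 \<le> clip y" "clip y \<le> 1" "\<bar>clip y\<bar> \<le> 1"
  by (auto simp: clip_def)

lemma clip_lipschitz: "\<bar>clip y - clip y'\<bar> \<le> \<bar>y - y'\<bar>"
  by (auto simp: clip_def min_def max_def)

lemma clip_le: "0 \<le> y \<Longrightarrow> clip y \<le> y"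
  by (auto simp: clip_def)

lemma clip_meas [measurable]: "clip \<in> borel_measurable borel"
  unfolding clip_def[abs_def] by measurable

lemma clip_tendsto_1: "0 < y \<Longrightarrow> (\<lambda>k. clip (real k * y)) \<longlonglongrightarrow> 1"
proof (rule tendsto_eventually)
  assume y: "0 < y"
  obtain k0 :: nat where k0: "1 / y \<le> real k0" using real_arch_simple by blast
  have "clip (real k * y) = 1" if "k0 \<le> k" for k
  proof -
    have "1 / y \<le> real k" using k0 that by linarith
    then show ?thesis using y by (simp add: clip_def pos_divide_le_eq)
  qed
  then show "eventually (\<lambda>k. clip (real k * y) = 1) sequentially"
    by (auto simp: eventually_sequentially)
qed

context suspension
begin

text \<open>Regularity is asked along orbits only, as the base is a mere measurable space. On the
  lift to X x R it becomes the fibrewise bound of \<open>lipschitz_fibre\<close>.\<close>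

definition flow_lipschitz :: "('a \<times> real \<Rightarrow> real) \<Rightarrow> bool" where
  "flow_lipschitz h \<longleftrightarrow> h \<in> borel_measurable N \<and> (\<forall>z\<in>\<Omega>. 0 \<le> h z \<and> h z \<le> 1) \<and>
    (\<exists>K. \<forall>z\<in>\<Omega>. \<forall>t. \<bar>h (fl t z) - h z\<bar> \<le> K * \<bar>t\<bar>)"

text \<open>A criterion inside single fibres. If the orbit segment of time \<open>t\<close> leaves
  its fibre, each endpoint lies within \<open>\<bar>t\<bar>\<close> of an end of its own fibre,
  where \<open>h\<close> is at most \<open>L * \<bar>t\<bar>\<close>; two nonnegative values below
  this bound differ by no more than it.\<close>

lemma flow_lipschitzI:
  assumes "h \<in> borel_measurable N"
    and bd: "\<And>z. z \<in> \<Omega> \<Longrightarrow> 0 \<le> h z \<and> h z \<le> 1"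
    and L: "0 \<le> L"
    and fib: "\<And>x s s'. (x, s) \<in> \<Omega> \<Longrightarrow> (x, s') \<in> \<Omega> \<Longrightarrow> \<bar>h (x, s) - h (x, s')\<bar> \<le> L * \<bar>s - s'\<bar>"
    and bot: "\<And>x s. (x, s) \<in> \<Omega> \<Longrightarrow> h (x, s) \<le> L * s"
    and top: "\<And>x s. (x, s) \<in> \<Omega> \<Longrightarrow> h (x, s) \<le> L * (f x - s)"
  shows "flow_lipschitz h"
  unfolding flow_lipschitz_def
proof (intro conjI exI[of _ L] ballI allI)
  fix z t assume z: "z \<in> \<Omega>"
  obtain x s where zx: "z = (x, s)" by (cases z)
  have x: "x \<in> space M" and s: "0 \<le> s" "s < f x" using z by (auto simp: zx sf_space_def)
  define n where "n = idx x (s + t)"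
  define x' where "x' = ipow M T n x"
  define s' where "s' = s + t - cc n x"
  have fz: "fl t z = (x', s')" by (simp add: fl_eq zx flow_pt_def n_def x'_def s'_def)
  have z': "(x', s') \<in> \<Omega>" using fl_in[OF z, of t] by (simp add: fz)
  have n: "cc n x \<le> s + t" "s + t < cc (n + 1) x" using idx_bounds[OF x] by (auto simp: n_def)
  have fx': "f x' = cc (n + 1) x - cc n x" using cc_Suc[OF x, of n] by (simp add: x'_def)
  have cmono: "cc i x \<le> cc j x" if "i \<le> j" for i j
  proof -
    have "0 \<le> c * real_of_int (j - i)" using c_pos that by simp
    then show ?thesis using cc_mono[OF x that] by linarith
  qed
  have both: "\<bar>h (fl t z) - h z\<bar> \<le> L * \<bar>t\<bar>" if "h z \<le> L * \<bar>t\<bar>" "h (x', s') \<le> L * \<bar>t\<bar>"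
    using that bd[OF z] bd[OF z'] by (simp add: fz abs_le_iff)
  \<comment> \<open>The segment stays in its fibre, leaves it through the roof, or leaves it through
    the floor.\<close>
  consider "n = 0" | "1 \<le> n" | "n \<le> - 1" by linarith
  then show "\<bar>h (fl t z) - h z\<bar> \<le> L * \<bar>t\<bar>"
  proof cases
    case 1
    then have "x' = x" "s' = s + t" by (auto simp: x'_def s'_def)
    then show ?thesis unfolding fz using fib[of x s' s] z z' by (simp add: zx)
  next
    case 2
    then have f1: "f x \<le> cc n x" using cmono[of 1 n] x by (simp add: cc_1)
    then have le: "f x - s \<le> \<bar>t\<bar>" "s' \<le> \<bar>t\<bar>" using n s by (auto simp: s'_def)
    show ?thesis
    proof (rule both)
      show "h z \<le> L * \<bar>t\<bar>" using top[of x s] z mult_left_mono[OF le(1) L] by (simp add: zx)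
      show "h (x', s') \<le> L * \<bar>t\<bar>" using bot[OF z'] mult_left_mono[OF le(2) L] by simp
    qed
  next
    case 3
    then have f1: "cc (n + 1) x \<le> 0" using cmono[of "n + 1" 0] by simp
    then have le: "s \<le> \<bar>t\<bar>" "f x' - s' \<le> \<bar>t\<bar>" using n s by (auto simp: s'_def fx')
    show ?thesis
    proof (rule both)
      show "h z \<le> L * \<bar>t\<bar>" using bot[of x s] z mult_left_mono[OF le(1) L] by (simp add: zx)
      show "h (x', s') \<le> L * \<bar>t\<bar>" using top[OF z'] mult_left_mono[OF le(2) L] by simp
    qed
  qed
qed (use assms in auto)

lemma flow_lipschitz_compl: "flow_lipschitz h \<Longrightarrow> flow_lipschitz (\<lambda>z. 1 - h z)"
  unfolding flow_lipschitz_def by (auto simp: abs_minus_commute)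

lemma flow_lipschitz_max:
  assumes h: "flow_lipschitz h" and h': "flow_lipschitz h'"
  shows "flow_lipschitz (\<lambda>z. max (h z) (h' z))"
proof -
  obtain K where K: "\<And>z t. z \<in> \<Omega> \<Longrightarrow> \<bar>h (fl t z) - h z\<bar> \<le> K * \<bar>t\<bar>"
    using h unfolding flow_lipschitz_def by blast
  obtain K' where K': "\<And>z t. z \<in> \<Omega> \<Longrightarrow> \<bar>h' (fl t z) - h' z\<bar> \<le> K' * \<bar>t\<bar>"
    using h' unfolding flow_lipschitz_def by blast
  have "\<bar>max (h (fl t z)) (h' (fl t z)) - max (h z) (h' z)\<bar> \<le> max K K' * \<bar>t\<bar>" if "z \<in> \<Omega>" for z t
  proof -
    have "K * \<bar>t\<bar> \<le> max K K' * \<bar>t\<bar>" "K' * \<bar>t\<bar> \<le> max K K' * \<bar>t\<bar>"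
      by (auto intro: mult_right_mono)
    then have "\<bar>h (fl t z) - h z\<bar> \<le> max K K' * \<bar>t\<bar>" "\<bar>h' (fl t z) - h' z\<bar> \<le> max K K' * \<bar>t\<bar>"
      using K[OF that, of t] K'[OF that, of t] by linarith+
    then show ?thesis by (auto simp: max_def)
  qed
  moreover have "(\<lambda>z. max (h z) (h' z)) \<in> borel_measurable N" using h h' by (auto simp: flow_lipschitz_def)
  moreover have "0 \<le> max (h z) (h' z) \<and> max (h z) (h' z) \<le> 1" if "z \<in> \<Omega>" for z
    using h h' that by (fastforce simp: flow_lipschitz_def)
  ultimately show ?thesis unfolding flow_lipschitz_def by blast
qed

text \<open>The identity from the space with the generated sigma-algebra into \<open>N\<close> is
  measurable because its two coordinates are; hence every measurable set of \<open>N\<close> is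
  generated.\<close>

lemma sets_N_generated:
  defines "\<G> \<equiv> {fst -` A \<inter> \<Omega> | A. A \<in> sets M} \<union> {snd -` {..<r} \<inter> \<Omega> | r. True}"
  shows "sets N \<subseteq> sigma_sets (space N) \<G>" "\<G> \<subseteq> sets N"
proof -
  show G: "\<G> \<subseteq> sets N"
    using measurable_sets[OF fst_N] measurable_sets[OF snd_N] by (auto simp: \<G>_def)
  define N' where "N' = sigma (\<Omega>) \<G>"
  have sub: "\<G> \<subseteq> Pow (\<Omega>)" by (auto simp: \<G>_def)
  have N': "space N' = \<Omega>" "sets N' = sigma_sets (\<Omega>) \<G>"
    using sub by (auto simp: N'_def)
  have fst': "fst \<in> measurable N' M"
  proof (rule measurableI)
    fix A assume "A \<in> sets M"
    then show "fst -` A \<inter> space N' \<in> sets N'" unfolding N' by (auto simp: \<G>_def)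
  qed (auto simp: N' sf_space_def)
  have snd': "snd \<in> borel_measurable N'"
  proof (subst borel_measurable_iff_less, intro allI)
    fix r :: real
    have "{z \<in> space N'. snd z < r} = snd -` {..<r} \<inter> \<Omega>" by (auto simp: N')
    also have "\<dots> \<in> sets N'" unfolding N' by (auto simp: \<G>_def)
    finally show "{z \<in> space N'. snd z < r} \<in> sets N'" .
  qed
  have "(\<lambda>z. (fst z, snd z)) \<in> measurable N' (restrict_space (M \<Otimes>\<^sub>M borel) (\<Omega>))"
    by (intro measurable_restrict_space2 measurable_Pair fst' snd') (simp add: N')
  then have id: "(\<lambda>z. z) \<in> measurable N' N" by (simp add: measurable_cong_sets[OF refl sets_N])
  show "sets N \<subseteq> sigma_sets (space N) \<G>"
  proof
    fix E assume E: "E \<in> sets N"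
    have "(\<lambda>z. z) -` E \<inter> space N' \<in> sets N'" by (rule measurable_sets[OF id E])
    moreover have "(\<lambda>z. z) -` E \<inter> space N' = E" using sets.sets_into_space[OF E] by (auto simp: N')
    ultimately show "E \<in> sigma_sets (space N) \<G>" by (simp add: N')
  qed
qed

text \<open>Each fibre meets the floor in a single point. The floor has to be excluded because the
  lower cutoff in \<open>flow_lipschitz_dense_basic\<close> vanishes there for every
  \<open>k\<close>.\<close>

lemma AE_snd_pos: "AE z in N. 0 < snd z"
proof -
  let ?Z = "{z \<in> \<Omega>. snd z = 0}"
  have "{z \<in> space N. snd z = 0} \<in> sets N"
    by measurable
  then have m: "?Z \<in> sets N" by simp
  have "emeasure N ?Z = (\<integral>\<^sup>+z. indicator ?Z z \<partial>N)"
    using m by simp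
  also have "\<dots> = (\<integral>\<^sup>+x. \<integral>\<^sup>+s. indicator ?Z (flow_pt x s) * indicator {0..<f x} s \<partial>lborel \<partial>M)"
    by (intro nn_integral_N borel_measurable_indicator m)
  also have "\<dots> = (\<integral>\<^sup>+x. \<integral>\<^sup>+s. 0 \<partial>(lborel::real measure) \<partial>M)"
  proof (rule nn_integral_cong)
    fix x assume x: "x \<in> space M"
    have "AE s in lborel. s \<noteq> (0::real)" by (rule AE_lborel_singleton)
    then have "AE s in lborel. indicator ?Z (flow_pt x s) * indicator {0..<f x} s = (0::ennreal)"
    proof eventually_elim
      case (elim s)
      then show ?case using x flow_pt_base[of x s] by (auto simp: indicator_def sf_space_def)
    qed
    then show "(\<integral>\<^sup>+s. indicator ?Z (flow_pt x s) * indicator {0..<f x} s \<partial>lborel) = (\<integral>\<^sup>+s. 0 \<partial>(lborel::real measure))"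
      by (rule nn_integral_cong_AE)
  qed
  finally have "emeasure N ?Z = 0" by simp
  then have "AE z in N. z \<notin> ?Z" using m by (intro AE_not_in) auto
  then show ?thesis using AE_space by eventually_elim (auto simp: sf_space_def)
qed

text \<open>The functions \<open>\<phi> k\<close> may fail to match where roof and floor are
  identified. Two cutoffs bring them down linearly to 0 there, so that
  \<open>flow_lipschitzI\<close> applies, and tend to 1 in the open fibre.\<close>

lemma flow_lipschitz_dense_basic:
  fixes \<phi> :: "nat \<Rightarrow> 'a \<times> real \<Rightarrow> real"
  assumes A: "A \<in> sets N" and e: "0 < e"
    and phi [measurable]: "\<And>k. \<phi> k \<in> borel_measurable N"
    and bd: "\<And>k z. 0 \<le> \<phi> k z \<and> \<phi> k z \<le> 1"
    and lip: "\<And>k x s s'. \<bar>\<phi> k (x, s) - \<phi> k (x, s')\<bar> \<le> real k * \<bar>s - s'\<bar>"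
    and lim: "\<And>z. z \<in> \<Omega> \<Longrightarrow> (\<lambda>k. \<phi> k z) \<longlonglongrightarrow> indicator A z"
  shows "\<exists>h. flow_lipschitz h \<and> (LINT z|N. \<bar>h z - indicator A z\<bar>) < e"
proof -
  interpret N: finite_measure N by (rule finite_N)
  note [measurable] = A
  define h where "h k z = \<phi> k z * clip (real k * snd z) * clip (real k * (f (fst z) - snd z))" for k :: nat and z
  have [measurable]: "h k \<in> borel_measurable N" for k unfolding h_def[abs_def] by measurable
  have h_bd: "0 \<le> h k z \<and> h k z \<le> 1" for k z
    unfolding h_def using bd[of k z] by (auto intro!: mult_le_one)
  have le3: "p * q * r \<le> q" "p * q * r \<le> r" if "0 \<le> p" "p \<le> 1" "0 \<le> q" "q \<le> 1" "0 \<le> r" "r \<le> 1" for p q r :: real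
  proof -
    have "p * q * r \<le> p * q" using that by (intro mult_right_le_one_le) auto
    also have "\<dots> \<le> q" using that by (intro mult_left_le_one_le) auto
    finally show "p * q * r \<le> q" .
    have "(p * q) * r \<le> r" using that by (intro mult_left_le_one_le mult_le_one) auto
    then show "p * q * r \<le> r" .
  qed
  have Lip: "flow_lipschitz (h k)" for k
  \<comment> \<open>There are three factors with values in [0, 1], each Lipschitz in the height with
    constant \<open>k\<close>.\<close>
  proof (rule flow_lipschitzI[where L="3 * real k"])
    fix x s assume z: "(x, s) \<in> \<Omega>"
    then have s: "0 \<le> s" "s < f x" by (auto simp: sf_space_def)
    have "h k (x, s) \<le> clip (real k * s)" unfolding h_def fst_conv snd_conv using bd[of k "(x, s)"] by (intro le3) auto
    also have "\<dots> \<le> real k * s" using s by (intro clip_le) auto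
    also have "\<dots> \<le> 3 * real k * s" using s by simp
    finally show "h k (x, s) \<le> 3 * real k * s" .
    have "h k (x, s) \<le> clip (real k * (f x - s))" unfolding h_def fst_conv snd_conv using bd[of k "(x, s)"] by (intro le3) auto
    also have "\<dots> \<le> real k * (f x - s)" using s by (intro clip_le) auto
    also have "\<dots> \<le> 3 * real k * (f x - s)" using s by (intro mult_right_mono) auto
    finally show "h k (x, s) \<le> 3 * real k * (f x - s)" .
  next
    fix x s s'
    have c: "\<bar>clip (real k * y) - clip (real k * y')\<bar> \<le> real k * \<bar>y - y'\<bar>" for y y'
      using clip_lipschitz[of "real k * y" "real k * y'"] by (simp add: right_diff_distrib[symmetric] abs_mult)
    have "h k (x, s) - h k (x, s') = (\<phi> k (x, s) * clip (real k * s) * clip (real k * (f x - s))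
         - \<phi> k (x, s) * clip (real k * s') * clip (real k * (f x - s')))
       + (\<phi> k (x, s) - \<phi> k (x, s')) * (clip (real k * s') * clip (real k * (f x - s')))"
      by (simp add: h_def algebra_simps)
    also have "\<bar>\<dots>\<bar> \<le> (\<bar>clip (real k * s) - clip (real k * s')\<bar> + \<bar>clip (real k * (f x - s)) - clip (real k * (f x - s'))\<bar>)
       + \<bar>\<phi> k (x, s) - \<phi> k (x, s')\<bar> * 1"
      using bd[of k "(x, s)"]
      by (intro order_trans[OF abs_triangle_ineq] add_mono abs_mult3_diff)
         (auto simp: abs_mult intro!: mult_left_le mult_le_one)
    also have "\<dots> \<le> (real k * \<bar>s - s'\<bar> + real k * \<bar>(f x - s) - (f x - s')\<bar>) + real k * \<bar>s - s'\<bar>"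
      unfolding mult_1_right by (intro add_mono c lip)
    also have "\<dots> = 3 * real k * \<bar>s - s'\<bar>" by (simp add: abs_minus_commute)
    finally show "\<bar>h k (x, s) - h k (x, s')\<bar> \<le> 3 * real k * \<bar>s - s'\<bar>" .
  qed (use h_bd in auto)
  have "(\<lambda>k. LINT z|N. \<bar>h k z - indicator A z\<bar>) \<longlonglongrightarrow> (LINT z|N. 0)"
  proof (rule integral_dominated_convergence[where w="\<lambda>_. 1"])
    show "AE z in N. (\<lambda>k. \<bar>h k z - indicator A z\<bar>) \<longlonglongrightarrow> 0"
      using AE_snd_pos AE_space
    proof eventually_elim
      case (elim z)
      then have z: "z \<in> \<Omega>" by simp
      then have p: "0 < f (fst z) - snd z" by (auto simp: sf_space_def)
      have "(\<lambda>k. h k z) \<longlonglongrightarrow> indicator A z * 1 * 1"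
        unfolding h_def by (intro tendsto_mult lim z clip_tendsto_1 elim p)
      then have "(\<lambda>k. h k z) \<longlonglongrightarrow> indicator A z" by simp
      then show ?case by (intro tendsto_rabs_zero LIM_zero)
    qed
    show "AE z in N. norm \<bar>h k z - indicator A z\<bar> \<le> 1" for k
      using h_bd[of k] by (intro AE_I2) (auto simp: indicator_def)
  qed auto
  from order_tendstoD(2)[OF this, of e] e obtain k where "(LINT z|N. \<bar>h k z - indicator A z\<bar>) < e"
    by (auto simp: eventually_sequentially)
  then show ?thesis using Lip by blast
qed

lemma flow_lipschitz_dense:
  assumes E: "E \<in> sets N" and e: "0 < e"
  shows "\<exists>h. flow_lipschitz h \<and> (LINT z|N. \<bar>h z - indicator E z\<bar>) < e"
proof -
  have "\<exists>h. flow_lipschitz h \<and> (LINT z|N. \<bar>h z - indicator E z\<bar>) < e \<and> (LINT z|N. \<bar>h z - indicator E z\<bar>) < e"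
  proof (rule approx_by_lattice[OF finite_N finite_N refl sets_N_generated])
    show "flow_lipschitz (\<lambda>_. 0)" by (auto simp: flow_lipschitz_def intro!: exI[of _ 0])
    fix A and e :: real
    assume A: "A \<in> {fst -` A \<inter> \<Omega> | A. A \<in> sets M} \<union> {snd -` {..<r} \<inter> \<Omega> | r. True}" and e: "0 < e"
    have AN: "A \<in> sets N" using A sets_N_generated(2) by blast
    have "\<exists>h. flow_lipschitz h \<and> (LINT z|N. \<bar>h z - indicator A z\<bar>) < e"
      using A
    proof (elim UnE CollectE exE conjE)
      fix B assume B: "A = fst -` B \<inter> \<Omega>" "B \<in> sets M"
      note [measurable] = B(2)
      show ?thesis
        by (rule flow_lipschitz_dense_basic[OF AN e, of "\<lambda>k z. indicator B (fst z)"])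
           (auto simp: B(1) indicator_def)
    next
      fix r assume r: "A = snd -` {..<r} \<inter> \<Omega>"
      show ?thesis
      proof (rule flow_lipschitz_dense_basic[OF AN e, of "\<lambda>k z. clip (real k * (r - snd z))"])
        show "\<bar>clip (real k * (r - snd (x, s))) - clip (real k * (r - snd (x, s')))\<bar> \<le> real k * \<bar>s - s'\<bar>" for k and x :: 'a and s s'
          using clip_lipschitz[of "real k * (r - s)" "real k * (r - s')"]
          by (simp add: right_diff_distrib[symmetric] abs_mult abs_minus_commute)
        show "(\<lambda>k. clip (real k * (r - snd z))) \<longlonglongrightarrow> indicator A z" if "z \<in> \<Omega>" for z
        proof (cases "snd z < r")
          case True
          then show ?thesis using clip_tendsto_1[of "r - snd z"] that by (simp add: r)
        next
          case False
          then have "clip (real k * (r - snd z)) = 0" for k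
            by (simp add: clip_def mult_nonneg_nonpos)
          then show ?thesis using False by (simp add: r)
        qed
      qed auto
    qed
    then show "\<exists>h. flow_lipschitz h \<and> (LINT z|N. \<bar>h z - indicator A z\<bar>) < e \<and> (LINT z|N. \<bar>h z - indicator A z\<bar>) < e" by blast
  qed (use E e flow_lipschitz_compl flow_lipschitz_max in \<open>auto simp: flow_lipschitz_def\<close>)
  then show ?thesis by blast
qed

end

section \<open>Limits along the special flow\<close>

context suspension
begin

lemma flow_pt_comp [measurable (raw)]:
  "g \<in> measurable L M \<Longrightarrow> r \<in> borel_measurable L \<Longrightarrow> (\<lambda>z. flow_pt (g z) (r z)) \<in> measurable L N"
  using measurable_compose[OF measurable_Pair flow_pt_meas, of g L r] by simp

lemma fl_comp [measurable (raw)]: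
  "t \<in> borel_measurable L \<Longrightarrow> g \<in> measurable L N \<Longrightarrow> (\<lambda>z. fl (t z) (g z)) \<in> measurable L N"
  using measurable_compose[OF measurable_Pair fl_meas2, of t L g] by simp

definition in_fibre :: "'a \<Rightarrow> real \<Rightarrow> real" where
  "in_fibre x s = (if 0 \<le> s \<and> s < f x then 1 else 0)"

lemma in_fibre_comp [measurable (raw)]:
  assumes [measurable]: "g \<in> measurable L M" "r \<in> borel_measurable L"
  shows "(\<lambda>z. in_fibre (g z) (r z)) \<in> borel_measurable L"
  unfolding in_fibre_def by measurable

lemma in_fibre_bounds [simp]: "0 \<le> in_fibre x s" "in_fibre x s \<le> 1" "\<bar>in_fibre x s\<bar> \<le> 1"
  by (auto simp: in_fibre_def)

sublocale fibre: pair_sigma_finite M "lborel :: real measure" ..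

sublocale N: finite_measure N by (rule finite_N)

text \<open>The height is integrated last, so that for each fixed \<open>s\<close> the inner
  integral is one over the base, where the limit theorems apply.\<close>

lemma
  assumes g: "integrable N g"
  shows integrable_fibres: "integrable (M \<Otimes>\<^sub>M lborel) (\<lambda>(x, s). in_fibre x s * g (flow_pt x s))"
    and integral_N: "(LINT z|N. g z) = (LINT s|lborel. LINT x|M. in_fibre x s * g (flow_pt x s))"
proof -
  have "\<Omega> \<inter> space (M \<Otimes>\<^sub>M lborel) \<in> sets (M \<Otimes>\<^sub>M lborel)"
    by (rule sets.Int[OF sf_space_sets sets.top])
  note restr = integrable_restrict_space[OF this] integral_restrict_space[OF this]
  have eq: "indicator (\<Omega>) z *\<^sub>R g z = (case z of (x, s) \<Rightarrow> in_fibre x s * g (flow_pt x s))"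
    if "z \<in> space (M \<Otimes>\<^sub>M lborel)" for z
  proof (cases "z \<in> \<Omega>")
    case True
    then show ?thesis using flow_pt_base by (cases z) (simp add: sf_space_def in_fibre_def)
  next
    case False
    then show ?thesis using that by (cases z) (auto simp: sf_space_def in_fibre_def space_pair_measure)
  qed
  have "integrable (M \<Otimes>\<^sub>M lborel) (\<lambda>z. indicator (\<Omega>) z *\<^sub>R g z)"
    using g restr(1)[of g] by (simp add: sf_measure_def)
  then show i: "integrable (M \<Otimes>\<^sub>M lborel) (\<lambda>(x, s). in_fibre x s * g (flow_pt x s))"
    by (subst (asm) Bochner_Integration.integrable_cong[OF refl eq])
  have "(LINT z|N. g z) = (LINT z|(M \<Otimes>\<^sub>M lborel). indicator (\<Omega>) z *\<^sub>R g z)"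
    using restr(2)[of g] by (simp add: sf_measure_def)
  also have "\<dots> = (LINT (x, s)|(M \<Otimes>\<^sub>M lborel). in_fibre x s * g (flow_pt x s))"
    by (rule Bochner_Integration.integral_cong[OF refl eq])
  also have "\<dots> = (LINT s|lborel. LINT x|M. in_fibre x s * g (flow_pt x s))"
    using fibre.integral_snd[OF i] by simp
  finally show "(LINT z|N. g z) = (LINT s|lborel. LINT x|M. in_fibre x s * g (flow_pt x s))" .
qed

text \<open>The function is the measure of the set where \<open>f\<close> exceeds \<open>s\<close>,
  for \<open>s \<ge> 0\<close>. It is the majorant for exchanging limit and integration over
  heights.\<close>

lemma integrable_fibre_mass: "integrable lborel (\<lambda>s. LINT x|M. in_fibre x s)"
proof -
  have "integrable N (\<lambda>_. 1 :: real)" by simp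
  from fibre.integrable_snd[OF integrable_fibres[OF this]] show ?thesis by simp
qed

lemma lipschitz_fibre_flow_pt:
  assumes h: "flow_lipschitz h"
  shows "\<exists>K. \<forall>s. lipschitz_fibre M (\<lambda>x r. h (flow_pt x (s + r))) K"
proof -
  obtain K where K: "\<And>z t. z \<in> \<Omega> \<Longrightarrow> \<bar>h (fl t z) - h z\<bar> \<le> K * \<bar>t\<bar>"
    using h unfolding flow_lipschitz_def by blast
  have [measurable]: "h \<in> borel_measurable N" and bd: "\<And>z. z \<in> \<Omega> \<Longrightarrow> 0 \<le> h z \<and> h z \<le> 1"
    using h unfolding flow_lipschitz_def by auto
  have "lipschitz_fibre M (\<lambda>x r. h (flow_pt x (s + r))) K" for s
  proof
    show "(\<lambda>p. h (flow_pt (fst p) (s + snd p))) \<in> borel_measurable (M \<Otimes>\<^sub>M borel)" by measurable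
    fix x r r' assume x: "x \<in> space M"
    show "0 \<le> h (flow_pt x (s + r))" "h (flow_pt x (s + r)) \<le> 1" using bd x by auto
    show "\<bar>h (flow_pt x (s + r)) - h (flow_pt x (s + r'))\<bar> \<le> K * \<bar>r - r'\<bar>"
      using K[OF flow_pt_in[OF x], of "r - r'" "s + r'"] by (simp add: fl_flow_pt[OF x])
  qed
  then show ?thesis by blast
qed

end

context rigid_suspension
begin

text \<open>At a fixed height this is \<open>lipschitz_tendsto\<close> on the base, with the
  indicator of the fibre absorbed into the first function; the heights are then integrated by
  dominated convergence with majorant \<open>w\<close>.\<close>

lemma lipschitz_flow_tendsto:
  assumes h1 [measurable]: "h1 \<in> borel_measurable N" and bd1: "\<And>z. z \<in> \<Omega> \<Longrightarrow> \<bar>h1 z\<bar> \<le> 1"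
    and h2: "flow_lipschitz h2" and h3: "flow_lipschitz h3"
  shows "(\<lambda>n. LINT z|N. wt n (fst z) * h1 z * h2 (fl (a n) z) * h3 (fl (2 * a n) z))
    \<longlonglongrightarrow> \<alpha> * (LINT p|P. LINT z|N. h1 z * h2 (fl (- snd p) z) * h3 (fl (- fst p) z))"
proof -
  have [measurable]: "h2 \<in> borel_measurable N" "h3 \<in> borel_measurable N"
    and bd2: "\<And>z. z \<in> \<Omega> \<Longrightarrow> \<bar>h2 z\<bar> \<le> 1" and bd3: "\<And>z. z \<in> \<Omega> \<Longrightarrow> \<bar>h3 z\<bar> \<le> 1"
    using h2 h3 unfolding flow_lipschitz_def by auto
  obtain K2 where K2: "\<And>s. lipschitz_fibre M (\<lambda>x r. h2 (flow_pt x (s + r))) K2"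
    using lipschitz_fibre_flow_pt[OF h2] by blast
  obtain K3 where K3: "\<And>s. lipschitz_fibre M (\<lambda>x r. h3 (flow_pt x (s + r))) K3"
    using lipschitz_fibre_flow_pt[OF h3] by blast
  define w where "w s = (LINT x|M. in_fibre x s)" for s
  define I where "I n s = (LINT x|M. in_fibre x s * (wt n x * h1 (flow_pt x s) * h2 (flow_pt x (s + a n)) * h3 (flow_pt x (s + 2 * a n))))" for n s
  define H where "H s p = (LINT x|M. in_fibre x s * (h1 (flow_pt x s) * h2 (flow_pt x (s - snd p)) * h3 (flow_pt x (s - fst p))))" for s and p :: "real \<times> real"
  have w_meas [measurable]: "w \<in> borel_measurable borel" unfolding w_def[abs_def] by measurable
  have w_int: "integrable lborel w" using integrable_fibre_mass by (simp add: w_def[abs_def])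
  have H_meas [measurable]: "(\<lambda>z. H (fst z) (snd z)) \<in> borel_measurable (lborel \<Otimes>\<^sub>M P)"
    unfolding H_def by measurable
  have I_meas [measurable]: "I n \<in> borel_measurable lborel" for n
    unfolding I_def[abs_def] by measurable
  have bound: "\<bar>LINT x|M. in_fibre x s * k x\<bar> \<le> w s"
    if [measurable]: "k \<in> borel_measurable M" and k: "\<And>x. x \<in> space M \<Longrightarrow> \<bar>k x\<bar> \<le> 1" for k s
  proof -
    have i: "integrable M (\<lambda>x. in_fibre x s * k x)" "integrable M (\<lambda>x. in_fibre x s)"
      by (rule integrable_bounded[where C=1], (measurable)[1], use k in \<open>auto intro!: abs_mult_le_1\<close>)+
    have "\<bar>LINT x|M. in_fibre x s * k x\<bar> \<le> (LINT x|M. \<bar>in_fibre x s * k x\<bar>)" by (rule integral_abs_bound)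
    also have "\<dots> \<le> w s" unfolding w_def
    proof (rule integral_mono)
      fix x assume "x \<in> space M"
      then show "\<bar>in_fibre x s * k x\<bar> \<le> in_fibre x s" using k[of x] by (simp add: abs_mult mult_left_le)
    qed (use i in auto)
    finally show ?thesis .
  qed
  have I_bd: "\<bar>I n s\<bar> \<le> w s" for n s
    unfolding I_def by (rule bound) (auto intro!: abs_mult_le_1 bd1 bd2 bd3)
  have H_bd: "\<bar>H s p\<bar> \<le> w s" for s p
    unfolding H_def by (rule bound) (auto intro!: abs_mult_le_1 bd1 bd2 bd3)
  have I_lim: "(\<lambda>n. I n s) \<longlonglongrightarrow> \<alpha> * (LINT p|P. H s p)" for s
  proof -
    have "(\<lambda>n. LINT x|M. wt n x * ((in_fibre x s * h1 (flow_pt x s)) * h2 (flow_pt ((T ^^ q n) x) (s + - fq n x))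
         * h3 (flow_pt ((T ^^ (2 * q n)) x) (s + - fq' n x))))
      \<longlonglongrightarrow> \<alpha> * (LINT p|P. LINT x|M. (in_fibre x s * h1 (flow_pt x s)) * h2 (flow_pt x (s + - snd p)) * h3 (flow_pt x (s + - fst p)))"
      by (rule lipschitz_tendsto[OF _ _ K2 K3]) (auto intro!: abs_mult_le_1 bd1)
    moreover have "(LINT x|M. wt n x * ((in_fibre x s * h1 (flow_pt x s)) * h2 (flow_pt ((T ^^ q n) x) (s + - fq n x))
         * h3 (flow_pt ((T ^^ (2 * q n)) x) (s + - fq' n x)))) = I n s" for n
      unfolding I_def
    proof (rule Bochner_Integration.integral_cong[OF refl])
      fix x assume x: "x \<in> space M"
      \<comment> \<open>Moving by \<open>q n\<close> fibres turns the height \<open>s + a n\<close>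
        into \<open>s + a n - cc (int (q n)) x\<close>, which is \<open>s - fq n x\<close>.\<close>
      have 1: "flow_pt ((T ^^ q n) x) (s + - fq n x) = flow_pt x (s + a n)"
        using flow_pt_shift[OF x, of "int (q n)" "s + a n"] by (simp add: ipow_of_nat fq_def algebra_simps)
      have 2: "flow_pt ((T ^^ (2 * q n)) x) (s + - fq' n x) = flow_pt x (s + 2 * a n)"
        using flow_pt_shift[OF x, of "int (2 * q n)" "s + 2 * a n"] unfolding ipow_of_nat fq'_def by (simp add: algebra_simps)
      show "wt n x * ((in_fibre x s * h1 (flow_pt x s)) * h2 (flow_pt ((T ^^ q n) x) (s + - fq n x))
         * h3 (flow_pt ((T ^^ (2 * q n)) x) (s + - fq' n x)))
        = in_fibre x s * (wt n x * h1 (flow_pt x s) * h2 (flow_pt x (s + a n)) * h3 (flow_pt x (s + 2 * a n)))"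
        unfolding 1 2 by simp
    qed
    moreover have "(LINT x|M. (in_fibre x s * h1 (flow_pt x s)) * h2 (flow_pt x (s + - snd p)) * h3 (flow_pt x (s + - fst p))) = H s p" for p
      unfolding H_def by (simp add: mult.assoc)
    ultimately show ?thesis by simp
  qed
  interpret LP: pair_sigma_finite "lborel :: real measure" P ..
  have H_P: "integrable P (H s)" for s
  proof (rule P.integrable_bounded[where C="w s"])
    show "H s \<in> borel_measurable P"
      using measurable_compose[OF measurable_Pair1'[of s lborel P] H_meas] by simp
  qed (use H_bd in auto)
  have H_int: "integrable (lborel \<Otimes>\<^sub>M P) (\<lambda>(s, p). H s p)"
  proof (rule LP.Fubini_integrable)
    have "\<bar>LINT p|P. \<bar>H s p\<bar>\<bar> \<le> w s" for s
    proof -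
      have "(LINT p|P. \<bar>H s p\<bar>) \<le> w s"
        using H_P[of s] H_bd by (intro P.integral_le_const) auto
      then show ?thesis by (subst abs_of_nonneg) auto
    qed
    then show "integrable lborel (\<lambda>s. LINT p|P. norm (case (s, p) of (s, p) \<Rightarrow> H s p))"
      by (intro Bochner_Integration.integrable_bound[OF w_int]) (auto intro!: AE_I2 order_trans[OF _ abs_ge_self])
  qed (use H_P in \<open>auto simp: case_prod_beta'\<close>)
  have "(\<lambda>n. LINT s|lborel. I n s) \<longlonglongrightarrow> (LINT s|lborel. \<alpha> * (LINT p|P. H s p))"
  proof (rule integral_dominated_convergence[OF _ _ w_int])
    have "(\<lambda>s. LINT p|P. H s p) \<in> borel_measurable lborel" using LP.integrable_fst[OF H_int] by auto
    then show "(\<lambda>s. \<alpha> * (LINT p|P. H s p)) \<in> borel_measurable lborel" by simp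
  qed (use I_lim I_bd in auto)
  also have "(LINT s|lborel. \<alpha> * (LINT p|P. H s p)) = \<alpha> * (LINT p|P. LINT s|lborel. H s p)"
    using LP.Fubini_integral[OF H_int] by simp
  finally have lim: "(\<lambda>n. LINT s|lborel. I n s) \<longlonglongrightarrow> \<alpha> * (LINT p|P. LINT s|lborel. H s p)" .
  have "(LINT s|lborel. H s p) = (LINT z|N. h1 z * h2 (fl (- snd p) z) * h3 (fl (- fst p) z))" for p
  proof -
    have "(LINT z|N. h1 z * h2 (fl (- snd p) z) * h3 (fl (- fst p) z))
      = (LINT s|lborel. LINT x|M. in_fibre x s * (h1 (flow_pt x s) * h2 (fl (- snd p) (flow_pt x s)) * h3 (fl (- fst p) (flow_pt x s))))"
      by (rule integral_N, rule N.integrable_bounded[where C=1]) (auto intro!: abs_mult_le_1 bd1 bd2 bd3)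
    also have "\<dots> = (LINT s|lborel. H s p)"
      unfolding H_def by (intro Bochner_Integration.integral_cong refl) (simp add: fl_flow_pt)
    finally show ?thesis ..
  qed
  with lim have "(\<lambda>n. LINT s|lborel. I n s) \<longlonglongrightarrow> \<alpha> * (LINT p|P. LINT z|N. h1 z * h2 (fl (- snd p) z) * h3 (fl (- fst p) z))" by simp
  moreover have "(LINT z|N. wt n (fst z) * h1 z * h2 (fl (a n) z) * h3 (fl (2 * a n) z)) = (LINT s|lborel. I n s)" for n
  proof -
    have "(LINT z|N. wt n (fst z) * h1 z * h2 (fl (a n) z) * h3 (fl (2 * a n) z))
      = (LINT s|lborel. LINT x|M. in_fibre x s * (wt n (fst (flow_pt x s)) * h1 (flow_pt x s) * h2 (fl (a n) (flow_pt x s)) * h3 (fl (2 * a n) (flow_pt x s))))"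
      by (rule integral_N, rule N.integrable_bounded[where C=1]) (auto intro!: abs_mult_le_1 bd1 bd2 bd3)
    also have "\<dots> = (LINT s|lborel. I n s)"
      unfolding I_def
    proof (intro Bochner_Integration.integral_cong refl)
      fix s x assume x: "x \<in> space M"
      \<comment> \<open>Inside the fibre \<open>flow_pt x s\<close> is \<open>(x, s)\<close>, so the
        weight is evaluated at \<open>x\<close>; outside it both sides are 0.\<close>
      show "in_fibre x s * (wt n (fst (flow_pt x s)) * h1 (flow_pt x s) * h2 (fl (a n) (flow_pt x s)) * h3 (fl (2 * a n) (flow_pt x s)))
        = in_fibre x s * (wt n x * h1 (flow_pt x s) * h2 (flow_pt x (s + a n)) * h3 (flow_pt x (s + 2 * a n)))"
        using x flow_pt_base[of x s] by (auto simp: in_fibre_def fl_flow_pt sf_space_def)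
    qed
    finally show ?thesis .
  qed
  ultimately show ?thesis by simp
qed

end

section \<open>Triples of points\<close>

text \<open>Only the traces on the space have to be measurable, so that the constant $1$ is in the span.\<close>

inductive box_span :: "'b measure \<Rightarrow> ('b \<times> 'b \<times> 'b \<Rightarrow> real) \<Rightarrow> bool" for L :: "'b measure" where
  box: "A \<inter> space L \<in> sets L \<Longrightarrow> B \<inter> space L \<in> sets L \<Longrightarrow> C \<inter> space L \<in> sets L \<Longrightarrow>
     box_span L (\<lambda>z. indicator A (fst z) * indicator B (fst (snd z)) * indicator C (snd (snd z)))"
| add: "box_span L g \<Longrightarrow> box_span L h \<Longrightarrow> box_span L (\<lambda>z. g z + h z)"
| scale: "box_span L g \<Longrightarrow> box_span L (\<lambda>z. r * g z)"

lemma box_span_1: "box_span L (\<lambda>z. 1)"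
  using box_span.box[of UNIV L UNIV UNIV] by simp

lemma box_span_mult_box:
  assumes "box_span L g" and s: "A \<inter> space L \<in> sets L" "B \<inter> space L \<in> sets L" "C \<inter> space L \<in> sets L"
  shows "box_span L (\<lambda>z. g z * (indicator A (fst z) * indicator B (fst (snd z)) * indicator C (snd (snd z))))"
  using assms(1)
proof induction
  case (box A' B' C')
  have "D' \<inter> D \<inter> space L \<in> sets L" if "D' \<inter> space L \<in> sets L" "D \<inter> space L \<in> sets L" for D D'
  proof -
    have "D' \<inter> D \<inter> space L = (D' \<inter> space L) \<inter> (D \<inter> space L)" by blast
    then show ?thesis using that by auto
  qed
  then have "box_span L (\<lambda>z. indicator (A' \<inter> A) (fst z) * indicator (B' \<inter> B) (fst (snd z)) * indicator (C' \<inter> C) (snd (snd z)))"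
    using box s by (intro box_span.box) auto
  then show ?case by (simp add: indicator_inter_arith mult_ac)
next
  case (add g h)
  then show ?case using box_span.add by (simp add: distrib_right)
next
  case (scale g r)
  then show ?case using box_span.scale[of L _ r] by (simp add: mult.assoc)
qed

text \<open>Products make the 0-1 valued members of the span closed under \<open>max\<close>, which
  for them is \<open>h + h' - h * h'\<close>.\<close>

lemma box_span_mult:
  assumes "box_span L g" "box_span L h"
  shows "box_span L (\<lambda>z. g z * h z)"
  using assms(2)
proof induction
  case (box A B C)
  then show ?case by (rule box_span_mult_box[OF assms(1)])
next
  case (add g h)
  then show ?case using box_span.add by (simp add: distrib_left)
next
  case (scale g r)
  then show ?case using box_span.scale[of L _ r] by (simp add: mult.left_commute)
qed

lemma box_span_bounded: "box_span L g \<Longrightarrow> \<exists>C. \<forall>z. \<bar>g z\<bar> \<le> C"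
proof (induction rule: box_span.induct)
  case (box A B C)
  show ?case by (intro exI[of _ 1]) (auto simp: indicator_def)
next
  case (add g h)
  then obtain C C' where "\<forall>z. \<bar>g z\<bar> \<le> C" "\<forall>z. \<bar>h z\<bar> \<le> C'" by blast
  then have "\<bar>g z + h z\<bar> \<le> C + C'" for z by (meson abs_triangle_ineq add_mono order_trans)
  then show ?case by blast
next
  case (scale g r)
  then obtain C where C: "\<forall>z. \<bar>g z\<bar> \<le> C" by blast
  then have "\<bar>r * g z\<bar> \<le> \<bar>r\<bar> * C" for z unfolding abs_mult by (intro mult_left_mono C[rule_format] abs_ge_zero)
  then show ?case by blast
qed

lemma box_span_measurable: "box_span L g \<Longrightarrow> g \<in> borel_measurable (L \<Otimes>\<^sub>M L \<Otimes>\<^sub>M L)"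
proof (induction rule: box_span.induct)
  case (box A B C)
  have [measurable]: "indicat_real D \<in> borel_measurable L" if "D \<inter> space L \<in> sets L" for D
    using that by (subst borel_measurable_indicator_iff) (simp add: Int_commute)
  note [measurable] = this[OF box(1)] this[OF box(2)] this[OF box(3)]
  show ?case by measurable
qed auto

text \<open>Preimages of boxes under the reversal composed with \<open>S\<close> are boxes again, so
  the class on which the limits are known is stable under the conjugacy.\<close>

lemma box_span_flip:
  assumes "box_span L g" and S: "S \<in> measurable L L"
  shows "box_span L (\<lambda>z. g (S (snd (snd z)), S (fst (snd z)), S (fst z)))"
  using assms(1)
proof induction
  case (box A B C)
  have "S -` D \<inter> space L \<in> sets L" if "D \<inter> space L \<in> sets L" for D
  proof -
    have "S -` D \<inter> space L = S -` (D \<inter> space L) \<inter> space L"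
      using measurable_space[OF S] by auto
    then show ?thesis using measurable_sets[OF S that] by simp
  qed
  then have "box_span L (\<lambda>z. indicator (S -` C) (fst z) * indicator (S -` B) (fst (snd z)) * indicator (S -` A) (snd (snd z)))"
    using box by (intro box_span.box) auto
  then show ?case by (simp add: indicator_vimage mult_ac)
qed (auto intro: box_span.intros)

lemma sets_triple_generated:
  fixes L :: "'b measure"
  defines "\<G> \<equiv> {A \<times> B \<times> C | A B C. A \<in> sets L \<and> B \<in> sets L \<and> C \<in> sets L}"
  shows "sets (L \<Otimes>\<^sub>M L \<Otimes>\<^sub>M L) \<subseteq> sigma_sets (space (L \<Otimes>\<^sub>M L \<Otimes>\<^sub>M L)) \<G>" "\<G> \<subseteq> sets (L \<Otimes>\<^sub>M L \<Otimes>\<^sub>M L)"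
proof -
  let ?O = "space L \<times> space L \<times> space L"
  show "\<G> \<subseteq> sets (L \<Otimes>\<^sub>M L \<Otimes>\<^sub>M L)" by (auto simp: \<G>_def)
  define L' where "L' = sigma ?O \<G>"
  have sub: "\<G> \<subseteq> Pow ?O" using sets.sets_into_space by (fastforce simp: \<G>_def)
  have L': "space L' = ?O" "sets L' = sigma_sets ?O \<G>"
    using sub by (auto simp: L'_def)
  have proj: "g \<in> measurable L' L"
    if "\<And>A. A \<in> sets L \<Longrightarrow> g -` A \<inter> ?O \<in> \<G>" "\<And>z. z \<in> ?O \<Longrightarrow> g z \<in> space L" for g
    using that by (intro measurableI) (auto simp: L' intro: sigma_sets.Basic)
  have box: "A \<times> B \<times> C \<in> \<G>" if "A \<in> sets L" "B \<in> sets L" "C \<in> sets L" for A B C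
    unfolding \<G>_def using that by blast
  have "fst -` A \<inter> ?O = A \<times> space L \<times> space L"
    "(\<lambda>z. fst (snd z)) -` A \<inter> ?O = space L \<times> A \<times> space L"
    "(\<lambda>z. snd (snd z)) -` A \<inter> ?O = space L \<times> space L \<times> A" if "A \<in> sets L" for A
    using sets.sets_into_space[OF that] by auto
  note this [simp]
  have "fst \<in> measurable L' L" "(\<lambda>z. fst (snd z)) \<in> measurable L' L" "(\<lambda>z. snd (snd z)) \<in> measurable L' L"
    by (rule proj; auto simp del: vimage_fst intro!: box)+
  then have id: "(\<lambda>z. (fst z, fst (snd z), snd (snd z))) \<in> measurable L' (L \<Otimes>\<^sub>M L \<Otimes>\<^sub>M L)"
    by (intro measurable_Pair)
  show "sets (L \<Otimes>\<^sub>M L \<Otimes>\<^sub>M L) \<subseteq> sigma_sets (space (L \<Otimes>\<^sub>M L \<Otimes>\<^sub>M L)) \<G>"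
  proof
    fix E assume E: "E \<in> sets (L \<Otimes>\<^sub>M L \<Otimes>\<^sub>M L)"
    have "(\<lambda>z. (fst z, fst (snd z), snd (snd z))) -` E \<inter> space L' \<in> sets L'" by (rule measurable_sets[OF id E])
    moreover have "(\<lambda>z. (fst z, fst (snd z), snd (snd z))) -` E \<inter> space L' = E"
      using sets.sets_into_space[OF E] by (auto simp: L' space_pair_measure)
    ultimately show "E \<in> sigma_sets (space (L \<Otimes>\<^sub>M L \<Otimes>\<^sub>M L)) \<G>" by (simp add: L' space_pair_measure)
  qed
qed

context suspension
begin

lemma integral_fl:
  fixes g :: "'a \<times> real \<Rightarrow> real"
  assumes [measurable]: "g \<in> borel_measurable N"
  shows "(LINT z|N. g (fl t z)) = (LINT z|N. g z)"
proof -
  have "(LINT z|distr N N (fl t). g z) = (LINT z|N. g (fl t z))"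
    by (intro integral_distr) auto
  then show ?thesis by (simp add: distr_fl)
qed

end

context rigid_suspension
begin

text \<open>\<open>B\<close> and \<open>C\<close> are replaced by flow-Lipschitz functions. Since
  the flow preserves \<open>N\<close>, the bound for the error is the same at all times, hence
  uniform in \<open>n\<close> and \<open>p\<close>. \<open>A\<close> can stay, because
  \<open>lipschitz_flow_tendsto\<close> asks of its first function only measurability and a
  bound.\<close>

lemma sets_flow_tendsto:
  assumes [measurable]: "A \<in> sets N" "B \<in> sets N" "C \<in> sets N"
  shows "(\<lambda>n. LINT z|N. wt n (fst z) * indicator A z * indicator B (fl (a n) z) * indicator C (fl (2 * a n) z))
    \<longlonglongrightarrow> \<alpha> * (LINT p|P. LINT z|N. indicator A z * indicator B (fl (- snd p) z) * indicator C (fl (- fst p) z))"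
proof -
  define F where "F h1 h2 h3 s t = (LINT z|N. h1 z * h2 (fl s z) * h3 (fl t z))"
    for h1 h2 h3 :: "'a \<times> real \<Rightarrow> real" and s t
  have F_diff: "\<bar>F h1 h2 h3 s t - F h1 h2' h3' s t\<bar> \<le> (LINT z|N. \<bar>h2 z - h2' z\<bar>) + (LINT z|N. \<bar>h3 z - h3' z\<bar>)"
    if m: "h1 \<in> borel_measurable N" "h2 \<in> borel_measurable N" "h3 \<in> borel_measurable N" "h2' \<in> borel_measurable N" "h3' \<in> borel_measurable N"
    and b: "\<And>z. z \<in> \<Omega> \<Longrightarrow> \<bar>h1 z\<bar> \<le> 1" "\<And>z. z \<in> \<Omega> \<Longrightarrow> \<bar>h2 z\<bar> \<le> 1" "\<And>z. z \<in> \<Omega> \<Longrightarrow> \<bar>h3 z\<bar> \<le> 1"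
      "\<And>z. z \<in> \<Omega> \<Longrightarrow> \<bar>h2' z\<bar> \<le> 1" "\<And>z. z \<in> \<Omega> \<Longrightarrow> \<bar>h3' z\<bar> \<le> 1"
    for h1 h2 h3 h2' h3' s t
  proof -
    note [measurable] = m
    let ?u = "\<lambda>z. h1 z * h2 (fl s z) * h3 (fl t z)" and ?v = "\<lambda>z. h1 z * h2' (fl s z) * h3' (fl t z)"
    let ?d = "\<lambda>z. \<bar>h2 (fl s z) - h2' (fl s z)\<bar> + \<bar>h3 (fl t z) - h3' (fl t z)\<bar>"
    have i: "integrable N (\<lambda>z. ?u z)" "integrable N (\<lambda>z. ?v z)"
      by (rule N.integrable_bounded[where C=1], (measurable)[1], auto intro!: abs_mult_le_1 b)+
    have d: "integrable N (\<lambda>z. \<bar>k (fl r z) - k' (fl r z)\<bar>)"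
      if [measurable]: "k \<in> borel_measurable N" "k' \<in> borel_measurable N"
      and "\<And>z. z \<in> \<Omega> \<Longrightarrow> \<bar>k z\<bar> \<le> 1" "\<And>z. z \<in> \<Omega> \<Longrightarrow> \<bar>k' z\<bar> \<le> 1" for k k' :: "'a \<times> real \<Rightarrow> real" and r
    proof (rule N.integrable_bounded[where C=2])
      fix z assume "z \<in> space N"
      then show "\<bar>\<bar>k (fl r z) - k' (fl r z)\<bar>\<bar> \<le> 2" using that(3)[of "fl r z"] that(4)[of "fl r z"] by simp
    qed measurable
    have "\<bar>F h1 h2 h3 s t - F h1 h2' h3' s t\<bar> \<le> (LINT z|N. ?d z)"
      unfolding F_def
    proof (rule abs_integral_diff_le[OF i])
      fix z assume "z \<in> space N"
      then show "\<bar>?u z - ?v z\<bar> \<le> ?d z"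
        using b by (intro abs_mult3_diff) auto
    next
      show "integrable N (\<lambda>z. ?d z)"
        by (intro Bochner_Integration.integrable_add d m b)
    qed
    also have "\<dots> = (LINT z|N. \<bar>h2 (fl s z) - h2' (fl s z)\<bar>) + (LINT z|N. \<bar>h3 (fl t z) - h3' (fl t z)\<bar>)"
      by (intro Bochner_Integration.integral_add d m b)
    also have "\<dots> = (LINT z|N. \<bar>h2 z - h2' z\<bar>) + (LINT z|N. \<bar>h3 z - h3' z\<bar>)"
      using integral_fl[of "\<lambda>z. \<bar>h2 z - h2' z\<bar>" s] integral_fl[of "\<lambda>z. \<bar>h3 z - h3' z\<bar>" t] by simp
    finally show ?thesis .
  qed
  let ?wA = "\<lambda>n z. wt n (fst z) * indicator A z"
  let ?X = "\<lambda>n. F (?wA n) (indicator B) (indicator C) (a n) (2 * a n)" and ?R = "LINT p|P. F (indicator A) (indicator B) (indicator C) (- snd p) (- fst p)"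
  have wA [measurable]: "?wA n \<in> borel_measurable N" for n by measurable
  have wA_bd: "\<bar>?wA n z\<bar> \<le> 1" for n z by (auto simp: indicator_def)
  have ib: "\<bar>indicat_real D z\<bar> \<le> 1" for D :: "('a \<times> real) set" and z by (auto simp: indicator_def)
  have "(\<lambda>n. ?X n - \<alpha> * ?R) \<longlonglongrightarrow> 0"
  proof (rule tendsto_zeroI_approx)
    fix e :: real assume e: "0 < e"
    \<comment> \<open>The two replacements cost \<open>2 * e'\<close> before the limit and
      \<open>\<alpha> * (2 * e')\<close> in it.\<close>
    define e' where "e' = e / (2 * (1 + \<alpha>))"
    have e': "0 < e'" using e alpha_pos by (simp add: e'_def)
    obtain h2 where h2: "flow_lipschitz h2" "(LINT z|N. \<bar>h2 z - indicator B z\<bar>) < e'"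
      using flow_lipschitz_dense[of B, OF _ e'] by auto
    obtain h3 where h3: "flow_lipschitz h3" "(LINT z|N. \<bar>h3 z - indicator C z\<bar>) < e'"
      using flow_lipschitz_dense[of C, OF _ e'] by auto
    have [measurable]: "h2 \<in> borel_measurable N" "h3 \<in> borel_measurable N"
      and bd2: "\<And>z. z \<in> \<Omega> \<Longrightarrow> \<bar>h2 z\<bar> \<le> 1" and bd3: "\<And>z. z \<in> \<Omega> \<Longrightarrow> \<bar>h3 z\<bar> \<le> 1"
      using h2 h3 unfolding flow_lipschitz_def by auto
    have close: "\<bar>F k h2 h3 s t - F k (indicator B) (indicator C) s t\<bar> \<le> 2 * e'"
      if k: "k \<in> borel_measurable N" "\<And>z. z \<in> \<Omega> \<Longrightarrow> \<bar>k z\<bar> \<le> 1" for k s t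
    proof -
      have "\<bar>F k h2 h3 s t - F k (indicator B) (indicator C) s t\<bar>
        \<le> (LINT z|N. \<bar>h2 z - indicator B z\<bar>) + (LINT z|N. \<bar>h3 z - indicator C z\<bar>)"
        by (intro F_diff k bd2 bd3 ib) measurable
      then show ?thesis using h2(2) h3(2) by linarith
    qed
    have iP: "integrable P (\<lambda>p. F (indicator A) k k' (- snd p) (- fst p))"
      if [measurable]: "k \<in> borel_measurable N" "k' \<in> borel_measurable N"
      and b: "\<And>z. z \<in> \<Omega> \<Longrightarrow> \<bar>k z\<bar> \<le> 1" "\<And>z. z \<in> \<Omega> \<Longrightarrow> \<bar>k' z\<bar> \<le> 1" for k k'
    proof (rule P.integrable_bounded[where C="measure N (space N)"])
      show "(\<lambda>p. F (indicator A) k k' (- snd p) (- fst p)) \<in> borel_measurable P"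
        unfolding F_def by measurable
      fix p :: "real \<times> real"
      have i: "integrable N (\<lambda>z. indicator A z * k (fl (- snd p) z) * k' (fl (- fst p) z))"
        by (rule N.integrable_bounded[where C=1]) (auto intro!: abs_mult_le_1 b ib)
      have "\<bar>F (indicator A) k k' (- snd p) (- fst p)\<bar> \<le> (LINT z|N. \<bar>indicator A z * k (fl (- snd p) z) * k' (fl (- fst p) z)\<bar>)"
        unfolding F_def by (rule integral_abs_bound)
      also have "\<dots> \<le> (LINT z|N. 1)"
        by (rule integral_mono) (use i in \<open>auto intro!: abs_mult_le_1 b ib\<close>)
      finally show "\<bar>F (indicator A) k k' (- snd p) (- fst p)\<bar> \<le> measure N (space N)" by simp
    qed
    have iP1: "integrable P (\<lambda>p. F (indicator A) h2 h3 (- snd p) (- fst p))"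
      by (intro iP bd2 bd3) measurable
    have iP2: "integrable P (\<lambda>p. F (indicator A) (indicator B) (indicator C) (- snd p) (- fst p))"
      by (intro iP ib) measurable
    let ?L = "LINT p|P. F (indicator A) h2 h3 (- snd p) (- fst p)"
    have LR: "\<bar>?L - ?R\<bar> \<le> 2 * e'"
    proof -
      have "\<bar>?L - ?R\<bar> \<le> (LINT p|P. 2 * e')"
        by (rule abs_integral_diff_le[OF iP1 iP2]) (simp_all add: close ib)
      then show ?thesis by (simp add: P.prob_space)
    qed
    have lim: "(\<lambda>n. \<bar>F (?wA n) h2 h3 (a n) (2 * a n) - \<alpha> * ?L\<bar>) \<longlonglongrightarrow> 0"
    proof (rule tendsto_rabs_zero, rule LIM_zero)
      show "(\<lambda>n. F (?wA n) h2 h3 (a n) (2 * a n)) \<longlonglongrightarrow> \<alpha> * ?L"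
        using lipschitz_flow_tendsto[of "indicator A" h2 h3] h2(1) h3(1) ib unfolding F_def by simp
    qed
    have "\<bar>?X n - \<alpha> * ?R\<bar> \<le> \<bar>F (?wA n) h2 h3 (a n) (2 * a n) - \<alpha> * ?L\<bar> + e" for n
    proof -
      have 1: "\<bar>F (?wA n) h2 h3 (a n) (2 * a n) - ?X n\<bar> \<le> 2 * e'"
        by (rule close[OF wA wA_bd])
      have 2: "\<bar>\<alpha> * ?L - \<alpha> * ?R\<bar> \<le> \<alpha> * (2 * e')"
        using LR alpha_pos by (simp add: right_diff_distrib[symmetric] abs_mult)
      have "2 * e' + \<alpha> * (2 * e') = (2 * (1 + \<alpha>)) * e'" by (simp add: algebra_simps)
      also have "\<dots> = e" using alpha_pos by (simp add: e'_def)
      finally show ?thesis using 1 2 by linarith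
    qed
    then show "\<exists>b. b \<longlonglongrightarrow> 0 \<and> (\<forall>n. \<bar>?X n - \<alpha> * ?R\<bar> \<le> b n + e)"
      using lim by blast
  qed
  from LIM_zero_cancel[OF this] show ?thesis unfolding F_def .
qed

end

section \<open>The reversal inequality\<close>

type_synonym 'a triple = "('a \<times> real) \<times> ('a \<times> real) \<times> ('a \<times> real)"

context rigid_suspension
begin

abbreviation Tri :: "'a triple measure" where
  "Tri \<equiv> N \<Otimes>\<^sub>M N \<Otimes>\<^sub>M N"

text \<open>Here \<open>p = (u, v)\<close> follows the order of (f_n', f_n): \<open>snd p\<close>
  goes with the middle point, reached at time \<open>a n\<close>, and \<open>fst p\<close> with the
  point at time \<open>2 * a n\<close>. \<open>past p\<close> and \<open>future p\<close> give the
  triples of the two limit laws.\<close>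

abbreviation "orbit n z \<equiv> (z, fl (a n) z, fl (2 * a n) z)"
abbreviation "past p z \<equiv> (z, fl (- snd p) z, fl (- fst p) z)"
abbreviation "future p z \<equiv> (fl (fst p) z, fl (snd p) z, z)"

lemma integrable_N_triple:
  fixes h :: "'a triple \<Rightarrow> real"
  assumes [measurable]: "h \<in> borel_measurable Tri" "g1 \<in> measurable N N" "g2 \<in> measurable N N" "g3 \<in> measurable N N"
    and bd: "\<And>z. \<bar>h z\<bar> \<le> C"
  shows "integrable N (\<lambda>z. h (g1 z, g2 z, g3 z))" "integrable N (\<lambda>z. wt n (fst z) * h (g1 z, g2 z, g3 z))"
proof -
  show i: "integrable N (\<lambda>z. h (g1 z, g2 z, g3 z))"
    by (rule N.integrable_bounded[where C=C]) (use bd in auto)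
  show "integrable N (\<lambda>z. wt n (fst z) * h (g1 z, g2 z, g3 z))"
    by (rule Bochner_Integration.integrable_bound[OF i]) (auto simp: abs_mult mult_left_le_one_le)
qed

lemma integrable_P_triple:
  fixes h :: "'a triple \<Rightarrow> real"
  assumes [measurable]: "h \<in> borel_measurable Tri" "g1 \<in> measurable (P \<Otimes>\<^sub>M N) N"
      "g2 \<in> measurable (P \<Otimes>\<^sub>M N) N" "g3 \<in> measurable (P \<Otimes>\<^sub>M N) N"
    and bd: "\<And>z. \<bar>h z\<bar> \<le> C"
  shows "integrable P (\<lambda>p. LINT z|N. h (g1 (p, z), g2 (p, z), g3 (p, z)))"
proof (rule P.integrable_bounded[where C="C * measure N (space N)"])
  show "(\<lambda>p. LINT z|N. h (g1 (p, z), g2 (p, z), g3 (p, z))) \<in> borel_measurable P" by measurable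
  fix p assume p: "p \<in> space P"
  have m: "(\<lambda>z. g (p, z)) \<in> measurable N N" if "g \<in> measurable (P \<Otimes>\<^sub>M N) N" for g
    using measurable_compose[OF measurable_Pair1'[OF p] that] by simp
  have i: "integrable N (\<lambda>z. h (g1 (p, z), g2 (p, z), g3 (p, z)))"
    by (rule integrable_N_triple(1)[OF assms(1) m[OF assms(2)] m[OF assms(3)] m[OF assms(4)] bd])
  have "\<bar>LINT z|N. h (g1 (p, z), g2 (p, z), g3 (p, z))\<bar> \<le> (LINT z|N. \<bar>h (g1 (p, z), g2 (p, z), g3 (p, z))\<bar>)"
    by (rule integral_abs_bound)
  also have "\<dots> \<le> (LINT z|N. C)"
    by (rule integral_mono) (use i bd in auto)
  finally show "\<bar>LINT z|N. h (g1 (p, z), g2 (p, z), g3 (p, z))\<bar> \<le> C * measure N (space N)"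
    by (simp add: mult.commute)
qed

lemma integrable_P_flow:
  fixes h :: "'a triple \<Rightarrow> real"
  assumes h: "h \<in> borel_measurable Tri" and bd: "\<And>z. \<bar>h z\<bar> \<le> C"
  shows "integrable P (\<lambda>p. LINT z|N. h (past p z))"
    and "integrable P (\<lambda>p. LINT z|N. h (future p z))"
proof -
  have "(\<lambda>w. fl (- snd (fst w)) (snd w)) \<in> measurable (P \<Otimes>\<^sub>M N) N"
    "(\<lambda>w. fl (- fst (fst w)) (snd w)) \<in> measurable (P \<Otimes>\<^sub>M N) N"
    "(\<lambda>w. fl (snd (fst w)) (snd w)) \<in> measurable (P \<Otimes>\<^sub>M N) N"
    "(\<lambda>w. fl (fst (fst w)) (snd w)) \<in> measurable (P \<Otimes>\<^sub>M N) N"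
    by measurable
  note m = this
  show "integrable P (\<lambda>p. LINT z|N. h (past p z))"
    using integrable_P_triple[OF h measurable_snd m(1) m(2) bd] by simp
  show "integrable P (\<lambda>p. LINT z|N. h (future p z))"
    using integrable_P_triple[OF h m(4) m(3) measurable_snd bd] by simp
qed

lemma box_span_tendsto:
  assumes "box_span N h"
  shows "(\<lambda>n. LINT z|N. wt n (fst z) * h (orbit n z))
    \<longlonglongrightarrow> \<alpha> * (LINT p|P. LINT z|N. h (past p z))"
  using assms
proof induction
  case (box A B C)
  have eq: "indicat_real D z = indicator (D \<inter> space N) z" if "z \<in> space N" for D z
    using that by (simp add: indicator_def)
  have "(LINT z|N. wt n (fst z) * (indicator A z * indicator B (fl (a n) z) * indicator C (fl (2 * a n) z)))
    = (LINT z|N. wt n (fst z) * indicator (A \<inter> space N) z * indicator (B \<inter> space N) (fl (a n) z) * indicator (C \<inter> space N) (fl (2 * a n) z))" for n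
  proof (rule Bochner_Integration.integral_cong[OF refl])
    fix z assume z: "z \<in> space N"
    then have "fl (a n) z \<in> space N" "fl (2 * a n) z \<in> space N" by auto
    note e = eq[OF z, of A] eq[OF this(1), of B] eq[OF this(2), of C]
    show "wt n (fst z) * (indicator A z * indicator B (fl (a n) z) * indicator C (fl (2 * a n) z))
      = wt n (fst z) * indicator (A \<inter> space N) z * indicator (B \<inter> space N) (fl (a n) z) * indicator (C \<inter> space N) (fl (2 * a n) z)"
      unfolding e by (simp only: mult.assoc)
  qed
  moreover have "(LINT z|N. indicator A z * indicator B (fl s z) * indicator C (fl t z))
    = (LINT z|N. indicat_real (A \<inter> space N) z * indicator (B \<inter> space N) (fl s z) * indicator (C \<inter> space N) (fl t z))" for s t
  proof (rule Bochner_Integration.integral_cong[OF refl])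
    fix z assume z: "z \<in> space N"
    then have "fl s z \<in> space N" "fl t z \<in> space N" by auto
    note e = eq[OF z, of A] eq[OF this(1), of B] eq[OF this(2), of C]
    show "indicat_real A z * indicator B (fl s z) * indicator C (fl t z)
      = indicator (A \<inter> space N) z * indicator (B \<inter> space N) (fl s z) * indicator (C \<inter> space N) (fl t z)"
      unfolding e ..
  qed
  ultimately show ?case using sets_flow_tendsto[OF box] by (simp only: fst_conv snd_conv)
next
  case (add g h)
  obtain C where C: "\<And>z. \<bar>g z\<bar> \<le> C" using box_span_bounded[OF add.hyps(1)] by blast
  obtain D where D: "\<And>z. \<bar>h z\<bar> \<le> D" using box_span_bounded[OF add.hyps(2)] by blast
  note m = box_span_measurable[OF add.hyps(1)] box_span_measurable[OF add.hyps(2)]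
  have id: "(\<lambda>z. z) \<in> measurable N N" by simp
  note ig = integrable_N_triple[OF m(1) id fl_meas fl_meas C] and ih = integrable_N_triple[OF m(2) id fl_meas fl_meas D]
  have "(LINT z|N. wt n (fst z) * (g (orbit n z) + h (orbit n z)))
    = (LINT z|N. wt n (fst z) * g (orbit n z)) + (LINT z|N. wt n (fst z) * h (orbit n z))" for n
    unfolding distrib_left by (rule Bochner_Integration.integral_add[OF ig(2) ih(2)])
  moreover have "(LINT p|P. LINT z|N. g (past p z) + h (past p z))
    = (LINT p|P. LINT z|N. g (past p z)) + (LINT p|P. LINT z|N. h (past p z))"
    unfolding Bochner_Integration.integral_add[OF ig(1) ih(1)]
    by (rule Bochner_Integration.integral_add[OF integrable_P_flow(1)[OF m(1) C] integrable_P_flow(1)[OF m(2) D]])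
  ultimately show ?case using tendsto_add[OF add.IH] by (simp only: distrib_left)
next
  case (scale g r)
  have "(LINT z|N. wt n (fst z) * (r * g (orbit n z))) = r * (LINT z|N. wt n (fst z) * g (orbit n z))" for n
    by (simp add: mult.left_commute)
  then show ?case using tendsto_mult_left[OF scale.IH, of r] by (simp add: mult.left_commute)
qed

end

locale reversible_suspension = rigid_suspension +
  fixes S :: "'a \<times> real \<Rightarrow> 'a \<times> real"
  assumes S_meas [measurable]: "S \<in> measurable (sf_measure M f) (sf_measure M f)"
    and S_distr: "distr (sf_measure M f) (sf_measure M f) S = sf_measure M f"
    and S_flow: "AE z in sf_measure M f. special_flow M T f t (S z) = S (special_flow M T f (- t) z)"
begin

lemma integral_S:
  fixes g :: "'a \<times> real \<Rightarrow> real"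
  assumes [measurable]: "g \<in> borel_measurable N"
  shows "(LINT z|N. g (S z)) = (LINT z|N. g z)"
proof -
  have "(LINT z|distr N N S. g z) = (LINT z|N. g (S z))"
    by (intro integral_distr) auto
  then show ?thesis by (simp add: S_distr)
qed

text \<open>\<open>S\<close> reverses the flow and preserves \<open>N\<close>. The conjugation
  relation enters the argument only here.\<close>

lemma integral_S_flow:
  fixes h :: "'a triple \<Rightarrow> real"
  assumes [measurable]: "h \<in> borel_measurable Tri"
  shows "(LINT z|N. h (S (fl s z), S (fl t z), S z)) = (LINT z|N. h (fl (- s) z, fl (- t) z, z))"
proof -
  have "(LINT z|N. h (S (fl s z), S (fl t z), S z)) = (LINT z|N. h (fl (- s) (S z), fl (- t) (S z), S z))"
  proof (rule integral_cong_AE)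
    \<comment> \<open>The exceptional null set of the conjugation depends on the time; two fixed
      times are involved, so this is harmless.\<close>
    show "AE z in N. h (S (fl s z), S (fl t z), S z) = h (fl (- s) (S z), fl (- t) (S z), S z)"
      using S_flow[of "- s"] S_flow[of "- t"] by eventually_elim simp
  qed measurable
  also have "\<dots> = (LINT z|N. h (fl (- s) z, fl (- t) z, z))"
    by (rule integral_S[of "\<lambda>z. h (fl (- s) z, fl (- t) z, z)"]) measurable
  finally show ?thesis .
qed

text \<open>The law of an orbit triple is invariant under reversal followed by \<open>S\<close>, so
  \<open>g\<close> and \<open>h\<close> have the same integral. The integrals of \<open>g\<close>
  and \<open>1 - h\<close> thus add up to the total mass, and the weight only lowers them. In the
  limit the same conjugation rewrites \<open>g\<close> on \<open>past\<close> as \<open>h\<close> on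
  \<open>future\<close>.\<close>

lemma reversal_inequality_span:
  assumes h: "box_span N h" and h01: "\<And>z. h z \<in> {0, 1}"
  shows "\<alpha> * (LINT p|P. LINT z|N. h (future p z))
    + \<alpha> * (LINT p|P. LINT z|N. 1 - h (past p z)) \<le> measure N (space N)"
proof -
  define g where "g = (\<lambda>z. h (S (snd (snd z)), S (fst (snd z)), S (fst z)))"
  have g: "box_span N g" unfolding g_def by (rule box_span_flip[OF h S_meas])
  have k: "box_span N (\<lambda>z. 1 - h z)"
    using box_span.add[OF box_span_1 box_span.scale[OF h, of "- 1"]] by simp
  have g01: "g z \<in> {0, 1}" for z using h01 by (simp add: g_def)
  note [measurable] = box_span_measurable[OF h] box_span_measurable[OF g] box_span_measurable[OF k]
  have bd: "\<bar>h z\<bar> \<le> 1" "\<bar>g z\<bar> \<le> 1" "\<bar>1 - h z\<bar> \<le> 1" for z using h01[of z] g01[of z] by auto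
  have id: "(\<lambda>z. z) \<in> measurable N N" by simp
  note ih = integrable_N_triple[OF box_span_measurable[OF h] id fl_meas fl_meas bd(1)]
  note ig = integrable_N_triple[OF box_span_measurable[OF g] id fl_meas fl_meas bd(2)]
  note ik = integrable_N_triple[OF box_span_measurable[OF k] id fl_meas fl_meas bd(3)]
  \<comment> \<open>After the conjugation the triple is read from its last point
    \<open>fl (- (2 * t)) z\<close>, which is distributed like \<open>z\<close>. The equal spacing
    of the three times makes the result an orbit triple again.\<close>
  have flip: "(LINT z|N. g (z, fl t z, fl (2 * t) z)) = (LINT z|N. h (z, fl t z, fl (2 * t) z))" for t
  proof -
    have "(LINT z|N. g (z, fl t z, fl (2 * t) z)) = (LINT z|N. h (fl (- (2 * t)) z, fl (- t) z, z))"
      using integral_S_flow[of h "2 * t" t] by (simp add: g_def)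
    also have "\<dots> = (LINT z|N. h (fl (- (2 * t)) z, fl t (fl (- (2 * t)) z), fl (2 * t) (fl (- (2 * t)) z)))"
      by (rule Bochner_Integration.integral_cong) (auto simp: fl_fl fl_0)
    also have "\<dots> = (LINT z|N. h (z, fl t z, fl (2 * t) z))"
      by (rule integral_fl[of "\<lambda>z. h (z, fl t z, fl (2 * t) z)"]) measurable
    finally show ?thesis .
  qed
  have "\<alpha> * (LINT p|P. LINT z|N. g (past p z))
    + \<alpha> * (LINT p|P. LINT z|N. 1 - h (past p z)) \<le> measure N (space N)"
  proof (rule LIMSEQ_le_const2[OF tendsto_add[OF box_span_tendsto[OF g] box_span_tendsto[OF k]]], intro exI allI impI)
    fix n :: nat
    have le: "wt n (fst z) * r \<le> r" if "0 \<le> r" for z :: "'a \<times> real" and r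
      using that by (simp add: mult_left_le_one_le)
    have "(LINT z|N. wt n (fst z) * g (orbit n z)) \<le> (LINT z|N. g (orbit n z))"
    proof (rule integral_mono[OF ig(2) ig(1)])
      fix z show "wt n (fst z) * g (orbit n z) \<le> g (orbit n z)"
        using g01[of "(orbit n z)"] by (intro le) auto
    qed
    moreover have "(LINT z|N. wt n (fst z) * (1 - h (orbit n z))) \<le> (LINT z|N. 1 - h (orbit n z))"
    proof (rule integral_mono[OF ik(2) ik(1)])
      fix z show "wt n (fst z) * (1 - h (orbit n z)) \<le> 1 - h (orbit n z)"
        using h01[of "(orbit n z)"] by (intro le) auto
    qed
    moreover have "(LINT z|N. 1 - h (orbit n z)) = measure N (space N) - (LINT z|N. h (orbit n z))"
      using ih(1) by simp
    ultimately show "(LINT z|N. wt n (fst z) * g (orbit n z))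
      + (LINT z|N. wt n (fst z) * (1 - h (orbit n z))) \<le> measure N (space N)"
      using flip[of "a n"] by linarith
  qed
  moreover have "(LINT z|N. g (past p z)) = (LINT z|N. h (future p z))" for p
    using integral_S_flow[of h "- fst p" "- snd p"] by (simp add: g_def)
  ultimately show ?thesis by simp
qed

text \<open>Both sides are continuous in L1 of the two limit laws, here \<open>K1\<close> for
  \<open>future\<close> and \<open>K2\<close> for \<open>past\<close>, and one 0-1 valued member of
  the span approximates \<open>E\<close> in both.\<close>

lemma reversal_inequality:
  assumes E [measurable]: "E \<in> sets Tri"
  shows "\<alpha> * (LINT p|P. LINT z|N. indicator E (future p z))
    + \<alpha> * (measure N (space N) - (LINT p|P. LINT z|N. indicator E (past p z))) \<le> measure N (space N)"
proof (rule field_le_epsilon)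
  let ?G = "{A \<times> B \<times> C | A B C. A \<in> sets N \<and> B \<in> sets N \<and> C \<in> sets N}"
  fix e :: real assume e: "0 < e"
  \<comment> \<open>Each of the two terms on the left moves by at most
    \<open>\<alpha> * e'\<close>.\<close>
  define e' where "e' = e / (2 * \<alpha>)"
  have e': "0 < e'" using e alpha_pos by (simp add: e'_def)
  interpret PN: pair_sigma_finite P N ..
  interpret PNf: finite_measure "P \<Otimes>\<^sub>M N" by (rule finite_measure_pair_measure) unfold_locales
  define \<phi> where "\<phi> = (\<lambda>w. (snd w, fl (- snd (fst w)) (snd w), fl (- fst (fst w)) (snd w)))"
  define \<phi>' where "\<phi>' = (\<lambda>w. (fl (fst (fst w)) (snd w), fl (snd (fst w)) (snd w), snd w))"
  have m [measurable]: "\<phi> \<in> measurable (P \<Otimes>\<^sub>M N) Tri" "\<phi>' \<in> measurable (P \<Otimes>\<^sub>M N) Tri"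
    unfolding \<phi>_def \<phi>'_def by measurable
  define K1 where "K1 = distr (P \<Otimes>\<^sub>M N) Tri \<phi>'"
  define K2 where "K2 = distr (P \<Otimes>\<^sub>M N) Tri \<phi>"
  have fin: "finite_measure K1" "finite_measure K2"
    unfolding K1_def K2_def by (intro PNf.finite_measure_distr m)+
  interpret K1: finite_measure K1 by (rule fin)
  interpret K2: finite_measure K2 by (rule fin)
  have sK: "sets K1 = sets Tri" "sets K2 = sets Tri" by (auto simp: K1_def K2_def)
  have spK: "space K1 = space Tri" by (simp add: K1_def)
  have int_K: "(LINT w|K1. k w) = (LINT p|P. LINT z|N. k (future p z))"
    "(LINT w|K2. k w) = (LINT p|P. LINT z|N. k (past p z))"
    if [measurable]: "k \<in> borel_measurable Tri" and bd: "\<And>z. \<bar>k z\<bar> \<le> 1" for k :: "_ \<Rightarrow> real"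
  proof -
    have i: "integrable (P \<Otimes>\<^sub>M N) (\<lambda>w. k (\<phi>' w))" "integrable (P \<Otimes>\<^sub>M N) (\<lambda>w. k (\<phi> w))"
      by (rule PNf.integrable_bounded[where C=1], (measurable)[1], rule bd)+
    have "(LINT w|K1. k w) = (LINT w|(P \<Otimes>\<^sub>M N). k (\<phi>' w))"
      unfolding K1_def by (rule integral_distr) measurable
    also have "\<dots> = (LINT p|P. LINT z|N. k (\<phi>' (p, z)))"
      by (rule PN.integral_fst'[OF i(1), symmetric])
    finally show "(LINT w|K1. k w) = (LINT p|P. LINT z|N. k (future p z))"
      by (simp add: \<phi>'_def)
    have "(LINT w|K2. k w) = (LINT w|(P \<Otimes>\<^sub>M N). k (\<phi> w))"
      unfolding K2_def by (rule integral_distr) measurable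
    also have "\<dots> = (LINT p|P. LINT z|N. k (\<phi> (p, z)))"
      by (rule PN.integral_fst'[OF i(2), symmetric])
    finally show "(LINT w|K2. k w) = (LINT p|P. LINT z|N. k (past p z))"
      by (simp add: \<phi>_def)
  qed
  define \<A> where "\<A> h \<longleftrightarrow> box_span N h \<and> (\<forall>z. h z \<in> {0, 1 :: real})" for h
  have "\<exists>h. \<A> h \<and> (LINT z|K1. \<bar>h z - indicator E z\<bar>) < e' \<and> (LINT z|K2. \<bar>h z - indicator E z\<bar>) < e'"
  proof (rule approx_by_lattice[OF fin, of "?G"])
    show "sets K2 = sets K1" using sK by simp
    show "sets K1 \<subseteq> sigma_sets (space K1) ?G"
      unfolding sK spK by (rule sets_triple_generated)
    show "?G \<subseteq> sets K1"
      unfolding sK by (rule sets_triple_generated)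
    show "E \<in> sets K1" unfolding sK by (rule E)
    show "0 < e'" by (rule e')
    show "h \<in> borel_measurable K1" if "\<A> h" for h
      using that box_span_measurable by (auto simp: \<A>_def measurable_cong_sets[OF sK(1) refl])
    show "0 \<le> h z \<and> h z \<le> 1" if "\<A> h" for h z
    proof -
      have "h z \<in> {0, 1}" using that unfolding \<A>_def by blast
      then show ?thesis by auto
    qed
    show "\<A> (\<lambda>_. 0)" using box_span.scale[OF box_span_1, of N 0] by (simp add: \<A>_def)
    show "\<A> (\<lambda>z. 1 - h z)" if "\<A> h" for h
    proof -
      have "1 - h z \<in> {0, 1}" for z using that[unfolded \<A>_def, THEN conjunct2, rule_format, of z] by auto
      moreover have "box_span N (\<lambda>z. 1 - h z)"
        using box_span.add[OF box_span_1 box_span.scale[of N h "- 1"]] that by (simp add: \<A>_def)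
      ultimately show ?thesis by (simp add: \<A>_def)
    qed
    show "\<A> (\<lambda>z. max (h z) (h' z))" if h: "\<A> h" and h': "\<A> h'" for h h'
    proof -
      have v: "h z \<in> {0, 1}" "h' z \<in> {0, 1}" for z using h h' unfolding \<A>_def by blast+
      have eq: "max (h z) (h' z) = h z + h' z + - 1 * (h z * h' z)" "max (h z) (h' z) \<in> {0, 1}" for z
        using v[of z] by auto
      have "box_span N (\<lambda>z. h z + h' z + - 1 * (h z * h' z))"
        using h h' by (intro box_span.add box_span.scale box_span_mult) (auto simp: \<A>_def)
      then show ?thesis using eq(2) unfolding \<A>_def eq(1) by simp
    qed
    fix A and e :: real
    assume "A \<in> ?G" and e: "0 < e"
    then obtain A1 A2 A3 where A: "A = A1 \<times> A2 \<times> A3" "A1 \<in> sets N" "A2 \<in> sets N" "A3 \<in> sets N" by auto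
    have "box_span N (\<lambda>z. indicator A1 (fst z) * indicator A2 (fst (snd z)) * indicator A3 (snd (snd z)))"
      by (intro box_span.box sets.Int sets.top A)
    moreover have "(\<lambda>z. indicator A1 (fst z) * indicator A2 (fst (snd z)) * indicator A3 (snd (snd z))) = indicat_real A"
      by (auto simp: A(1) indicator_def fun_eq_iff)
    ultimately have "\<A> (indicator A)" by (auto simp: \<A>_def indicator_def)
    then show "\<exists>h. \<A> h \<and> (LINT z|K1. \<bar>h z - indicator A z\<bar>) < e \<and> (LINT z|K2. \<bar>h z - indicator A z\<bar>) < e"
      using e by (intro exI[of _ "indicator A"]) simp
  qed
  then obtain h where h: "box_span N h" "\<And>z. h z \<in> {0, 1}"
    and c1: "(LINT z|K1. \<bar>h z - indicator E z\<bar>) < e'" and c2: "(LINT z|K2. \<bar>h z - indicator E z\<bar>) < e'"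
    unfolding \<A>_def by blast
  have hbd: "\<bar>h z\<bar> \<le> 1" for z using h(2)[of z] by auto
  have ibd: "\<bar>indicat_real E z\<bar> \<le> 1" for z by (auto simp: indicator_def)
  note [measurable] = box_span_measurable[OF h(1)]
  have iK: "integrable K1 h" "integrable K2 h" "integrable K1 (indicat_real E)" "integrable K2 (indicat_real E)"
    using hbd ibd
    by (auto intro!: K1.integrable_bounded[where C=1] K2.integrable_bounded[where C=1]
        simp: measurable_cong_sets[OF sK(1) refl] measurable_cong_sets[OF sK(2) refl])
  have d: "\<bar>(LINT z|K. h z) - (LINT z|K. indicator E z)\<bar> \<le> (LINT z|K. \<bar>h z - indicator E z\<bar>)"
    if "integrable K h" "integrable K (indicat_real E)" for K
    using integral_abs_bound[of K "\<lambda>z. h z - indicator E z"] that by simp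
  have id: "(\<lambda>z. z) \<in> measurable N N" by simp
  have "(LINT p|P. LINT z|N. 1 - h (past p z)) = measure N (space N) - (LINT w|K2. h w)"
    unfolding int_K(2)[OF box_span_measurable[OF h(1)] hbd]
    using integrable_N_triple(1)[OF box_span_measurable[OF h(1)] id fl_meas fl_meas hbd]
      integrable_P_flow(1)[OF box_span_measurable[OF h(1)] hbd]
    by (simp add: P.prob_space)
  then have main: "\<alpha> * (LINT w|K1. h w) + \<alpha> * (measure N (space N) - (LINT w|K2. h w)) \<le> measure N (space N)"
    using reversal_inequality_span[OF h] int_K(1)[OF box_span_measurable[OF h(1)] hbd] by simp
  have "(LINT w|K1. indicator E w) - e' \<le> (LINT w|K1. h w)"
    using d[OF iK(1) iK(3)] c1 by linarith
  then have 1: "\<alpha> * (LINT w|K1. indicator E w) - \<alpha> * e' \<le> \<alpha> * (LINT w|K1. h w)"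
    unfolding right_diff_distrib[symmetric] using alpha_pos by (intro mult_left_mono) auto
  have "(LINT w|K2. h w) \<le> (LINT w|K2. indicator E w) + e'"
    using d[OF iK(2) iK(4)] c2 by linarith
  then have 2: "\<alpha> * (measure N (space N) - (LINT w|K2. indicator E w)) - \<alpha> * e' \<le> \<alpha> * (measure N (space N) - (LINT w|K2. h w))"
    unfolding right_diff_distrib[symmetric] using alpha_pos by (intro mult_left_mono) auto
  have "2 * (\<alpha> * e') = e" using alpha_pos by (simp add: e'_def)
  then have "\<alpha> * (LINT w|K1. indicator E w) + \<alpha> * (measure N (space N) - (LINT w|K2. indicator E w)) \<le> measure N (space N) + e"
    using main 1 2 by linarith
  then show "\<alpha> * (LINT p|P. LINT z|N. indicator E (future p z))
    + \<alpha> * (measure N (space N) - (LINT p|P. LINT z|N. indicator E (past p z))) \<le> measure N (space N) + e"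
    using int_K[of "indicator E", OF _ ibd] by simp
qed

end

section \<open>Aperiodicity\<close>

text \<open>Halving: if \<open>B'\<close> is a subset of \<open>B\<close> of strictly intermediate
  measure, then \<open>B'\<close> and \<open>B - B'\<close> both have positive measure and one of
  them has at most half the measure of \<open>B\<close>.\<close>

lemma (in prob_space) non_atomic_small_set:
  assumes "non_atomic M"
  shows "\<exists>B\<in>sets M. 0 < prob B \<and> prob B \<le> (1 / 2) ^ k"
proof (induction k)
  case 0
  then show ?case by (intro bexI[of _ "space M"]) (auto simp: prob_space)
next
  case (Suc k)
  then obtain B where B: "B \<in> sets M" "0 < prob B" "prob B \<le> (1 / 2) ^ k" by blast
  then obtain B' where B': "B' \<in> sets M" "B' \<subseteq> B" "0 < prob B'" "prob B' < prob B"
    using assms unfolding non_atomic_def emeasure_eq_measure by (auto simp: ennreal_less_iff)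
  have diff: "prob (B - B') = prob B - prob B'" using B B' by (intro finite_measure_Diff) auto
  show ?case
  proof (cases "prob B' \<le> prob B / 2")
    case True
    then show ?thesis using B B' by (intro bexI[of _ B']) auto
  next
    case False
    then show ?thesis using B B' diff by (intro bexI[of _ "B - B'"]) auto
  qed
qed

text \<open>An injective measurable real function makes equality of points a measurable condition;
  the same device serves in \<open>reversal_mass_bound\<close>.\<close>

locale separated_ergodic_system = ergodic_system M T for M :: "'a measure" and T +
  fixes \<phi> :: "'a \<Rightarrow> real"
  assumes phi_meas [measurable]: "\<phi> \<in> borel_measurable M"
    and phi_inj: "inj_on \<phi> (space M)"
    and non_atomic: "non_atomic M"
begin

lemma phi_eq_iff: "x \<in> space M \<Longrightarrow> y \<in> space M \<Longrightarrow> \<phi> x = \<phi> y \<longleftrightarrow> x = y"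
  using phi_inj by (auto simp: inj_on_def)

text \<open>Suppose almost every point had period \<open>n\<close>, and take \<open>B\<close> of
  positive measure less than \<open>1 / n\<close>. On \<open>A\<close> the first \<open>n\<close>
  iterates form the whole orbit, so the set \<open>C\<close> of points of \<open>A\<close> whose
  orbit meets \<open>B\<close> is strictly invariant. Its measure lies between that of
  \<open>B\<close> and \<open>n\<close> times that, hence strictly between 0 and 1.\<close>

lemma periodic_null:
  assumes n: "0 < n"
  shows "AE x in M. (T ^^ n) x \<noteq> x"
proof -
  have T_inj: "T x = T y \<longleftrightarrow> x = y" if "x \<in> space M" "y \<in> space M" for x y
    using bij_T that by (auto simp: bij_betw_def inj_on_def)
  have [measurable]: "(\<lambda>x. (T ^^ k) x) \<in> measurable M M" for k by (rule T_funpow_meas)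
  define A where "A = {x \<in> space M. (T ^^ n) x = x}"
  have "A = {x \<in> space M. \<phi> ((T ^^ n) x) = \<phi> x}" unfolding A_def using phi_eq_iff by auto
  also have "\<dots> \<in> sets M" by measurable
  finally have A [measurable]: "A \<in> sets M" .
  have "T -` A \<inter> space M = A"
    unfolding A_def using T_inj by (auto simp: funpow_swap1[symmetric])
  then have "prob A = 0 \<or> prob A = 1" using erg A by (auto simp: ergodic_def)
  moreover have "prob A \<noteq> 1"
  proof
    assume A1: "prob A = 1"
    obtain k where k: "(1 / 2) ^ k < 1 / real n"
      using real_arch_pow_inv[of "1 / real n" "1 / 2"] n by auto
    obtain B where B: "B \<in> sets M" "0 < prob B" "prob B \<le> (1 / 2) ^ k"
      using non_atomic_small_set[OF non_atomic] by blast
    note [measurable] = B(1)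
    define C where "C = {x \<in> A. \<exists>j<n. (T ^^ j) x \<in> B}"
    have "C = A \<inter> (\<Union>j<n. (T ^^ j) -` B \<inter> space M)" by (auto simp: C_def A_def)
    then have C_sets: "C \<in> sets M" using measurable_sets[OF T_funpow_meas B(1)] A by auto
    \<comment> \<open>On \<open>A\<close> the times are cyclic modulo \<open>n\<close>: time
      \<open>n\<close> counts as time 0.\<close>
    have shift: "(\<exists>j<n. (T ^^ j) (T x) \<in> B) \<longleftrightarrow> (\<exists>j<n. (T ^^ j) x \<in> B)" if x: "x \<in> A" for x
    proof
      assume "\<exists>j<n. (T ^^ j) (T x) \<in> B"
      then obtain j where j: "j < n" "(T ^^ Suc j) x \<in> B" by (auto simp: funpow_swap1)
      show "\<exists>j<n. (T ^^ j) x \<in> B"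
      proof (cases "Suc j = n")
        case True
        then have "(T ^^ 0) x \<in> B" using j x by (simp add: A_def)
        then show ?thesis using n by blast
      next
        case False
        then have "Suc j < n" using j by simp
        then show ?thesis using j by blast
      qed
    next
      assume "\<exists>j<n. (T ^^ j) x \<in> B"
      then obtain j where j: "j < n" "(T ^^ j) x \<in> B" by auto
      show "\<exists>j<n. (T ^^ j) (T x) \<in> B"
      proof (cases j)
        case 0
        then have "(T ^^ Suc (n - 1)) x \<in> B" using j x n by (simp add: A_def del: funpow.simps)
        then have "(T ^^ (n - 1)) (T x) \<in> B" by (simp add: funpow_swap1)
        then show ?thesis using n by (intro exI[of _ "n - 1"]) auto
      next
        case (Suc i)
        then have "(T ^^ i) (T x) \<in> B" using j by (simp add: funpow_swap1)
        then show ?thesis using j Suc by (intro exI[of _ i]) auto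
      qed
    qed
    have TA: "x \<in> space M \<Longrightarrow> T x \<in> A \<longleftrightarrow> x \<in> A" for x
      using \<open>T -` A \<inter> space M = A\<close> by blast
    have "T -` C \<inter> space M = C"
      using TA shift A_def by (auto simp: C_def)
    then have "prob C = 0 \<or> prob C = 1" using erg C_sets by (auto simp: ergodic_def)
    moreover have "prob B \<le> prob C"
    proof -
      have "prob B = prob (B \<inter> A)"
      proof (rule finite_measure_eq_AE)
        have "AE x in M. x \<in> A" using A1 A by (simp add: prob_eq_1)
        then show "AE x in M. (x \<in> B) = (x \<in> B \<inter> A)" by eventually_elim auto
      qed measurable
      also have "\<dots> \<le> prob C"
        by (rule finite_measure_mono[OF _ C_sets]) (use n in \<open>auto simp: C_def intro!: exI[of _ 0]\<close>)
      finally show ?thesis .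
    qed
    moreover have "prob C \<le> n * prob B"
    proof -
      have "prob C \<le> prob (\<Union>j\<in>{..<n}. (T ^^ j) -` B \<inter> space M)"
        using measurable_sets[OF T_funpow_meas B(1)] by (intro finite_measure_mono) (auto simp: C_def A_def)
      also have "\<dots> \<le> (\<Sum>j<n. prob ((T ^^ j) -` B \<inter> space M))"
        using measurable_sets[OF T_funpow_meas B(1)] by (intro finite_measure_subadditive_finite) auto
      also have "\<dots> = (\<Sum>j<n. prob B)"
      proof (rule sum.cong[OF refl])
        fix j
        show "prob ((T ^^ j) -` B \<inter> space M) = prob B"
          using measure_distr[OF T_funpow_meas B(1), of j] by (simp add: distr_T_funpow)
      qed
      finally show ?thesis by simp
    qed
    moreover have "n * prob B < 1"
    proof -
      have "prob B < 1 / real n" using B(3) k by linarith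
      then show ?thesis using n by (simp add: field_simps)
    qed
    ultimately show False using B(2) by linarith
  qed
  ultimately have "AE x in M. x \<notin> A" using A by (simp add: prob_eq_0)
  then show ?thesis using AE_space by eventually_elim (auto simp: A_def)
qed

lemma aperiodic: "AE x in M. \<forall>k. k \<noteq> 0 \<longrightarrow> ipow M T k x \<noteq> x"
proof -
  have "AE x in M. \<forall>n. 0 < n \<longrightarrow> (T ^^ n) x \<noteq> x"
    unfolding AE_all_countable using periodic_null by auto
  then show ?thesis using AE_space
  proof eventually_elim
    case (elim x)
    show ?case
    proof (intro allI impI notI)
      fix k :: int assume k: "k \<noteq> 0" "ipow M T k x = x"
      have "ipow M T (- k) x = x" using ipow_add[of x "- k" k] elim(2) k by simp
      then have "ipow M T (int (nat \<bar>k\<bar>)) x = x" using k by (auto simp: abs_if)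
      then have "(T ^^ nat \<bar>k\<bar>) x = x" unfolding ipow_of_nat .
      then show False using elim(1) k(1) by simp
    qed
  qed
qed

end

section \<open>Aperiodicity of the flow\<close>

context suspension
begin

lemma AE_N_fst:
  assumes "AE x in M. Q x"
  shows "AE z in N. Q (fst z)"
proof -
  obtain B where B: "B \<in> null_sets M" "{x \<in> space M. \<not> Q x} \<subseteq> B"
    using assms by (auto simp: eventually_ae_filter)
  have [measurable]: "B \<in> sets M" using B by auto
  let ?B = "fst -` B \<inter> space N"
  have S: "?B \<in> sets N" by (rule measurable_sets[OF fst_N]) measurable
  have "emeasure N ?B = (\<integral>\<^sup>+z. indicator ?B z \<partial>N)"
    using S by simp
  also have "\<dots> = (\<integral>\<^sup>+x. \<integral>\<^sup>+s. indicator ?B (flow_pt x s) * indicator {0..<f x} s \<partial>lborel \<partial>M)"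
    by (rule nn_integral_N[OF borel_measurable_indicator[OF S]])
  also have "\<dots> = (\<integral>\<^sup>+x. 0 \<partial>M)"
  proof (rule nn_integral_cong_AE)
    have "AE x in M. x \<notin> B" using B(1) by (rule AE_not_in)
    then show "AE x in M. (\<integral>\<^sup>+s. indicator ?B (flow_pt x s) * indicator {0..<f x} s \<partial>lborel) = 0"
      using AE_space
    proof eventually_elim
      case (elim x)
      have "indicator ?B (flow_pt x s) * indicator {0..<f x} s = (0::ennreal)" for s
        using elim flow_pt_base[of x s] by (auto simp: indicator_def sf_space_def)
      then show ?case by (simp only: nn_integral_const mult_zero_left)
    qed
  qed
  finally have "emeasure N ?B = 0" by simp
  then have "AE z in N. z \<notin> ?B" using S by (intro AE_not_in) auto
  then show ?thesis using AE_space
  proof eventually_elim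
    case (elim z)
    then have "fst z \<in> space M" "fst z \<notin> B" by (auto simp: sf_space_def)
    then show ?case using B(2) by blast
  qed
qed

text \<open>A return to \<open>z\<close> forces the base point to return after \<open>n\<close>
  steps of \<open>T\<close>. Aperiodicity gives \<open>n = 0\<close>, so the orbit never left its
  fibre and the equality of heights yields \<open>t = 0\<close>.\<close>

lemma flow_aperiodic:
  assumes z: "z \<in> \<Omega>" and ap: "\<forall>k. k \<noteq> 0 \<longrightarrow> ipow M T k (fst z) \<noteq> fst z"
    and t: "fl t z = z"
  shows "t = 0"
proof -
  define n where "n = idx (fst z) (snd z + t)"
  have "ipow M T n (fst z) = fst z" "snd z + t - cc n (fst z) = snd z"
    using t unfolding fl_eq flow_pt_def n_def[symmetric] by (metis fst_conv, metis snd_conv)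
  then show ?thesis using ap by (cases "n = 0") auto
qed

end

lemma standard_borel_injection:
  assumes "standard_borel_space M"
  obtains \<phi> :: "'a \<Rightarrow> real" where "\<phi> \<in> borel_measurable M" "inj_on \<phi> (space M)"
proof -
  obtain B :: "real set" and \<phi> \<psi> where B: "\<phi> \<in> measurable M (restrict_space borel B)"
    and inv: "\<forall>x\<in>space M. \<psi> (\<phi> x) = x"
    using assms unfolding standard_borel_space_def by blast
  have "\<phi> \<in> borel_measurable M"
    using measurable_compose[OF B measurable_restrict_space1[OF measurable_ident]] by (simp add: id_def)
  moreover have "inj_on \<phi> (space M)" using inv by (intro inj_on_inverseI[of _ \<psi>]) auto
  ultimately show ?thesis by (rule that)
qed

section \<open>Non-reversibility\<close>

text \<open>\<open>N\<close> is not normalised; its total mass is divided out at the end of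
  \<open>reversal_mass_bound\<close>.\<close>

lemma (in suspension) measure_N_pos: "0 < measure N (space N)"
proof -
  have "ennreal c = (\<integral>\<^sup>+x. ennreal c \<partial>M)" by (simp add: emeasure_space_1)
  also have "\<dots> \<le> (\<integral>\<^sup>+x. \<integral>\<^sup>+s. 1 * indicator {0..<f x} s \<partial>lborel \<partial>M)"
  proof (rule nn_integral_mono)
    fix x assume "x \<in> space M"
    then show "ennreal c \<le> (\<integral>\<^sup>+s. 1 * indicator {0..<f x} s \<partial>lborel)"
      using f_ge[of x] c_pos by (simp add: ennreal_leI)
  qed
  also have "\<dots> = emeasure N (space N)"
    by (subst nn_integral_N[symmetric]) auto
  finally have "ennreal c \<le> ennreal (measure N (space N))" by (simp add: N.emeasure_eq_measure)
  then show ?thesis using c_pos by simp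
qed

text \<open>\<open>E\<close> is the complement of the triples lying on one orbit with a value of xi
  in \<open>F\<close>. Past triples almost surely avoid \<open>E\<close>. A future triple with
  \<open>u - 2 * v\<close> in \<open>D\<close> falls into \<open>E\<close>: its value is the
  negative, which is outside \<open>F\<close>, and aperiodicity leaves no other value. The bound is
  \<open>reversal_inequality\<close> for this \<open>E\<close>.\<close>

lemma (in reversible_suspension) reversal_mass_bound:
  fixes \<phi> :: "'a \<Rightarrow> real"
  assumes phi [measurable]: "\<phi> \<in> borel_measurable M" and inj: "inj_on \<phi> (space M)"
    and ap: "AE x in M. \<forall>k. k \<noteq> 0 \<longrightarrow> ipow M T k x \<noteq> x"
    and F: "countable F" "AE p in P. fst p - 2 * snd p \<in> F"
    and D: "D \<in> sets borel" "\<And>d. d \<in> D \<Longrightarrow> - d \<notin> F"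
  shows "\<alpha> * (1 + measure P {p \<in> space P. fst p - 2 * snd p \<in> D}) \<le> 1"
proof -
  \<comment> \<open>If the second point lies over \<open>ipow M T k x\<close>, where
    \<open>x\<close> is the base point of the first, then flowing backwards from the first point for
    the time \<open>t1 k z\<close> leads to the second; \<open>t2\<close> does the same for the
    third point.\<close>
  define t1 where "t1 k z = snd (fst z) - cc k (fst (fst z)) - snd (fst (snd z))"
    for k and z :: "'a triple"
  define t2 where "t2 k z = snd (fst z) - cc k (fst (fst z)) - snd (snd (snd z))"
    for k and z :: "'a triple"
  define R where "R k l z \<longleftrightarrow> \<phi> (fst (fst (snd z))) = \<phi> (ipow M T k (fst (fst z))) \<and>
     \<phi> (fst (snd (snd z))) = \<phi> (ipow M T l (fst (fst z))) \<and> t2 l z - 2 * t1 k z \<in> F"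
    for k l and z :: "'a triple"
  \<comment> \<open>Running over all pairs of integers makes \<open>E\<close> a countable
    combination of measurable conditions. A triple may admit several pairs; uniqueness of the times
    is available, and used, only on aperiodic orbits.\<close>
  define E where "E = {z \<in> space Tri. \<not> (\<exists>k l. R k l z)}"
  have [measurable]: "F \<in> sets borel" using F(1) by (rule sets.countable[rotated]) auto
  have [measurable]: "t1 k \<in> borel_measurable Tri" "t2 k \<in> borel_measurable Tri" for k
    unfolding t1_def[abs_def] t2_def[abs_def] by measurable
  have [measurable]: "Measurable.pred Tri (R k l)" for k l
    unfolding R_def by measurable
  have E [measurable]: "E \<in> sets Tri" unfolding E_def by measurable
  have phi_iff: "\<phi> x = \<phi> y \<longleftrightarrow> x = y" if "x \<in> space M" "y \<in> space M" for x y
    using inj that by (auto simp: inj_on_def)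
  have fst_in: "fst z \<in> space M" if "z \<in> \<Omega>" for z using that by (auto simp: sf_space_def)
  have on_F: "(z, fl (- v) z, fl (- u) z) \<notin> E" if z: "z \<in> \<Omega>" and uv: "u - 2 * v \<in> F" for z u v
  proof -
    have "R (idx (fst z) (snd z - v)) (idx (fst z) (snd z - u)) (z, fl (- v) z, fl (- u) z)"
      using uv by (simp add: R_def t1_def t2_def fl_eq flow_pt_def)
    then show ?thesis by (auto simp: E_def)
  qed
  have off_F: "(fl u z, fl v z, z) \<in> E"
    if z: "z \<in> \<Omega>" and apz: "\<forall>k. k \<noteq> 0 \<longrightarrow> ipow M T k (fst z) \<noteq> fst z" and uv: "u - 2 * v \<in> D" for z u v
  proof -
    have "\<not> R k l (fl u z, fl v z, z)" for k l
    proof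
      let ?z = "(fl u z, fl v z, z)"
      assume R: "R k l ?z"
      \<comment> \<open>A point over the base orbit of the first point is that point moved back by
        the time read off from the two heights and the cocycle.\<close>
      have recover: "w = fl (- (snd (fl u z) - cc j (fst (fl u z)) - snd w)) (fl u z)"
        if w: "w \<in> \<Omega>" and j: "fst w = ipow M T j (fst (fl u z))" for w j
      proof -
        have "fl (- (snd (fl u z) - cc j (fst (fl u z)) - snd w)) (fl u z) = flow_pt (fst (fl u z)) (snd w + cc j (fst (fl u z)))"
          by (simp add: fl_eq[of _ "fl u z"] algebra_simps)
        also have "\<dots> = flow_pt (fst w) (snd w)"
          using flow_pt_shift[of "fst (fl u z)" j "snd w + cc j (fst (fl u z))"] fst_in[OF fl_in[OF z, of u]] j by simp
        also have "\<dots> = w" using w flow_pt_base[of "fst w" "snd w"] by simp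
        finally show ?thesis ..
      qed
      note in1 = fst_in[OF fl_in[OF z, of u]] fst_in[OF fl_in[OF z, of v]] fst_in[OF z]
      have "fst (fl v z) = ipow M T k (fst (fl u z))" "fst z = ipow M T l (fst (fl u z))"
        using R phi_iff in1 by (auto simp: R_def)
      from recover[OF fl_in[OF z] this(1)] recover[OF z this(2)]
      have 1: "fl v z = fl (- t1 k ?z) (fl u z)" and 2: "z = fl (- t2 l ?z) (fl u z)"
        by (simp_all add: t1_def t2_def)
      have "fl (u - t2 l ?z) z = z" using 2 fl_fl[OF z, of "- t2 l ?z" u] by simp
      then have t2: "t2 l ?z = u" using flow_aperiodic[OF z apz] by fastforce
      have "fl v z = fl (u - t1 k ?z) z" using 1 fl_fl[OF z, of "- t1 k ?z" u] by simp
      then have "fl (u - t1 k ?z - v) z = fl (- v) (fl v z)"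
        using fl_fl[OF z, of "- v" "u - t1 k ?z"] by simp
      also have "\<dots> = z" using fl_fl[OF z, of "- v" v] fl_0[OF z] by simp
      finally have t1: "t1 k ?z = u - v" using flow_aperiodic[OF z apz] by fastforce
      \<comment> \<open>Here \<open>t2 - 2 * t1\<close> is \<open>u - 2 * (u - v)\<close>: this is
        the change of sign under reversal.\<close>
      have "- (u - 2 * v) \<in> F" using R t1 t2 by (simp add: R_def algebra_simps)
      then show False using D(2)[OF uv] by simp
    qed
    then show ?thesis using z by (simp add: E_def space_pair_measure)
  qed
  have bdE: "\<bar>indicat_real E z\<bar> \<le> 1" for z by (auto simp: indicator_def)
  have mE: "indicat_real E \<in> borel_measurable Tri" by measurable
  have zero: "(LINT p|P. LINT z|N. indicat_real E (past p z)) = 0"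
  proof -
    have "AE p in P. (LINT z|N. indicat_real E (past p z)) = 0"
      using F(2)
    proof eventually_elim
      case (elim p)
      have "(LINT z|N. indicat_real E (past p z)) = (LINT z|N. 0)"
        by (rule Bochner_Integration.integral_cong) (use on_F elim in auto)
      then show ?case by simp
    qed
    then have "(LINT p|P. LINT z|N. indicat_real E (past p z)) = (LINT p|P. 0)"
      using integrable_P_flow(1)[OF mE bdE] by (intro integral_cong_AE) auto
    then show ?thesis by simp
  qed
  define N0 where "N0 = measure N (space N)"
  let ?D = "{p \<in> space P. fst p - 2 * snd p \<in> D}"
  note [measurable] = D(1)
  have D_sets: "?D \<in> sets P" by measurable
  have "N0 * measure P ?D = (LINT p|P. N0 * indicator ?D p)"
    using sets.sets_into_space[OF D_sets] by (simp add: Int_absorb2)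
  also have "\<dots> \<le> (LINT p|P. LINT z|N. indicat_real E (future p z))"
  proof (rule integral_mono)
    show "integrable P (\<lambda>p. N0 * indicator ?D p)" using D_sets by (auto simp: P.emeasure_eq_measure)
    show "integrable P (\<lambda>p. LINT z|N. indicat_real E (future p z))"
      by (rule integrable_P_flow(2)[OF mE bdE])
    fix p assume p: "p \<in> space P"
    show "N0 * indicator ?D p \<le> (LINT z|N. indicat_real E (future p z))"
    proof (cases "p \<in> ?D")
      case True
      have "(LINT z|N. indicat_real E (future p z)) = (LINT z|N. 1)"
      proof (rule integral_cong_AE)
        show "AE z in N. indicat_real E (future p z) = 1"
          using AE_N_fst[OF ap] AE_space
          by eventually_elim (use True off_F in auto)
      qed measurable
      then show ?thesis using True by (simp add: N0_def)
    qed simp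
  qed
  finally have "\<alpha> * (N0 * measure P ?D) \<le> \<alpha> * (LINT p|P. LINT z|N. indicat_real E (future p z))"
    using alpha_pos by simp
  then have "\<alpha> * (N0 * measure P ?D) + \<alpha> * N0 \<le> N0"
    using reversal_inequality[OF E] unfolding zero N0_def[symmetric] by simp
  then have "(\<alpha> * (1 + measure P ?D)) * N0 \<le> 1 * N0" by (simp add: algebra_simps)
  then show ?thesis using measure_N_pos unfolding N0_def by (simp only: mult_le_cancel_right_pos)
qed

theorem theorem4p4:
  fixes M :: "'a measure" and T :: "'a \<Rightarrow> 'a" and f :: "'a \<Rightarrow> real"
    and c :: real and W :: "nat \<Rightarrow> 'a set" and q :: "nat \<Rightarrow> nat" and a :: "nat \<Rightarrow> real"
    and \<alpha> :: real and P :: "(real \<times> real) measure"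
    and m :: nat and cc :: "nat \<Rightarrow> real" and d :: "nat \<Rightarrow> real"
  assumes prob: "prob_space M"
    and std: "standard_borel_space M"
    and nonatomic: "non_atomic M"
    and aut: "mp_automorphism M T"
    and erg: "ergodic M T"
    and f_meas: "f \<in> borel_measurable M"
    and f_L2: "integrable M (\<lambda>x. (f x)\<^sup>2)"
    and c_pos: "0 < c" and f_ge: "\<forall>x\<in>space M. c \<le> f x"
    and W_sets: "\<forall>n. W n \<in> sets M"
    and q_incr: "strict_mono q"
    and alpha: "0 < \<alpha>" "\<alpha> \<le> 1"
    and P_prob: "prob_space P" and P_sets: "sets P = sets borel"
    and C1: "(\<lambda>n. measure M (W n)) \<longlonglongrightarrow> \<alpha>"
    and C2: "(\<lambda>n. measure M (sym_diff (W n) (T -` W n \<inter> space M))) \<longlonglongrightarrow> 0"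
    and C3: "rigidity_along M T q W"
    and C4: "rigidity_along M T (\<lambda>n. 2 * q n) W"
    and C5: "\<exists>B. \<forall>n. (LINT x:W n|M. \<bar>cocycle M T f (int (q n)) x - a n\<bar>\<^sup>2) \<le> B"
    and C6: "\<exists>B. \<forall>n. (LINT x:W n|M. \<bar>cocycle M T f (int (2 * q n)) x - 2 * a n\<bar>\<^sup>2) \<le> B"
    and C7: "weak_conv_measures
               (\<lambda>n. distr (uniform_measure M (W n)) borel
                  (\<lambda>x. (cocycle M T f (int (2 * q n)) x - 2 * a n,
                        cocycle M T f (int (q n)) x - a n)))
               P"
    and xi_discrete: "\<forall>A\<in>sets borel.
        measure (distr P borel (\<lambda>(x, y). x - 2 * y)) A = (\<Sum>i\<le>m. cc i * indicator A (d i))"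
    and cc_nonneg: "\<forall>i\<le>m. 0 \<le> cc i"
    and d0: "d 0 = 0"
    and mass: "(\<Sum>i\<in>{1..m}. cc i) > (1 - \<alpha>) / \<alpha>"
    and d_sym: "\<forall>i\<le>m. \<forall>j\<le>m. i \<noteq> j \<longrightarrow> d i \<noteq> - d j"
  shows "\<not> special_flow_iso_inverse M T f"
proof
  assume "special_flow_iso_inverse M T f"
  then obtain S where S: "S \<in> measurable (sf_measure M f) (sf_measure M f)"
    "distr (sf_measure M f) (sf_measure M f) S = sf_measure M f"
    "\<And>t. AE z in sf_measure M f. special_flow M T f t (S z) = S (special_flow M T f (- t) z)"
    unfolding special_flow_iso_inverse_def Let_def by blast
  obtain \<phi> :: "'a \<Rightarrow> real" where \<phi>: "\<phi> \<in> borel_measurable M" "inj_on \<phi> (space M)"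
    using standard_borel_injection[OF std] by blast
  interpret M: prob_space M by (rule prob)
  interpret P: prob_space P by (rule P_prob)
  have f_int: "integrable M f"
    by (rule M.square_integrable_imp_integrable[OF f_meas f_L2])
  interpret separated_ergodic_system M T \<phi>
    by unfold_locales (use aut erg \<phi> nonatomic in auto)
  interpret reversible_suspension M T f c W q a \<alpha> P S
    by unfold_locales (use assms f_int S in auto)
  let ?\<xi> = "\<lambda>(x, y). x - 2 * y :: real"
  have \<xi>_meas: "?\<xi> \<in> borel_measurable P" by measurable
  have \<xi>_prob: "measure P {p \<in> space P. fst p - 2 * snd p \<in> A} = (\<Sum>i\<le>m. cc i * indicator A (d i))"
    if A: "A \<in> sets borel" for A
  proof -
    have "measure P (?\<xi> -` A \<inter> space P) = (\<Sum>i\<le>m. cc i * indicator A (d i))"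
      using xi_discrete A measure_distr[OF \<xi>_meas A] by simp
    moreover have "?\<xi> -` A \<inter> space P = {p \<in> space P. fst p - 2 * snd p \<in> A}" by auto
    ultimately show ?thesis by simp
  qed
  \<comment> \<open>\<open>?D\<close> leaves out the atom 0, which is its own negative and so would
    violate the condition that negatives of points of \<open>?D\<close> lie outside
    \<open>?F\<close>.\<close>
  let ?F = "d ` {..m}" and ?D = "d ` {1..m}"
  have sets: "?F \<in> sets borel" "?D \<in> sets borel" by (auto intro!: borel_closed finite_imp_closed)
  have total: "(\<Sum>i\<le>m. cc i) = 1"
    using \<xi>_prob[of UNIV] P.prob_space by simp
  have "measure P {p \<in> space P. fst p - 2 * snd p \<in> ?F} = (\<Sum>i\<le>m. cc i)"
    unfolding \<xi>_prob[OF sets(1)] by (intro sum.cong) auto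
  then have PF: "AE p in P. fst p - 2 * snd p \<in> ?F"
    using total P.AE_in_set_eq_1[of "{p \<in> space P. fst p - 2 * snd p \<in> ?F}"] sets by simp
  have d_ne: "d i \<noteq> 0" if "i \<in> {1..m}" for i
    using d_sym[rule_format, of i 0] d0 that by auto
  have PD: "measure P {p \<in> space P. fst p - 2 * snd p \<in> ?D} = (\<Sum>i\<in>{1..m}. cc i)"
  proof -
    \<comment> \<open>The index 0 drops out because no \<open>d i\<close> with
      \<open>i \<ge> 1\<close> equals \<open>d 0 = 0\<close>.\<close>
    have "(\<Sum>i\<le>m. cc i * indicator ?D (d i)) = (\<Sum>i\<in>{1..m}. cc i * indicator ?D (d i))"
    proof (rule sum.mono_neutral_right)
      show "\<forall>i\<in>{..m} - {1..m}. cc i * indicator ?D (d i) = 0"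
      proof
        fix i assume "i \<in> {..m} - {1..m}"
        then have "i = 0" by auto
        then show "cc i * indicator ?D (d i) = 0" using d0 d_ne by (auto simp: indicator_def)
      qed
    qed auto
    also have "\<dots> = (\<Sum>i\<in>{1..m}. cc i)" by (intro sum.cong) auto
    finally show ?thesis unfolding \<xi>_prob[OF sets(2)] .
  qed
  have DF: "- e \<notin> ?F" if e: "e \<in> ?D" for e
  proof
    assume "- e \<in> ?F"
    then obtain i j where ij: "i \<in> {1..m}" "e = d i" "j \<le> m" "- e = d j" using e by auto
    then have "d i = - d j" by linarith
    \<comment> \<open>Different indices are excluded by \<open>d_sym\<close>; for equal ones the
      equation would mean \<open>d i = 0\<close>.\<close>
    then have "i = j" using d_sym[rule_format, of i j] ij by auto
    then show False using \<open>d i = - d j\<close> d_ne[OF ij(1)] by simp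
  qed
  have "\<alpha> * (1 + (\<Sum>i\<in>{1..m}. cc i)) \<le> 1"
    using reversal_mass_bound[OF \<phi> aperiodic _ PF sets(2) DF] unfolding PD by (auto intro: countable_finite)
  moreover have "1 - \<alpha> < \<alpha> * (\<Sum>i\<in>{1..m}. cc i)"
    using mass alpha by (simp add: pos_divide_less_eq mult.commute)
  ultimately show False by (simp add: distrib_left)
qed

end
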